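(* Let $n\in\mathbb{N}$, let $s_1,s_2\in\mathbb{R}$, and let $a\in ES^m(\mathbb{Z}^n\times\mathbb{T}^n)$ (an elliptic symbol of order $m$), where $m\in\mathbb{R}$ satisfies $m>s_1-s_2$. Let $$A\colon \operatorname{Dom}(A)\subseteq H^{s_1}(\mathbb{Z}^n)\to H^{s_2}(\mathbb{Z}^n),\qquad Au:=T_au,\quad \operatorname{Dom}(A)=\mathcal{S}(\mathbb{Z}^n),$$ and $$A^{\dagger}\colon \operatorname{Dom}(A^{\dagger})\subseteq H^{-s_2}(\mathbb{Z}^n)\to H^{-s_1}(\mathbb{Z}^n),\qquad A^{\dagger}u:=(T_a)^{\dagger}u,\quad \operatorname{Dom}(A^{\dagger})=\mathcal{S}(\mathbb{Z}^n),$$ where $(T_a)^\dagger$ is the formal adjoint of the pseudo-differential operator $T_a$ on $\mathcal{S}(\mathbb{Z}^n)$. Then $A$ and $A^{\dagger}$ form an essentially adjoint pair, that is, $\widetilde{A}=(A^{\dagger})'$ and $\widetilde{A^{\dagger}}=A'$, where $\widetilde{\ \cdot\ }$ denotes closure and $'$ denotes the true (operator-theoretic) adjoint, the anti-dual of $H^{s_j}(\mathbb{Z}^n)$ being identified with $H^{-s_j}(\mathbb{Z}^n)$, $j=1,2$.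
   Context: Notation. $\mathbb{T}^n=\mathbb{R}^n/\mathbb{Z}^n$, $|k|$ is the Euclidean norm of $k\in\mathbb{Z}^n$, $\mathbb{N}_0=\{0,1,2,\dots\}$. For $u$ on $\mathbb{Z}^n$, $\Delta_{k_j}u(k):=u(k+e_j)-u(k)$ ($e_j$ the $j$-th standard unit vector) and $\Delta_k^{\alpha}:=\Delta_{k_1}^{\alpha_1}\cdots\Delta_{k_n}^{\alpha_n}$ for $\alpha\in\mathbb{N}_0^n$. On $\mathbb{T}^n$, $D_{x_j}^{(l)}:=\prod_{r=0}^{l-1}\left(\frac{1}{2\pi i}\frac{\partial}{\partial x_j}-r\right)$ for $l\in\mathbb{N}$, $D_{x_j}^{(0)}:=1$, and $D_x^{(\beta)}:=D_{x_1}^{(\beta_1)}\cdots D_{x_n}^{(\beta_n)}$ for $\beta\in\mathbb{N}_0^n$. Symbols. For $m\in\mathbb{R}$, $S^m(\mathbb{Z}^n\times\mathbb{T}^n)$ is the set of $a\colon\mathbb{Z}^n\times\mathbb{T}^n\to\mathbb{C}$ such that $a(k,\cdot)\in C^\infty(\mathbb{T}^n)$ for all $k$ and, for all $\alpha,\beta\in\mathbb{N}_0^n$, there is $C_{\alpha,\beta}>0$ with $|D_x^{(\beta)}\Delta_k^{\alpha}a(k,x)|\le C_{\alpha,\beta}(1+|k|)^{m-|\alpha|}$ for all $(k,x)$. $ES^m(\mathbb{Z}^n\times\mathbb{T}^n)$ is the set of $a\in S^m(\mathbb{Z}^n\times\mathbb{T}^n)$ for which there are constants $C>0$, $R>0$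 with $|a(k,x)|\ge C(1+|k|)^m$ for all $x\in\mathbb{T}^n$ and all $k$ with $|k|>R$. Schwartz space and operators. $\mathcal{S}(\mathbb{Z}^n)$ is the space of $u\colon\mathbb{Z}^n\to\mathbb{C}$ with $\sup_k|k^\alpha(\Delta_k^\beta u)(k)|<\infty$ for all $\alpha,\beta\in\mathbb{N}_0^n$; $\mathcal{S}'(\mathbb{Z}^n)$ is the space of continuous linear functionals on it (tempered distributions). $(u,v):=\sum_{k}u(k)\overline{v(k)}$ is the inner product of $\ell^2(\mathbb{Z}^n)$, with norm $\|\cdot\|$. $\widehat{u}(x):=\sum_{k}e^{-2\pi i k\cdot x}u(k)$. For $a\in S^m(\mathbb{Z}^n\times\mathbb{T}^n)$, $(T_au)(k):=\int_{\mathbb{T}^n}e^{2\pi i k\cdot x}a(k,x)\widehat{u}(x)\,dx$ for $u\in\mathcal{S}(\mathbb{Z}^n)$; $T_a$ maps $\mathcal{S}(\mathbb{Z}^n)$ continuously into itself. Its formal adjoint $(T_a)^\dagger\colon\mathcal{S}(\mathbb{Z}^n)\to\mathcal{S}(\mathbb{Z}^n)$ is defined by $(T_au,v)=(u,(T_a)^\dagger v)$ for all $u,v\in\mathcal{S}(\mathbb{Z}^n)$. $T_a$ extends to $\mathcal{S}'(\mathbb{Z}^n)$ by $(T_aF)(\overline{u}):=F(\overline{T_a^\dagger u})$. Sobolev spaces. With $\Lambda_s(k):=(1+|k|^2)^{s/2}$, $H^s(\mathbb{Z}^n):=\{u\in\mathcal{S}'(\mathbb{Z}^n)\colon T_{\Lambda_s}u\in\ell^2(\mathbb{Z}^n)\}$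 with norm $\|u\|_{H^s}:=\|T_{\Lambda_s}u\|$; concretely, it is the weighted sequence space with $\|u\|_{H^s}^2=\sum_k(1+|k|^2)^s|u(k)|^2$. $\mathcal{S}(\mathbb{Z}^n)$ is dense in every $H^s(\mathbb{Z}^n)$. The form $(\cdot,\cdot)$ extends to a continuous sesquilinear pairing $H^{-s}(\mathbb{Z}^n)\times H^{s}(\mathbb{Z}^n)\to\mathbb{C}$, and $f\mapsto(f,\cdot)$ identifies $H^{-s}(\mathbb{Z}^n)$ with the anti-dual of $H^s(\mathbb{Z}^n)$ (the space of continuous anti-linear functionals). Adjoints. For a Hilbert space $\mathscr{H}$, $(\overline{\mathscr{H}})'$ is its anti-dual. For densely defined $Y\colon\mathscr{H}_1\to\mathscr{H}_2$ and $Z\colon(\overline{\mathscr{H}_2})'\to(\overline{\mathscr{H}_1})'$ (operators need not be everywhere defined), with $\langle f,u\rangle_{d_j}$ denoting the action of $f\in(\overline{\mathscr{H}_j})'$ on $u\in\mathscr{H}_j$: the true adjoint $Y'\colon(\overline{\mathscr{H}_2})'\to(\overline{\mathscr{H}_1})'$ has $f\in\operatorname{Dom}(Y')$ and $Y'f=g$ iff $\langle f,Yu\rangle_{d_2}=\langle g,u\rangle_{d_1}$ for all $u\in\operatorname{Dom}(Y)$; the true adjoint $Z'\colon\mathscr{H}_1\to\mathscr{H}_2$ (using reflexivity) has $w\in\operatorname{Dom}(Z')$ and $Z'w=v$ iff $\langle Zf,w\rangle_{d_1}=\langle f,v\rangle_{d_2}$ for all $f\in\operatorname{Dom}(Z)$.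 $Y$ and $Z$ form an essentially adjoint pair if $\widetilde{Y}=Z'$ and $\widetilde{Z}=Y'$, where $\widetilde{G}$ is the closure of a closable operator $G$. Here $\mathscr{H}_j=H^{s_j}(\mathbb{Z}^n)$, $(\overline{\mathscr{H}_j})'=H^{-s_j}(\mathbb{Z}^n)$, $\langle f,u\rangle_{d_j}=(f,u)$, $Y=A$, $Z=A^\dagger$. *)

theory Defs
  imports "HOL-Analysis.Analysis"
begin

text \<open>
  \<open>n\<close> is \<open>CARD('n)\<close>; \<open>\<int>\<^sup>n\<close> is \<open>int ^ 'n\<close>. Functions on the torus are represented by functions on
  \<open>real ^ 'n\<close> of period 1 in each coordinate, and integration over the torus is integration over
  the unit cube.
\<close>

type_synonym 'n lattice_fun = "int ^ 'n \<Rightarrow> complex"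
type_synonym 'n lattice_symbol = "int ^ 'n \<Rightarrow> real ^ 'n \<Rightarrow> complex"

definition rvec :: "int ^ 'n \<Rightarrow> real ^ 'n" where
  "rvec k = (\<chi> j. real_of_int (k $ j))"

definition znorm :: "int ^ 'n \<Rightarrow> real" where
  "znorm k = norm (rvec k)"

definition mi_order :: "('n::finite \<Rightarrow> nat) \<Rightarrow> nat" where
  "mi_order \<alpha> = (\<Sum>j\<in>UNIV. \<alpha> j)"

text \<open>
  Products of operators over the coordinates are taken along an arbitrary enumeration. The choice
  is immaterial: the difference operators commute, and so do the partial derivatives on smooth
  functions.
\<close>

definition coords :: "'n::finite list" where
  "coords = (SOME js. distinct js \<and> set js = UNIV)"

definition fdiff :: "'n \<Rightarrow> 'n lattice_fun \<Rightarrow> 'n::finite lattice_fun" where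
  "fdiff j u = (\<lambda>k. u (k + axis j 1) - u k)"

definition mi_diff :: "('n \<Rightarrow> nat) \<Rightarrow> 'n lattice_fun \<Rightarrow> 'n::finite lattice_fun" where
  "mi_diff \<alpha> = foldr (\<lambda>j. fdiff j ^^ \<alpha> j) coords"

definition partial_deriv :: "'n::finite \<Rightarrow> (real ^ 'n \<Rightarrow> complex) \<Rightarrow> real ^ 'n \<Rightarrow> complex" where
  "partial_deriv j f x = vector_derivative (\<lambda>t. f (x + t *\<^sub>R axis j 1)) (at 0)"

primrec Dfall :: "'n::finite \<Rightarrow> nat \<Rightarrow> (real ^ 'n \<Rightarrow> complex) \<Rightarrow> real ^ 'n \<Rightarrow> complex" where
  "Dfall j 0 f = f"
| "Dfall j (Suc l) f =
     (\<lambda>x. 1 / (2 * of_real pi * \<i>) * partial_deriv j (Dfall j l f) x - of_nat l * Dfall j l f x)"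

definition mi_Dfall :: "('n::finite \<Rightarrow> nat) \<Rightarrow> (real ^ 'n \<Rightarrow> complex) \<Rightarrow> real ^ 'n \<Rightarrow> complex" where
  "mi_Dfall \<beta> = foldr (\<lambda>j. Dfall j (\<beta> j)) coords"

primrec C_diff :: "nat \<Rightarrow> (real ^ 'n::finite \<Rightarrow> complex) \<Rightarrow> bool" where
  "C_diff 0 f \<longleftrightarrow> continuous_on UNIV f"
| "C_diff (Suc r) f \<longleftrightarrow> (\<forall>x. f differentiable (at x)) \<and> (\<forall>j. C_diff r (partial_deriv j f))"

definition torus_smooth :: "(real ^ 'n::finite \<Rightarrow> complex) set" where
  "torus_smooth = {f. (\<forall>j x. f (x + axis j 1) = f x) \<and> (\<forall>r. C_diff r f)}"

definition symbols :: "real \<Rightarrow> 'n::finite lattice_symbol set" where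
  "symbols m = {a. (\<forall>k. a k \<in> torus_smooth) \<and>
     (\<forall>\<alpha> \<beta>. \<exists>C>0. \<forall>k x.
        cmod (mi_Dfall \<beta> (\<lambda>y. mi_diff \<alpha> (\<lambda>l. a l y) k) x)
          \<le> C * (1 + znorm k) powr (m - real (mi_order \<alpha>)))}"

definition elliptic_symbols :: "real \<Rightarrow> 'n::finite lattice_symbol set" where
  "elliptic_symbols m = {a \<in> symbols m.
     \<exists>C>0. \<exists>R>0. \<forall>k x. znorm k > R \<longrightarrow> cmod (a k x) \<ge> C * (1 + znorm k) powr m}"

definition schwartz :: "'n::finite lattice_fun set" where
  "schwartz = {u. \<forall>\<alpha> \<beta>. bdd_above (range (\<lambda>k.
     cmod ((\<Prod>j\<in>UNIV. of_int (k $ j) ^ \<alpha> j) * mi_diff \<beta> u k)))}"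

text \<open>
  The sesquilinear form of \<open>\<ell>\<^sup>2\<close>. The series converges absolutely whenever \<open>u\<close> and \<open>v\<close> lie in Sobolev
  spaces (defined below) of opposite orders, so the same formula is the extended pairing.
\<close>

definition pairing :: "'n::finite lattice_fun \<Rightarrow> 'n lattice_fun \<Rightarrow> complex" where
  "pairing u v = (\<Sum>\<^sub>\<infinity>k. u k * cnj (v k))"

definition fourier :: "'n::finite lattice_fun \<Rightarrow> real ^ 'n \<Rightarrow> complex" where
  "fourier u x = (\<Sum>\<^sub>\<infinity>k. exp (- 2 * of_real pi * \<i> * of_real (rvec k \<bullet> x)) * u k)"

definition pdo :: "'n::finite lattice_symbol \<Rightarrow> 'n lattice_fun \<Rightarrow> 'n lattice_fun" where
  "pdo a u k = integral (cbox 0 1)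
     (\<lambda>x. exp (2 * of_real pi * \<i> * of_real (rvec k \<bullet> x)) * a k x * fourier u x)"

definition formal_adjoint ::
    "('n::finite lattice_fun \<Rightarrow> 'n lattice_fun) \<Rightarrow> 'n lattice_fun \<Rightarrow> 'n lattice_fun" where
  "formal_adjoint T v =
     (THE w. w \<in> schwartz \<and> (\<forall>u\<in>schwartz. pairing (T u) v = pairing u w))"

definition l2 :: "'n::finite lattice_fun set" where
  "l2 = {u. (\<lambda>k. (cmod (u k))\<^sup>2) summable_on UNIV}"

definition l2_norm :: "'n::finite lattice_fun \<Rightarrow> real" where
  "l2_norm u = sqrt (\<Sum>\<^sub>\<infinity>k. (cmod (u k))\<^sup>2)"

text \<open>
  The operator with the \<open>x\<close>-independent symbol \<open>(1 + \<bar>k\<bar>\<^sup>2) powr (s/2)\<close> is multiplication by that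
  weight. A tempered distribution which it maps into \<open>\<ell>\<^sup>2\<close> is given by a function on the lattice, and
  conversely a function whose weighted version is in \<open>\<ell>\<^sup>2\<close> grows at most polynomially, hence is
  tempered; so the Sobolev spaces are weighted sequence spaces.
\<close>

definition bessel :: "real \<Rightarrow> 'n::finite lattice_fun \<Rightarrow> 'n lattice_fun" where
  "bessel s u = (\<lambda>k. of_real ((1 + (znorm k)\<^sup>2) powr (s / 2)) * u k)"

definition sobolev :: "real \<Rightarrow> 'n::finite lattice_fun set" where
  "sobolev s = {u. bessel s u \<in> l2}"

definition sobolev_norm :: "real \<Rightarrow> 'n::finite lattice_fun \<Rightarrow> real" where
  "sobolev_norm s u = l2_norm (bessel s u)"

text \<open>
  An operator is a partial function on lattice functions. The spaces between which it acts enter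
  through their orders: \<open>s t\<close> in front of \<open>Y\<close> means that \<open>Y\<close> is considered from \<open>sobolev s\<close> to
  \<open>sobolev t\<close>. The anti-dual of \<open>sobolev s\<close> is \<open>sobolev (- s)\<close>, acting by \<open>pairing f u\<close>.
\<close>

type_synonym 'n lattice_op = "'n lattice_fun \<rightharpoonup> 'n lattice_fun"

definition restricted_op ::
    "('n lattice_fun \<Rightarrow> 'n lattice_fun) \<Rightarrow> 'n lattice_fun set \<Rightarrow> 'n::finite lattice_op" where
  "restricted_op T D = (\<lambda>u. if u \<in> D then Some (T u) else None)"

definition densely_defined_op :: "real \<Rightarrow> real \<Rightarrow> 'n::finite lattice_op \<Rightarrow> bool" where
  "densely_defined_op s t Y \<longleftrightarrow>
     dom Y \<subseteq> sobolev s \<and> ran Y \<subseteq> sobolev t \<and>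
     (\<forall>u\<in>dom Y. \<forall>v\<in>dom Y. \<forall>c.
        Y (\<lambda>k. c * u k + v k) = Some (\<lambda>k. c * the (Y u) k + the (Y v) k)) \<and>
     (\<forall>u\<in>sobolev s. \<forall>\<epsilon>>0. \<exists>w\<in>dom Y. sobolev_norm s (\<lambda>k. w k - u k) < \<epsilon>)"

definition op_of_graph :: "('n lattice_fun \<times> 'n lattice_fun) set \<Rightarrow> 'n::finite lattice_op" where
  "op_of_graph G = (\<lambda>u. if u \<in> Domain G then Some (THE v. (u, v) \<in> G) else None)"

definition graph_closure ::
    "real \<Rightarrow> real \<Rightarrow> 'n::finite lattice_op \<Rightarrow> ('n lattice_fun \<times> 'n lattice_fun) set" where
  "graph_closure s t Y = {(u, v). u \<in> sobolev s \<and> v \<in> sobolev t \<and>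
     (\<exists>w. (\<forall>i::nat. w i \<in> dom Y) \<and>
        (\<lambda>i. sobolev_norm s (\<lambda>k. w i k - u k)) \<longlonglongrightarrow> 0 \<and>
        (\<lambda>i. sobolev_norm t (\<lambda>k. the (Y (w i)) k - v k)) \<longlonglongrightarrow> 0)}"

definition closable_op :: "real \<Rightarrow> real \<Rightarrow> 'n::finite lattice_op \<Rightarrow> bool" where
  "closable_op s t Y \<longleftrightarrow> single_valued (graph_closure s t Y)"

definition op_closure :: "real \<Rightarrow> real \<Rightarrow> 'n::finite lattice_op \<Rightarrow> 'n lattice_op" where
  "op_closure s t Y = op_of_graph (graph_closure s t Y)"

definition true_adjoint :: "real \<Rightarrow> real \<Rightarrow> 'n::finite lattice_op \<Rightarrow> 'n lattice_op" where
  "true_adjoint s t Y = op_of_graph {(f, g). f \<in> sobolev (- t) \<and> g \<in> sobolev (- s) \<and>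
     (\<forall>u\<in>dom Y. pairing f (the (Y u)) = pairing g u)}"

text \<open>
  The adjoint of an operator \<open>Z\<close> between the anti-duals, from \<open>sobolev (- t)\<close> to \<open>sobolev (- s)\<close>;
  by reflexivity it acts from \<open>sobolev s\<close> to \<open>sobolev t\<close>.
\<close>

definition true_adjoint_of_dual :: "real \<Rightarrow> real \<Rightarrow> 'n::finite lattice_op \<Rightarrow> 'n lattice_op" where
  "true_adjoint_of_dual s t Z = op_of_graph {(w, v). w \<in> sobolev s \<and> v \<in> sobolev t \<and>
     (\<forall>f\<in>dom Z. pairing (the (Z f)) w = pairing f v)}"

text \<open>
  The adjoints are single-valued because \<open>Y\<close> and \<open>Z\<close> are densely defined, the closures because
  \<open>Y\<close> and \<open>Z\<close> are closable; these implicit requirements are part of the definition.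
\<close>

definition essentially_adjoint_pair ::
    "real \<Rightarrow> real \<Rightarrow> 'n::finite lattice_op \<Rightarrow> 'n lattice_op \<Rightarrow> bool" where
  "essentially_adjoint_pair s t Y Z \<longleftrightarrow>
     densely_defined_op s t Y \<and> densely_defined_op (- t) (- s) Z \<and>
     closable_op s t Y \<and> closable_op (- t) (- s) Z \<and>
     op_closure s t Y = true_adjoint_of_dual s t Z \<and>
     op_closure (- t) (- s) Z = true_adjoint s t Y"

end

theory Submission
  imports Defs
begin

text \<open>
  On the lattice, \<open>T\<^sub>a\<close> is the infinite matrix whose \<open>(k, l)\<close> entry is the Fourier coefficient of
  \<open>a k\<close> at \<open>l - k\<close>; it decays rapidly off the diagonal and grows like \<open>\<bar>k\<bar> powr m\<close> along it. Such
  matrices are closed under adjoints and products, are bounded from \<open>H\<^sup>s\<close> to \<open>H\<^sup>s\<^sup>-\<^sup>m\<close>, and their formal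
  adjoint is the conjugate transpose. Ellipticity makes the matrix of \<open>1 / a\<close> (cut off for small
  \<open>k\<close>) a two-sided inverse modulo matrices of order \<open>-1\<close>. Bootstrapping, \<open>u \<in> H\<^sup>s\<close> (any \<open>s\<close>) with
  \<open>T\<^sub>a u \<in> H\<^sup>t\<close> lies in \<open>H\<^sup>t\<^sup>+\<^sup>m\<close>, where Schwartz sequences approximate \<open>u\<close> and \<open>T\<^sub>a u\<close> simultaneously.
  Hence the closure of \<open>T\<^sub>a\<close> is its maximal realisation, which is the adjoint of the formal
  adjoint; the same applies to the formal adjoint.
\<close>

section \<open>Weights on the lattice\<close>

text \<open>No symbolic calculus is developed. The parametrix is never shown to be a symbol:
  composition only uses that its Fourier coefficients and their first lattice differences decay
  rapidly, with orders -m and -m-1. One difference is enough because a remainder of order -1 is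
  enough; the bootstrap takes the place of an asymptotic series. The right inverse is wanted for the
  second closure: conjugate transposition turns it into a left inverse of the formal adjoint, so the
  latter need not be recognised as an elliptic pseudo-differential operator. The hypothesis on m
  enters through s < t + m: approximants chosen in the space of order t + m then converge in that of
  order s as well. The analytic input is the convolution rule for the coefficients of a product. It
  needs Fourier inversion, hence the uniqueness of Fourier coefficients of continuous
  functions.\<close>

definition bracket :: "int ^ 'n::finite \<Rightarrow> real" where
  "bracket k = 1 + znorm k"

lemma rvec_simps:
  "rvec (k + l) = rvec k + rvec l" "rvec (k - l) = rvec k - rvec l" "rvec (- k) = - rvec k"
  "rvec 0 = 0" "rvec k $ j = real_of_int (k $ j)"
  by (simp_all add: rvec_def vec_eq_iff)

lemma rvec_axis: "rvec (axis j c) = axis j (real_of_int c)"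
  by (simp add: rvec_def vec_eq_iff axis_def)

lemma bracket_ge_1: "bracket k \<ge> 1"
  by (simp add: bracket_def znorm_def)

lemma bracket_pos: "bracket k > 0"
  using bracket_ge_1[of k] by linarith

lemma bracket_minus: "bracket (- k) = bracket k"
  by (simp add: bracket_def znorm_def rvec_simps)

lemma bracket_minus_commute: "bracket (k - l) = bracket (l - k)"
  using bracket_minus[of "k - l"] by simp

lemma bracket_zero: "bracket 0 = 1"
  by (simp add: bracket_def znorm_def rvec_simps)

lemma bracket_add: "bracket (k + l) \<le> bracket k * bracket l"
proof -
  have "norm (rvec k + rvec l) \<le> norm (rvec k) + norm (rvec l)" by (rule norm_triangle_ineq)
  then have "1 + norm (rvec k + rvec l) \<le> 1 + norm (rvec k) + norm (rvec l) + norm (rvec k) * norm (rvec l)"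
    using mult_nonneg_nonneg[OF norm_ge_zero[of "rvec k"] norm_ge_zero[of "rvec l"]] by linarith
  then show ?thesis by (simp add: bracket_def znorm_def rvec_simps algebra_simps)
qed

lemma bracket_axis: "bracket (axis j 1) = 2"
  by (simp add: bracket_def znorm_def rvec_axis)

lemma bracket_powr_nonneg: "bracket k powr s \<ge> 0"
  by simp

lemma bracket_powr_pos: "bracket k powr s > 0"
  using bracket_pos[of k] by simp

lemma bracket_powr_mono: "s \<le> t \<Longrightarrow> bracket k powr s \<le> bracket k powr t"
  using bracket_ge_1[of k] by (simp add: powr_mono)

lemma bracket_powr_cancel: "bracket k powr s * bracket k powr (- s) = 1"
  using bracket_pos[of k] by (simp flip: powr_add)

text \<open>Peetre's inequality. For s >= 0 it is a power of the submultiplicativity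
  \<open>bracket_add\<close>; for s < 0 the roles of \<open>k\<close> and \<open>l\<close> are
  exchanged and the negative powers cleared. It pays with off-diagonal decay for moving a weight
  from one index to the other; the losses of |s| in later exponents come from here.\<close>

lemma peetre: "bracket k powr s \<le> bracket l powr s * bracket (k - l) powr \<bar>s\<bar>"
proof (cases "s \<ge> 0")
  case True
  have "bracket k \<le> bracket l * bracket (k - l)" using bracket_add[of l "k - l"] by simp
  then have "bracket k powr s \<le> (bracket l * bracket (k - l)) powr s"
    using True bracket_pos[of k] by (intro powr_mono2) auto
  then show ?thesis using True bracket_pos[of l] bracket_pos[of "k - l"] by (simp add: powr_mult)
next
  case False
  have "bracket l \<le> bracket k * bracket (k - l)" using bracket_add[of k "l - k"] by (simp add: bracket_minus_commute)
  then have "bracket l powr (- s) \<le> (bracket k * bracket (k - l)) powr (- s)"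
    using False bracket_pos[of l] by (intro powr_mono2) auto
  also have "\<dots> = bracket k powr (- s) * bracket (k - l) powr \<bar>s\<bar>"
    using False bracket_pos[of k] bracket_pos[of "k - l"] by (simp add: powr_mult)
  finally have "bracket l powr (- s) * (bracket k powr s * bracket l powr s)
      \<le> bracket k powr (- s) * bracket (k - l) powr \<bar>s\<bar> * (bracket k powr s * bracket l powr s)"
    by (intro mult_right_mono) auto
  moreover have "bracket l powr (- s) * (bracket k powr s * bracket l powr s) = (bracket l powr s * bracket l powr (- s)) * bracket k powr s"
    by (simp only: ac_simps)
  moreover have "bracket k powr (- s) * bracket (k - l) powr \<bar>s\<bar> * (bracket k powr s * bracket l powr s)
      = (bracket k powr s * bracket k powr (- s)) * (bracket l powr s * bracket (k - l) powr \<bar>s\<bar>)"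
    by (simp only: ac_simps)
  ultimately show ?thesis
    by (simp only: bracket_powr_cancel mult_1)
qed

text \<open>The subtracted term exists for the induction: the two new summands 1/(M+2)^2 lie below
  the telescoping differences 1/(M+1) - 1/(M+2).\<close>

lemma sum_inverse_squares_le:
  "(\<Sum>i\<in>{- int M..int M}. 1 / (1 + \<bar>real_of_int i\<bar>)\<^sup>2) \<le> 4 - 2 / (real M + 1)"
proof (induction M)
  case 0
  then show ?case by simp
next
  case (Suc M)
  have eq: "{- int (Suc M)..int (Suc M)} = insert (- int (Suc M)) (insert (int (Suc M)) {- int M..int M})"
    by auto
  have "(\<Sum>i\<in>{- int (Suc M)..int (Suc M)}. 1 / (1 + \<bar>real_of_int i\<bar>)\<^sup>2)
      = 2 / (real M + 2)\<^sup>2 + (\<Sum>i\<in>{- int M..int M}. 1 / (1 + \<bar>real_of_int i\<bar>)\<^sup>2)"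
    unfolding eq by (subst sum.insert | simp add: add.commute)+
  also have "\<dots> \<le> 2 / (real M + 2)\<^sup>2 + (4 - 2 / (real M + 1))"
    using Suc by simp
  also have "\<dots> \<le> 4 - 2 / (real (Suc M) + 1)"
  proof -
    have "2 / (real M + 2)\<^sup>2 \<le> 2 / ((real M + 1) * (real M + 2))"
      by (intro divide_left_mono) (auto simp: power2_eq_square intro!: mult_right_mono)
    also have "\<dots> = 2 / (real M + 1) - 2 / (real M + 2)"
      by (simp add: field_simps)
    finally show ?thesis by (simp add: add.commute)
  qed
  finally show ?case .
qed

lemma component_le_jb: "1 + \<bar>real_of_int (k $ j)\<bar> \<le> bracket k"
  using component_le_norm_cart[of "rvec k" j] by (simp add: bracket_def znorm_def rvec_simps)

text \<open>Each 1 + |k_j| is at most the bracket, so the power -2n is dominated by a product of n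
  one-dimensional inverse squares. A finite set of lattice points sits in a cube, where the sum of
  products factorises with every factor at most 4. The exponent 2n is from now on the standard
  reserve for a summation over the lattice.\<close>

lemma bracket_summable_nat:
  "(\<lambda>k::int ^ 'n::finite. bracket k powr (- (2 * real CARD('n)))) summable_on UNIV"
proof (rule nonneg_bounded_partial_sums_imp_summable_on[where C = "4 ^ CARD('n)"])
  have "(\<Sum>k\<in>F. bracket k powr (- (2 * real CARD('n)))) \<le> 4 ^ CARD('n)" 
    if F: "finite F" for F :: "(int ^ 'n) set"
  proof -
    define h :: "int \<Rightarrow> real" where "h i = 1 / (1 + \<bar>real_of_int i\<bar>)\<^sup>2" for i
    have h0: "h i \<ge> 0" for i by (simp add: h_def)
    define I where "I = (\<lambda>(k::int^'n, j). \<bar>k $ j\<bar>) ` (F \<times> UNIV)"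
    \<comment> \<open>\<open>insert 0\<close> keeps the maximum meaningful when \<open>F\<close> is
      empty.\<close>
    define M where "M = nat (Max (insert 0 I))"
    have finI: "finite I" using F by (simp add: I_def)
    have M: "\<bar>k $ j\<bar> \<le> int M" if "k \<in> F" for k j
    proof -
      have "\<bar>k $ j\<bar> \<in> I" using that by (force simp: I_def)
      then have "\<bar>k $ j\<bar> \<le> Max (insert 0 I)" using finI by (intro Max_ge) auto
      then show ?thesis unfolding M_def by linarith
    qed
    define G where "G = Pi\<^sub>E UNIV (\<lambda>_::'n. {- int M..int M})"
    have finG: "finite G" unfolding G_def by (intro finite_PiE) auto
    have "(\<Sum>k\<in>F. bracket k powr (- (2 * real CARD('n)))) \<le> (\<Sum>k\<in>F. \<Prod>j\<in>UNIV. h (k $ j))"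
    proof (rule sum_mono)
      fix k assume "k \<in> F"
      have "(\<Prod>j\<in>(UNIV::'n set). (1 + \<bar>real_of_int (k $ j)\<bar>)\<^sup>2) \<le> (\<Prod>j\<in>(UNIV::'n set). (bracket k)\<^sup>2)"
        by (intro prod_mono) (auto intro!: power_mono component_le_jb)
      also have "\<dots> = bracket k ^ (2 * CARD('n))" by (simp add: power_mult)
      also have "\<dots> = bracket k powr (2 * real CARD('n))"
        using bracket_pos[of k] by (simp flip: powr_realpow)
      finally have *: "(\<Prod>j\<in>UNIV. (1 + \<bar>real_of_int (k $ j)\<bar>)\<^sup>2) \<le> bracket k powr (2 * real CARD('n))" .
      have "bracket k powr (- (2 * real CARD('n))) = 1 / bracket k powr (2 * real CARD('n))"
        by (simp add: powr_minus_divide)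
      also have "\<dots> \<le> 1 / (\<Prod>j\<in>(UNIV::'n set). (1 + \<bar>real_of_int (k $ j)\<bar>)\<^sup>2)"
        using * bracket_powr_pos[of k "2 * real CARD('n)"]
        by (intro divide_left_mono) (auto intro!: prod_pos mult_pos_pos zero_less_power simp: add_pos_nonneg)
      also have "\<dots> = (\<Prod>j\<in>UNIV. h (k $ j))" by (simp add: h_def prod_dividef)
      finally show "bracket k powr (- (2 * real CARD('n))) \<le> (\<Prod>j\<in>UNIV. h (k $ j))" .
    qed
    also have "\<dots> = (\<Sum>g\<in>(\<lambda>k j. k $ j) ` F. \<Prod>j\<in>UNIV. h (g j))"
      by (subst sum.reindex) (auto simp: inj_on_def vec_eq_iff fun_eq_iff)
    also have "\<dots> \<le> (\<Sum>g\<in>G. \<Prod>j\<in>UNIV. h (g j))"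
      using finG h0 M by (intro sum_mono2) (auto simp: G_def abs_le_iff prod_nonneg minus_le_iff)
    also have "\<dots> = (\<Prod>j\<in>(UNIV::'n set). \<Sum>i\<in>{- int M..int M}. h i)"
      unfolding G_def by (rule prod_sum_PiE[symmetric]) auto
    also have "\<dots> \<le> (\<Prod>j\<in>(UNIV::'n set). 4)"
    proof (rule prod_mono, safe)
      show "0 \<le> sum h {- int M..int M}" using h0 by (intro sum_nonneg) auto
      have "2 / (real M + 1) \<ge> 0" by simp
      then show "sum h {- int M..int M} \<le> 4"
        using sum_inverse_squares_le[of M] unfolding h_def by linarith
    qed
    finally show ?thesis by simp
  qed
  then show "\<forall>\<^sub>F F in finite_subsets_at_top UNIV. (\<Sum>k\<in>F. bracket (k::int^'n) powr (- (2 * real CARD('n)))) \<le> 4 ^ CARD('n)"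
    by (auto intro!: eventually_finite_subsets_at_top_weakI)
qed (use bracket_powr_nonneg in auto)


lemma bracket_shift_summable:
  "(\<lambda>p::int ^ 'n::finite. bracket (k - p) powr (- (2 * real CARD('n)))) summable_on UNIV"
  using summable_on_reindex_bij_betw[of "\<lambda>p. k - p" UNIV UNIV "\<lambda>k::int^'n. bracket k powr (- (2 * real CARD('n)))"]
    bracket_summable_nat by (simp add: bij_diff)

text \<open>The argument carries nothing but the dimension; by translation invariance the same
  constant serves for every centre.\<close>

definition bracket_sum :: "'n::finite itself \<Rightarrow> real" where
  "bracket_sum _ = (\<Sum>\<^sub>\<infinity>k::int ^ 'n. bracket k powr (- (2 * real CARD('n))))"

lemma bracket_shift_infsum:
  "(\<Sum>\<^sub>\<infinity>p::int ^ 'n::finite. bracket (k - p) powr (- (2 * real CARD('n)))) = bracket_sum TYPE('n)"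
  unfolding bracket_sum_def
  using infsum_reindex_bij_betw[of "\<lambda>p. k - p" UNIV UNIV "\<lambda>k::int^'n. bracket k powr (- (2 * real CARD('n)))"]
  by (simp add: bij_diff)

lemma bracket_sum_nonneg: "bracket_sum TYPE('n::finite) \<ge> 0"
  by (simp add: bracket_sum_def infsum_nonneg)

section \<open>Matrices with rapid off-diagonal decay\<close>

type_synonym 'n lattice_matrix = "int ^ 'n \<Rightarrow> int ^ 'n \<Rightarrow> complex"

text \<open>The weight sits on the row index. By Peetre's inequality the column index would define
  the same class, which is why adjoints stay in it.\<close>

definition offdiag :: "real \<Rightarrow> 'n::finite lattice_matrix \<Rightarrow> bool" where
  "offdiag m K \<longleftrightarrow> (\<forall>N\<ge>0. \<exists>C\<ge>0. \<forall>k l. cmod (K k l) \<le> C * bracket k powr m * bracket (k - l) powr (- N))"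

definition mat_apply :: "'n::finite lattice_matrix \<Rightarrow> 'n lattice_fun \<Rightarrow> 'n lattice_fun" where
  "mat_apply K u = (\<lambda>k. \<Sum>\<^sub>\<infinity>l. K k l * u l)"

definition mat_adj :: "'n::finite lattice_matrix \<Rightarrow> 'n lattice_matrix" where
  "mat_adj K = (\<lambda>k l. cnj (K l k))"

definition mat_comp :: "'n::finite lattice_matrix \<Rightarrow> 'n lattice_matrix \<Rightarrow> 'n lattice_matrix" where
  "mat_comp K L = (\<lambda>k l. \<Sum>\<^sub>\<infinity>p. K k p * L p l)"

text \<open>Kept complex-valued, so that the mapping properties proved for matrices apply to it
  unchanged.\<close>

definition mat_abs :: "'n::finite lattice_matrix \<Rightarrow> 'n lattice_matrix" where
  "mat_abs K = (\<lambda>k l. of_real (cmod (K k l)))"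

definition mat_id :: "'n::finite lattice_matrix" where
  "mat_id = (\<lambda>k l. if k = l then 1 else 0)"

lemma offdiagE:
  assumes "offdiag m K" "N \<ge> 0"
  obtains C where "C \<ge> 0" "\<And>k l. cmod (K k l) \<le> C * bracket k powr m * bracket (k - l) powr (- N)"
  using assms unfolding offdiag_def by blast

lemma offdiag_abs: "offdiag m K \<Longrightarrow> offdiag m (mat_abs K)"
  by (simp add: offdiag_def mat_abs_def)

lemma offdiag_adj:
  assumes "offdiag m K"
  shows "offdiag m (mat_adj K)"
  unfolding offdiag_def
proof (intro allI impI)
  fix N :: real assume N: "N \<ge> 0"
  \<comment> \<open>The extra decay |m| pays for moving the weight from \<open>l\<close> to
    \<open>k\<close>.\<close>
  obtain C where C: "C \<ge> 0" "\<And>k l. cmod (K k l) \<le> C * bracket k powr m * bracket (k - l) powr (- (N + \<bar>m\<bar>))"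
    using offdiagE[OF assms, of "N + \<bar>m\<bar>"] N by auto
  have "cmod (mat_adj K k l) \<le> C * bracket k powr m * bracket (k - l) powr (- N)" for k l
  proof -
    have "cmod (mat_adj K k l) \<le> C * bracket l powr m * bracket (l - k) powr (- (N + \<bar>m\<bar>))"
      using C by (simp add: mat_adj_def)
    also have "\<dots> \<le> C * (bracket k powr m * bracket (l - k) powr \<bar>m\<bar>) * bracket (l - k) powr (- (N + \<bar>m\<bar>))"
      using C(1) by (intro mult_right_mono mult_left_mono peetre) auto
    also have "\<dots> = C * bracket k powr m * (bracket (l - k) powr \<bar>m\<bar> * bracket (l - k) powr (- (N + \<bar>m\<bar>)))"
      by (simp only: ac_simps)
    also have "\<dots> = C * bracket k powr m * bracket (k - l) powr (- N)"
      by (simp add: bracket_minus_commute flip: powr_add)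
    finally show ?thesis .
  qed
  then show "\<exists>C\<ge>0. \<forall>k l. cmod (mat_adj K k l) \<le> C * bracket k powr m * bracket (k - l) powr (- N)"
    using C(1) by blast
qed

lemma offdiag_add:
  assumes "offdiag m K" "offdiag m L"
  shows "offdiag m (\<lambda>k l. K k l + L k l)"
  unfolding offdiag_def
proof (intro allI impI)
  fix N :: real assume N: "N \<ge> 0"
  obtain C where C: "C \<ge> 0" "\<And>k l. cmod (K k l) \<le> C * bracket k powr m * bracket (k - l) powr (- N)"
    using offdiagE[OF assms(1) N] by auto
  obtain D where D: "D \<ge> 0" "\<And>k l. cmod (L k l) \<le> D * bracket k powr m * bracket (k - l) powr (- N)"
    using offdiagE[OF assms(2) N] by auto
  have "cmod (K k l + L k l) \<le> (C + D) * bracket k powr m * bracket (k - l) powr (- N)" for k l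
    using norm_triangle_ineq[of "K k l" "L k l"] C(2)[of k l] D(2)[of k l]
    by (simp add: algebra_simps)
  then show "\<exists>C\<ge>0. \<forall>k l. cmod (K k l + L k l) \<le> C * bracket k powr m * bracket (k - l) powr (- N)"
    using C(1) D(1) by (intro exI[of _ "C + D"]) auto
qed

text \<open>Of the decay N + 2n in \<open>k - p\<close>, the part N converts the decay in
  \<open>p - l\<close> into decay in \<open>k - l\<close> (Peetre with exponent -N), and the part 2n
  makes the sum over \<open>p\<close> converge.\<close>

lemma triple_sum_bound:
  fixes T :: "int ^ 'n::finite \<Rightarrow> complex"
  assumes "\<And>p. cmod (T p) \<le> C * bracket (k - p) powr (- (N + 2 * real CARD('n))) * bracket (p - l) powr (- N)"
    and "N \<ge> 0" "C \<ge> 0"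
  shows "(\<lambda>p. cmod (T p)) summable_on UNIV"
    and "cmod (\<Sum>\<^sub>\<infinity>p. T p) \<le> C * bracket_sum TYPE('n) * bracket (k - l) powr (- N)"
proof -
  let ?d = "2 * real CARD('n)"
  have le: "cmod (T p) \<le> C * bracket (k - l) powr (- N) * bracket (k - p) powr (- ?d)" for p
  proof -
    have "bracket (p - l) powr (- N) \<le> bracket (k - l) powr (- N) * bracket (k - p) powr N"
      using peetre[of "p - l" "- N" "k - l"] assms(2) by (simp add: bracket_minus_commute)
    then have "C * bracket (k - p) powr (- (N + ?d)) * bracket (p - l) powr (- N)
       \<le> C * bracket (k - p) powr (- (N + ?d)) * (bracket (k - l) powr (- N) * bracket (k - p) powr N)"
      using assms(3) by (intro mult_left_mono) auto
    also have "\<dots> = C * bracket (k - l) powr (- N) * (bracket (k - p) powr (- (N + ?d)) * bracket (k - p) powr N)"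
      by (simp only: ac_simps)
    also have "bracket (k - p) powr (- (N + ?d)) * bracket (k - p) powr N = bracket (k - p) powr (- ?d)"
      by (simp flip: powr_add)
    finally show ?thesis using assms(1)[of p] by linarith
  qed
  have s: "(\<lambda>p. C * bracket (k - l) powr (- N) * bracket (k - p) powr (- ?d)) summable_on UNIV"
    by (intro summable_on_cmult_right bracket_shift_summable)
  show abs: "(\<lambda>p. cmod (T p)) summable_on UNIV"
    by (rule summable_on_comparison_test[OF s]) (use le in auto)
  have "cmod (\<Sum>\<^sub>\<infinity>p. T p) \<le> (\<Sum>\<^sub>\<infinity>p. cmod (T p))"
    using abs by (intro norm_infsum_bound)
  also have "\<dots> \<le> (\<Sum>\<^sub>\<infinity>p. C * bracket (k - l) powr (- N) * bracket (k - p) powr (- ?d))"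
    using le by (intro infsum_mono abs s) auto
  also have "\<dots> = C * bracket (k - l) powr (- N) * bracket_sum TYPE('n)"
    by (subst infsum_cmult_right) (auto simp: bracket_shift_infsum intro: bracket_shift_summable)
  finally show "cmod (\<Sum>\<^sub>\<infinity>p. T p) \<le> C * bracket_sum TYPE('n) * bracket (k - l) powr (- N)"
    by (simp only: ac_simps)
qed

section \<open>Sobolev spaces\<close>

text \<open>Fubini--Tonelli for series: iterated absolute summability in one order amounts to
  absolute summability over the product, which is symmetric in the two indices.\<close>

lemma double_sum:
  fixes F :: "'a \<Rightarrow> 'b \<Rightarrow> 'c::banach"
  assumes 1: "\<And>p. (\<lambda>l. norm (F p l)) summable_on UNIV"
    and 2: "(\<lambda>p. \<Sum>\<^sub>\<infinity>l. norm (F p l)) summable_on UNIV"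
  shows "(\<Sum>\<^sub>\<infinity>p. \<Sum>\<^sub>\<infinity>l. F p l) = (\<Sum>\<^sub>\<infinity>l. \<Sum>\<^sub>\<infinity>p. F p l)"
    and "(\<lambda>p. norm (F p l)) summable_on UNIV"
    and "(\<lambda>l. \<Sum>\<^sub>\<infinity>p. norm (F p l)) summable_on UNIV"
proof -
  have s: "(\<lambda>(p,l). norm (F p l)) summable_on UNIV \<times> UNIV"
  proof -
    have "(\<lambda>p. norm (\<Sum>\<^sub>\<infinity>l. norm (F p l))) summable_on UNIV"
      using 2 by (simp add: infsum_nonneg)
    then show ?thesis
      using iffD2[OF Infinite_Sum.abs_summable_on_Sigma_iff[of "\<lambda>(p,l). F p l" UNIV "\<lambda>_. UNIV"]] 1
      unfolding case_prod_beta' fst_conv snd_conv by blast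
  qed
  have s': "(\<lambda>(p,l). F p l) summable_on UNIV \<times> UNIV"
    by (rule abs_summable_summable) (use s in \<open>simp only: case_prod_beta'\<close>)
  show "(\<Sum>\<^sub>\<infinity>p. \<Sum>\<^sub>\<infinity>l. F p l) = (\<Sum>\<^sub>\<infinity>l. \<Sum>\<^sub>\<infinity>p. F p l)"
    by (rule infsum_swap_banach[OF s'])
  have t: "(\<lambda>(l,p). norm (F p l)) summable_on UNIV \<times> UNIV"
    using iffD1[OF summable_on_swap s] by (simp only: case_prod_beta' fst_conv snd_conv)
  have *: "(\<forall>l. (\<lambda>p. norm (F p l)) summable_on UNIV) \<and> 
        (\<lambda>l. norm (\<Sum>\<^sub>\<infinity>p. norm (F p l))) summable_on UNIV"
    using iffD1[OF Infinite_Sum.abs_summable_on_Sigma_iff[of "\<lambda>(l,p). F p l" UNIV "\<lambda>_. UNIV"]] t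
    unfolding case_prod_beta' fst_conv snd_conv by blast
  then show "(\<lambda>p. norm (F p l)) summable_on UNIV" by blast
  show "(\<lambda>l. \<Sum>\<^sub>\<infinity>p. norm (F p l)) summable_on UNIV"
    using * by (simp add: infsum_nonneg)
qed

text \<open>Young's inequality for the convolution of a summable and a square-summable sequence.
  Writing g as the square of sqrt g, Cauchy--Schwarz bounds the square of g * f by (sum of g) times
  g * f^2; summing over \<open>k\<close> in the other order then gives the constant.\<close>

lemma young_convolution:
  fixes g f :: "int ^ 'n::finite \<Rightarrow> real"
  assumes g: "\<And>k. g k \<ge> 0" "g summable_on UNIV"
    and f: "\<And>k. f k \<ge> 0" "(\<lambda>k. (f k)\<^sup>2) summable_on UNIV"
  shows "(\<lambda>l. g (k - l) * f l) summable_on UNIV"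
    and "(\<lambda>k. (\<Sum>\<^sub>\<infinity>l. g (k - l) * f l)\<^sup>2) summable_on UNIV"
    and "(\<Sum>\<^sub>\<infinity>k. (\<Sum>\<^sub>\<infinity>l. g (k - l) * f l)\<^sup>2) \<le> (infsum g UNIV)\<^sup>2 * (\<Sum>\<^sub>\<infinity>k. (f k)\<^sup>2)"
proof -
  define S where "S = infsum g UNIV"
  define Q where "Q = (\<Sum>\<^sub>\<infinity>k. (f k)\<^sup>2)"
  have S0: "S \<ge> 0" unfolding S_def by (intro infsum_nonneg g)
  have Q0: "Q \<ge> 0" unfolding Q_def by (intro infsum_nonneg) auto
  have gk: "(\<lambda>l. g (k - l)) summable_on UNIV" and gS: "(\<Sum>\<^sub>\<infinity>l. g (k - l)) = S" for k
    unfolding S_def using summable_on_reindex_bij_betw[of "\<lambda>l. k - l" UNIV UNIV g] 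
      infsum_reindex_bij_betw[of "\<lambda>l. k - l" UNIV UNIV g] g(2)
    by (simp_all add: bij_diff)
  have gl: "(\<lambda>k. g (k - l)) summable_on UNIV" and gS': "(\<Sum>\<^sub>\<infinity>k. g (k - l)) = S" for l
    unfolding S_def using summable_on_reindex_bij_betw[of "\<lambda>k. k - l" UNIV UNIV g] 
      infsum_reindex_bij_betw[of "\<lambda>k. k - l" UNIV UNIV g] g(2)
    bij_betw_byWitness[of UNIV "\<lambda>k. k + l" "\<lambda>k. k - l" UNIV] by simp_all
  have fQ: "(f l)\<^sup>2 \<le> Q" for l
    using finite_sum_le_infsum[OF f(2), of "{l}"] by (simp add: Q_def)
  show gf: "(\<lambda>l. g (k - l) * f l) summable_on UNIV" for k
  proof (rule summable_on_comparison_test)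
    show "(\<lambda>l. g (k - l) * sqrt Q) summable_on UNIV"
      using gk by (intro summable_on_cmult_left)
    show "g (k - l) * f l \<le> g (k - l) * sqrt Q" for l
      using fQ[of l] by (intro mult_left_mono g real_le_rsqrt)
  qed (use f g in auto)
  have gf2: "(\<lambda>l. g (k - l) * (f l)\<^sup>2) summable_on UNIV" for k
  proof (rule summable_on_comparison_test)
    show "(\<lambda>l. g (k - l) * Q) summable_on UNIV"
      using gk by (intro summable_on_cmult_left)
    show "g (k - l) * (f l)\<^sup>2 \<le> g (k - l) * Q" for l
      using fQ[of l] by (intro mult_left_mono g)
  qed (use f g in auto)
  define H where "H k = (\<Sum>\<^sub>\<infinity>l. g (k - l) * (f l)\<^sup>2)" for k
  have H0: "H k \<ge> 0" for k unfolding H_def by (intro infsum_nonneg) (use g in auto)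
  have CS: "(\<Sum>\<^sub>\<infinity>l. g (k - l) * f l)\<^sup>2 \<le> S * H k" for k
  proof -
    have "(\<Sum>\<^sub>\<infinity>l. g (k - l) * f l) \<le> sqrt (S * H k)"
    proof (rule infsum_le_finite_sums[OF gf])
      fix A :: "(int ^ 'n) set" assume A: "finite A"
      have "(\<Sum>l\<in>A. g (k - l) * f l)\<^sup>2 = (\<Sum>l\<in>A. sqrt (g (k - l)) * (sqrt (g (k - l)) * f l))\<^sup>2"
        using g(1) by (simp flip: mult.assoc)
      also have "\<dots> \<le> (\<Sum>l\<in>A. (sqrt (g (k - l)))\<^sup>2) * (\<Sum>l\<in>A. (sqrt (g (k - l)) * f l)\<^sup>2)"
        by (rule Cauchy_Schwarz_ineq_sum)
      also have "\<dots> = (\<Sum>l\<in>A. g (k - l)) * (\<Sum>l\<in>A. g (k - l) * (f l)\<^sup>2)"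
        using g(1) by (simp add: power_mult_distrib)
      also have "\<dots> \<le> S * H k"
      proof (intro mult_mono S0)
        show "(\<Sum>l\<in>A. g (k - l)) \<le> S"
          using finite_sum_le_infsum[OF gk A] g(1) gS by simp
        show "(\<Sum>l\<in>A. g (k - l) * (f l)\<^sup>2) \<le> H k"
          unfolding H_def using finite_sum_le_infsum[OF gf2 A] g(1) by simp
      qed (use g in \<open>auto intro: sum_nonneg\<close>)
      finally show "(\<Sum>l\<in>A. g (k - l) * f l) \<le> sqrt (S * H k)" by (rule real_le_rsqrt)
    qed
    moreover have "(\<Sum>\<^sub>\<infinity>l. g (k - l) * f l) \<ge> 0" by (intro infsum_nonneg) (use g f in auto)
    ultimately have "(\<Sum>\<^sub>\<infinity>l. g (k - l) * f l)\<^sup>2 \<le> (sqrt (S * H k))\<^sup>2" by (intro power_mono)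
    then show ?thesis using S0 H0 by simp
  qed
  have in1: "(\<lambda>k. norm (g (k - l) * (f l)\<^sup>2)) summable_on UNIV" for l
    using gl g(1) by (auto intro!: summable_on_cmult_left)
  have sumk: "(\<Sum>\<^sub>\<infinity>k. g (k - l) * (f l)\<^sup>2) = S * (f l)\<^sup>2" for l
    using gS'[of l] by (subst infsum_cmult_left) (auto intro: gl)
  have in2: "(\<lambda>l. \<Sum>\<^sub>\<infinity>k. norm (g (k - l) * (f l)\<^sup>2)) summable_on UNIV"
    using g(1) sumk f(2) by (simp add: summable_on_cmult_right)
  \<comment> \<open>With \<open>l\<close> outside, the inner sum over \<open>k\<close> is a constant
    multiple of f(l)^2; interchanging the sums therefore gives both the summability and the total of
    \<open>H\<close>.\<close>
  have Hs: "H summable_on UNIV"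
    using double_sum(3)[where F = "\<lambda>l k. g (k - l) * (f l)\<^sup>2", OF in1 in2] g(1) by (simp add: H_def[abs_def])
  have HQ: "infsum H UNIV = S * Q"
    using double_sum(1)[where F = "\<lambda>l k. g (k - l) * (f l)\<^sup>2", OF in1 in2]
    by (simp add: H_def[abs_def] sumk Q_def infsum_cmult_right f(2))
  show sm: "(\<lambda>k. (\<Sum>\<^sub>\<infinity>l. g (k - l) * f l)\<^sup>2) summable_on UNIV"
  proof (rule summable_on_comparison_test)
    show "(\<lambda>k. S * H k) summable_on UNIV" by (intro summable_on_cmult_right Hs)
  qed (use CS in auto)
  have "(\<Sum>\<^sub>\<infinity>k. (\<Sum>\<^sub>\<infinity>l. g (k - l) * f l)\<^sup>2) \<le> (\<Sum>\<^sub>\<infinity>k. S * H k)"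
    by (intro infsum_mono sm CS summable_on_cmult_right Hs)
  also have "\<dots> = S * (S * Q)" using HQ Hs by (simp add: infsum_cmult_right)
  finally show "(\<Sum>\<^sub>\<infinity>k. (\<Sum>\<^sub>\<infinity>l. g (k - l) * f l)\<^sup>2) \<le> (infsum g UNIV)\<^sup>2 * (\<Sum>\<^sub>\<infinity>k. (f k)\<^sup>2)"
    by (simp add: S_def Q_def power2_eq_square mult.assoc)
qed

section \<open>Sobolev weights and norms\<close>

definition sobolev_weight :: "real \<Rightarrow> int ^ 'n::finite \<Rightarrow> real" where
  "sobolev_weight s k = (1 + (znorm k)\<^sup>2) powr (s / 2)"

lemma sobolev_weight_pos: "sobolev_weight s k > 0"
  using zero_le_power2[of "znorm k"] unfolding sobolev_weight_def powr_gt_zero by linarith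

lemma sobolev_weight_mono: "s \<le> t \<Longrightarrow> sobolev_weight s k \<le> sobolev_weight t k"
  by (simp add: sobolev_weight_def powr_mono)

lemma sobolev_weight_cancel: "sobolev_weight s k * sobolev_weight (- s) k = 1"
  using sobolev_weight_pos[of 0 k] by (simp add: sobolev_weight_def flip: powr_add split: if_splits)

text \<open>The Sobolev norm uses 1 + |k|^2, whereas submultiplicativity is at hand for 1 + |k|.
  They are comparable because 1 + z^2 <= (1 + z)^2 <= 2 (1 + z^2).\<close>

lemma sobolev_weight_jb_nonneg:
  assumes "s \<ge> 0"
  shows "sobolev_weight s k \<le> bracket k powr s" "bracket k powr s \<le> 2 powr s * sobolev_weight s k"
proof -
  let ?z = "znorm k"
  have z: "?z \<ge> 0" by (simp add: znorm_def)
  have j: "bracket k powr s = ((bracket k)\<^sup>2) powr (s / 2)"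
    using bracket_pos[of k] by (simp add: powr_powr flip: powr_numeral)
  have "1 + ?z\<^sup>2 \<le> (bracket k)\<^sup>2" using z by (simp add: bracket_def power2_eq_square algebra_simps)
  then show "sobolev_weight s k \<le> bracket k powr s"
    unfolding j sobolev_weight_def using assms by (intro powr_mono2) auto
  have "(1 + ?z)\<^sup>2 + (1 - ?z)\<^sup>2 = 2 * (1 + ?z\<^sup>2)" by (simp add: power2_eq_square algebra_simps)
  then have "(bracket k)\<^sup>2 \<le> 2 * (1 + ?z\<^sup>2)" unfolding bracket_def using zero_le_power2[of "1 - ?z"] by linarith
  \<comment> \<open>The factor 2 is enlarged to 4 so that its power s/2 is exactly
    \<open>2 powr s\<close>.\<close>
  also have "\<dots> \<le> 2\<^sup>2 * (1 + ?z\<^sup>2)" by (intro mult_right_mono) auto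
  finally have "bracket k powr s \<le> (2\<^sup>2 * (1 + ?z\<^sup>2)) powr (s / 2)"
    unfolding j using assms by (intro powr_mono2) auto
  also have "\<dots> = (2\<^sup>2) powr (s / 2) * sobolev_weight s k"
    by (subst powr_mult) (simp_all only: sobolev_weight_def)
  also have "(2\<^sup>2::real) powr (s / 2) = 2 powr s" by (simp add: powr_powr flip: powr_numeral)
  finally show "bracket k powr s \<le> 2 powr s * sobolev_weight s k" .
qed

text \<open>For negative s this is the opposite comparison at -s, inverted by means of the
  cancellation laws; |s| in the constant covers both signs.\<close>

lemma sobolev_weight_le_jb: "sobolev_weight s k \<le> 2 powr \<bar>s\<bar> * bracket k powr s"
proof (cases "s \<ge> 0")
  case True
  have "1 * bracket k powr s \<le> 2 powr s * bracket k powr s"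
    using True by (intro mult_right_mono) (auto simp: ge_one_powr_ge_zero)
  then show ?thesis using sobolev_weight_jb_nonneg(1)[OF True, of k] True by simp
next
  case False
  have "bracket k powr (- s) \<le> 2 powr (- s) * sobolev_weight (- s) k" using False by (intro sobolev_weight_jb_nonneg) auto
  then have "bracket k powr (- s) * (sobolev_weight s k * bracket k powr s) \<le> 2 powr (- s) * sobolev_weight (- s) k * (sobolev_weight s k * bracket k powr s)"
    using sobolev_weight_pos[of s k] by (intro mult_right_mono) auto
  moreover have "bracket k powr (- s) * (sobolev_weight s k * bracket k powr s) = (bracket k powr s * bracket k powr (- s)) * sobolev_weight s k"
    by (simp only: ac_simps)
  moreover have "2 powr (- s) * sobolev_weight (- s) k * (sobolev_weight s k * bracket k powr s) = (sobolev_weight s k * sobolev_weight (- s) k) * (2 powr (- s) * bracket k powr s)"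
    by (simp only: ac_simps)
  ultimately show ?thesis using False by (simp add: bracket_powr_cancel sobolev_weight_cancel)
qed

lemma bracket_le_wt: "bracket k powr s \<le> 2 powr \<bar>s\<bar> * sobolev_weight s k"
proof (cases "s \<ge> 0")
  case True
  then show ?thesis using sobolev_weight_jb_nonneg(2)[OF True, of k] by simp
next
  case False
  have "sobolev_weight (- s) k \<le> bracket k powr (- s)" using False by (intro sobolev_weight_jb_nonneg) auto
  then have "sobolev_weight (- s) k * (sobolev_weight s k * bracket k powr s) \<le> bracket k powr (- s) * (sobolev_weight s k * bracket k powr s)"
    using sobolev_weight_pos[of s k] by (intro mult_right_mono) auto
  moreover have "sobolev_weight (- s) k * (sobolev_weight s k * bracket k powr s) = (sobolev_weight s k * sobolev_weight (- s) k) * bracket k powr s"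
    by (simp only: ac_simps)
  moreover have "bracket k powr (- s) * (sobolev_weight s k * bracket k powr s) = (bracket k powr s * bracket k powr (- s)) * sobolev_weight s k"
    by (simp only: ac_simps)
  ultimately have "bracket k powr s \<le> sobolev_weight s k" by (simp add: bracket_powr_cancel sobolev_weight_cancel)
  also have "\<dots> \<le> 2 powr \<bar>s\<bar> * sobolev_weight s k"
    using sobolev_weight_pos[of s k] by (simp add: ge_one_powr_ge_zero)
  finally show ?thesis .
qed

lemma cmod_bessel: "cmod (bessel s u k) = sobolev_weight s k * cmod (u k)"
  using sobolev_weight_pos[of s k] by (simp add: bessel_def sobolev_weight_def norm_mult)

lemma sobolev_iff: "u \<in> sobolev s \<longleftrightarrow> (\<lambda>k. (sobolev_weight s k * cmod (u k))\<^sup>2) summable_on UNIV"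
  by (simp add: sobolev_def l2_def cmod_bessel)

lemma sobolev_norm_eq: "sobolev_norm s u = sqrt (\<Sum>\<^sub>\<infinity>k. (sobolev_weight s k * cmod (u k))\<^sup>2)"
  by (simp add: sobolev_norm_def l2_norm_def cmod_bessel)

lemma sobolev_norm_nonneg: "sobolev_norm s u \<ge> 0"
  by (simp add: sobolev_norm_eq infsum_nonneg)

lemma sobolev_weight_times_cmod_le:
  assumes "u \<in> sobolev s"
  shows "sobolev_weight s k * cmod (u k) \<le> sobolev_norm s u"
proof -
  have "(sobolev_weight s k * cmod (u k))\<^sup>2 \<le> (\<Sum>\<^sub>\<infinity>k. (sobolev_weight s k * cmod (u k))\<^sup>2)"
    using finite_sum_le_infsum[of "\<lambda>k. (sobolev_weight s k * cmod (u k))\<^sup>2" UNIV "{k}"] assms by (simp add: sobolev_iff)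
  then show ?thesis unfolding sobolev_norm_eq by (rule real_le_rsqrt)
qed

lemma sobolev_mono:
  assumes "s \<le> t" "u \<in> sobolev t"
  shows "u \<in> sobolev s" "sobolev_norm s u \<le> sobolev_norm t u"
proof -
  have le: "(sobolev_weight s k * cmod (u k))\<^sup>2 \<le> (sobolev_weight t k * cmod (u k))\<^sup>2" for k
    using sobolev_weight_mono[OF assms(1), of k] sobolev_weight_pos[of s k] by (intro power_mono mult_right_mono) auto
  show *: "u \<in> sobolev s"
    unfolding sobolev_iff
    by (rule summable_on_comparison_test[OF assms(2)[unfolded sobolev_iff]]) (use le in auto)
  show "sobolev_norm s u \<le> sobolev_norm t u"
    unfolding sobolev_norm_eq real_sqrt_le_iff using * assms(2) le
    by (intro infsum_mono) (auto simp: sobolev_iff)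
qed

lemma sobolev_lincomb:
  assumes "u \<in> sobolev s" "v \<in> sobolev s"
  shows "(\<lambda>k. c * u k + d * v k) \<in> sobolev s"
  unfolding sobolev_iff
proof (rule summable_on_comparison_test)
  show "(\<lambda>k. 2 * (cmod c)\<^sup>2 * (sobolev_weight s k * cmod (u k))\<^sup>2 + 2 * (cmod d)\<^sup>2 * (sobolev_weight s k * cmod (v k))\<^sup>2) summable_on UNIV"
    using assms unfolding sobolev_iff by (intro summable_on_add summable_on_cmult_right)
  fix k
  have "(sobolev_weight s k * cmod (c * u k + d * v k))\<^sup>2 \<le> (sobolev_weight s k * (cmod c * cmod (u k) + cmod d * cmod (v k)))\<^sup>2"
    using sobolev_weight_pos[of s k] norm_triangle_ineq[of "c * u k" "d * v k"]
    by (intro power_mono mult_left_mono) (auto simp: norm_mult)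
  also have "\<dots> \<le> 2 * (sobolev_weight s k * (cmod c * cmod (u k)))\<^sup>2 + 2 * (sobolev_weight s k * (cmod d * cmod (v k)))\<^sup>2"
    using sum_squares_bound[of "sobolev_weight s k * (cmod c * cmod (u k))" "sobolev_weight s k * (cmod d * cmod (v k))"]
    by (simp add: power2_eq_square algebra_simps)
  finally show "(sobolev_weight s k * cmod (c * u k + d * v k))\<^sup>2 \<le> 2 * (cmod c)\<^sup>2 * (sobolev_weight s k * cmod (u k))\<^sup>2 + 2 * (cmod d)\<^sup>2 * (sobolev_weight s k * cmod (v k))\<^sup>2"
    by (simp add: power_mult_distrib algebra_simps)
qed auto

lemma sobolev_diff: "u \<in> sobolev s \<Longrightarrow> v \<in> sobolev s \<Longrightarrow> (\<lambda>k. u k - v k) \<in> sobolev s"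
  using sobolev_lincomb[of u s v 1 "-1"] by simp

lemma sobolev_abs_iff: "(\<lambda>k. of_real (cmod (u k))) \<in> sobolev s \<longleftrightarrow> u \<in> sobolev s"
  by (simp add: sobolev_iff)

text \<open>The weights of orders s and -s cancel in the product, and the remaining product of
  square-summable sequences is bounded by the sum of the squares. This makes \<open>pairing\<close>
  an absolutely convergent series on spaces of opposite orders.\<close>

lemma sobolev_dual_summable:
  assumes "u \<in> sobolev s" "v \<in> sobolev (- s)"
  shows "(\<lambda>k. cmod (u k) * cmod (v k)) summable_on UNIV"
proof (rule summable_on_comparison_test)
  show "(\<lambda>k. (sobolev_weight s k * cmod (u k))\<^sup>2 + (sobolev_weight (- s) k * cmod (v k))\<^sup>2) summable_on UNIV"
    using assms by (intro summable_on_add) (simp_all add: sobolev_iff)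
  fix k
  have "cmod (u k) * cmod (v k) = (sobolev_weight s k * sobolev_weight (- s) k) * (cmod (u k) * cmod (v k))" by (simp add: sobolev_weight_cancel)
  also have "\<dots> = (sobolev_weight s k * cmod (u k)) * (sobolev_weight (- s) k * cmod (v k))" by (simp only: ac_simps)
  also have "\<dots> \<le> (sobolev_weight s k * cmod (u k))\<^sup>2 + (sobolev_weight (- s) k * cmod (v k))\<^sup>2"
    using sum_squares_bound[of "sobolev_weight s k * cmod (u k)" "sobolev_weight (- s) k * cmod (v k)"]
    mult_nonneg_nonneg[OF mult_nonneg_nonneg[OF less_imp_le[OF sobolev_weight_pos] norm_ge_zero]
      mult_nonneg_nonneg[OF less_imp_le[OF sobolev_weight_pos] norm_ge_zero], of s k "u k" "- s" k "v k"]
    by linarith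
  finally show "cmod (u k) * cmod (v k) \<le> (sobolev_weight s k * cmod (u k))\<^sup>2 + (sobolev_weight (- s) k * cmod (v k))\<^sup>2" .
qed auto

text \<open>Conjugated by the weights of source and target, the matrix is dominated by a summable
  convolution kernel, so Young's inequality gives the bound. The constant is fixed before
  \<open>u\<close>, as continuity requires.\<close>

lemma offdiag_bounded:
  fixes K :: "'n::finite lattice_matrix"
  assumes "offdiag m K"
  obtains C where "C \<ge> 0"
    "\<And>u k. u \<in> sobolev s \<Longrightarrow> (\<lambda>l. cmod (K k l * u l)) summable_on UNIV"
    "\<And>u. u \<in> sobolev s \<Longrightarrow> mat_apply K u \<in> sobolev (s - m)"
    "\<And>u. u \<in> sobolev s \<Longrightarrow> sobolev_norm (s - m) (mat_apply K u) \<le> C * sobolev_norm s u"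
proof -
  let ?d = "2 * real CARD('n)"
  \<comment> \<open>The part |s| of the decay is consumed by Peetre's inequality when the weight of
    order s passes from \<open>k\<close> to \<open>l\<close>; the part 2n is left for the kernel
    \<open>g\<close>.\<close>
  obtain C where C: "C \<ge> 0" "\<And>k l. cmod (K k l) \<le> C * bracket k powr m * bracket (k - l) powr (- (\<bar>s\<bar> + ?d))"
    using offdiagE[OF assms, of "\<bar>s\<bar> + ?d"] by auto
  define D where "D = 2 powr \<bar>s - m\<bar> * C * 2 powr \<bar>s\<bar>"
  have D0: "D \<ge> 0" using C(1) by (simp add: D_def)
  define g where "g k = D * bracket k powr (- ?d)" for k :: "int^'n"
  have g: "g k \<ge> 0" "g summable_on UNIV" for k
    using D0 bracket_summable_nat unfolding g_def by (auto intro: summable_on_cmult_right)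
  have K: "sobolev_weight (s - m) k * cmod (K k l) \<le> g (k - l) * sobolev_weight s l" for k l
  proof -
    have "sobolev_weight (s - m) k * cmod (K k l)
        \<le> (2 powr \<bar>s - m\<bar> * bracket k powr (s - m)) * (C * bracket k powr m * bracket (k - l) powr (- (\<bar>s\<bar> + ?d)))"
      using C sobolev_weight_pos[of "s - m" k] by (intro mult_mono sobolev_weight_le_jb) auto
    also have "\<dots> = (2 powr \<bar>s - m\<bar> * C) * (bracket k powr (s - m) * bracket k powr m) * bracket (k - l) powr (- (\<bar>s\<bar> + ?d))"
      by (simp only: ac_simps)
    also have "bracket k powr (s - m) * bracket k powr m = bracket k powr s" by (simp flip: powr_add)
    also have "(2 powr \<bar>s - m\<bar> * C) * bracket k powr s * bracket (k - l) powr (- (\<bar>s\<bar> + ?d))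
       \<le> (2 powr \<bar>s - m\<bar> * C) * ((2 powr \<bar>s\<bar> * sobolev_weight s l) * bracket (k - l) powr \<bar>s\<bar>) * bracket (k - l) powr (- (\<bar>s\<bar> + ?d))"
      using C(1) order_trans[OF peetre[of k s l] mult_right_mono[OF bracket_le_wt[of l s]]]
      by (intro mult_right_mono mult_left_mono) auto
    also have "\<dots> = D * (bracket (k - l) powr \<bar>s\<bar> * bracket (k - l) powr (- (\<bar>s\<bar> + ?d))) * sobolev_weight s l"
      by (simp only: ac_simps D_def)
    also have "bracket (k - l) powr \<bar>s\<bar> * bracket (k - l) powr (- (\<bar>s\<bar> + ?d)) = bracket (k - l) powr (- ?d)"
      by (simp flip: powr_add)
    finally show ?thesis by (simp add: g_def)
  qed
  have sm: "(\<lambda>l. cmod (K k l * u l)) summable_on UNIV"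
    and ms: "mat_apply K u \<in> sobolev (s - m)"
    and mn: "sobolev_norm (s - m) (mat_apply K u) \<le> infsum g UNIV * sobolev_norm s u"
    if u: "u \<in> sobolev s" for u k
  proof -
    define f where "f l = sobolev_weight s l * cmod (u l)" for l
    have f: "f l \<ge> 0" "(\<lambda>l. (f l)\<^sup>2) summable_on UNIV" for l
      using u sobolev_weight_pos[of s l] by (simp_all add: f_def sobolev_iff)
    note Y = young_convolution[OF g f]
    have le: "sobolev_weight (s - m) k * cmod (K k l * u l) \<le> g (k - l) * f l" for k l
      using mult_right_mono[OF K[of k l], of "cmod (u l)"] by (simp add: norm_mult f_def mult.assoc)
    have sm': "(\<lambda>l. sobolev_weight (s - m) k * cmod (K k l * u l)) summable_on UNIV" for k
      by (rule summable_on_comparison_test[OF Y(1)]) (use le sobolev_weight_pos[of "s - m" k] in auto)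
    show sm: "(\<lambda>l. cmod (K k l * u l)) summable_on UNIV" for k
      using summable_on_cmult_right[OF sm'[of k], of "1 / sobolev_weight (s - m) k"] sobolev_weight_pos[of "s - m" k] by simp
    have app: "(sobolev_weight (s - m) k * cmod (mat_apply K u k))\<^sup>2 \<le> (\<Sum>\<^sub>\<infinity>l. g (k - l) * f l)\<^sup>2" for k
    proof -
      have "sobolev_weight (s - m) k * cmod (mat_apply K u k) \<le> sobolev_weight (s - m) k * (\<Sum>\<^sub>\<infinity>l. cmod (K k l * u l))"
        unfolding mat_apply_def using sobolev_weight_pos[of "s - m" k] sm by (intro mult_left_mono norm_infsum_bound) auto
      also have "\<dots> = (\<Sum>\<^sub>\<infinity>l. sobolev_weight (s - m) k * cmod (K k l * u l))"
        using sm by (simp add: infsum_cmult_right)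
      also have "\<dots> \<le> (\<Sum>\<^sub>\<infinity>l. g (k - l) * f l)"
        by (intro infsum_mono sm' Y le)
      finally show ?thesis using sobolev_weight_pos[of "s - m" k] by (intro power_mono) auto
    qed
    show "mat_apply K u \<in> sobolev (s - m)"
      unfolding sobolev_iff by (rule summable_on_comparison_test[OF Y(2)]) (use app in auto)
    then have "(\<Sum>\<^sub>\<infinity>k. (sobolev_weight (s - m) k * cmod (mat_apply K u k))\<^sup>2) \<le> (\<Sum>\<^sub>\<infinity>k. (\<Sum>\<^sub>\<infinity>l. g (k - l) * f l)\<^sup>2)"
      unfolding sobolev_iff by (intro infsum_mono Y(2) app)
    also have "\<dots> \<le> (infsum g UNIV)\<^sup>2 * (\<Sum>\<^sub>\<infinity>k. (f k)\<^sup>2)" by (rule Y(3))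
    finally have "sobolev_norm (s - m) (mat_apply K u) \<le> sqrt ((infsum g UNIV)\<^sup>2 * (\<Sum>\<^sub>\<infinity>k. (f k)\<^sup>2))"
      unfolding sobolev_norm_eq by (simp add: real_sqrt_le_iff)
    also have "\<dots> = infsum g UNIV * sobolev_norm s u"
      using g(1) by (simp add: real_sqrt_mult infsum_nonneg sobolev_norm_eq f_def)
    finally show "sobolev_norm (s - m) (mat_apply K u) \<le> infsum g UNIV * sobolev_norm s u" .
  qed
  show ?thesis
    by (rule that[of "infsum g UNIV"]) (use sm ms mn g(1) in \<open>auto intro: infsum_nonneg\<close>)
qed

lemma offdiag_summable:
  assumes "offdiag m K" "u \<in> sobolev s"
  shows "(\<lambda>l. cmod (K k l * u l)) summable_on UNIV"
  by (rule offdiag_bounded[OF assms(1), of s thesis for thesis]) (use assms(2) in blast)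

lemma offdiag_sobolev:
  assumes "offdiag m K" "u \<in> sobolev s"
  shows "mat_apply K u \<in> sobolev (s - m)"
  by (rule offdiag_bounded[OF assms(1), of s thesis for thesis]) (use assms(2) in blast)

lemma mat_apply_lincomb:
  assumes "offdiag m K" "u \<in> sobolev s" "v \<in> sobolev s"
  shows "mat_apply K (\<lambda>k. c * u k + d * v k) = (\<lambda>k. c * mat_apply K u k + d * mat_apply K v k)"
proof
  fix k
  have "(\<lambda>l. K k l * u l) summable_on UNIV" "(\<lambda>l. K k l * v l) summable_on UNIV"
    using offdiag_summable[OF assms(1)] assms(2,3) by (blast intro: abs_summable_summable)+
  then have "(\<Sum>\<^sub>\<infinity>l. c * (K k l * u l) + d * (K k l * v l))
     = c * mat_apply K u k + d * mat_apply K v k"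
    unfolding mat_apply_def by (subst infsum_add) (auto simp: infsum_cmult_right intro: summable_on_cmult_right)
  then show "mat_apply K (\<lambda>k. c * u k + d * v k) k = c * mat_apply K u k + d * mat_apply K v k"
    by (simp add: mat_apply_def algebra_simps)
qed

lemma mat_apply_diff:
  "offdiag m K \<Longrightarrow> u \<in> sobolev s \<Longrightarrow> v \<in> sobolev s \<Longrightarrow>
    mat_apply K (\<lambda>k. u k - v k) = (\<lambda>k. mat_apply K u k - mat_apply K v k)"
  using mat_apply_lincomb[of m K u s v 1 "-1"] by simp

text \<open>Absolute convergence of an iterated sum through the entrywise absolute value of \<open>K\<close>, which
  has the same decay as \<open>K\<close>.\<close>

lemma infsum_cmod_mat:
  assumes "offdiag m K" "u \<in> sobolev s"
  shows "of_real (\<Sum>\<^sub>\<infinity>l. cmod (K k l * u l)) = mat_apply (mat_abs K) (\<lambda>l. of_real (cmod (u l))) k"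
proof -
  have "((\<lambda>l. cmod (K k l * u l)) has_sum (\<Sum>\<^sub>\<infinity>l. cmod (K k l * u l))) UNIV"
    using offdiag_summable[OF assms] by simp
  then have "((\<lambda>l. complex_of_real (cmod (K k l * u l))) has_sum of_real (\<Sum>\<^sub>\<infinity>l. cmod (K k l * u l))) UNIV"
    by (rule has_sum_of_real)
  then show ?thesis by (simp add: mat_apply_def mat_abs_def norm_mult infsumI)
qed

text \<open>The double series may be rearranged because its row sums are those of the absolute
  matrix applied to |u|. That sequence has order s - m and pairs absolutely with
  \<open>v\<close>.\<close>

lemma pairing_adjoint:
  assumes K: "offdiag m K" and u: "u \<in> sobolev s" and v: "v \<in> sobolev (m - s)"
  shows "pairing (mat_apply K u) v = pairing u (mat_apply (mat_adj K) v)"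
proof -
  define F where "F k l = K k l * u l * cnj (v k)" for k l
  have s1: "(\<lambda>l. norm (F k l)) summable_on UNIV" for k
    unfolding F_def using summable_on_cmult_left[OF offdiag_summable[OF K u], where c = "cmod (v k)"]
    by (simp add: norm_mult)
  have eq: "(\<Sum>\<^sub>\<infinity>l. norm (F k l)) = cmod (mat_apply (mat_abs K) (\<lambda>l. of_real (cmod (u l))) k) * cmod (v k)" for k
    unfolding F_def using infsum_cmult_left[OF offdiag_summable[OF K u, of k], where c = "cmod (v k)"]
    by (simp add: norm_mult infsum_nonneg flip: infsum_cmod_mat[OF K u])
  have "mat_apply (mat_abs K) (\<lambda>l. of_real (cmod (u l))) \<in> sobolev (s - m)"
    using u by (intro offdiag_sobolev offdiag_abs K) (simp add: sobolev_abs_iff)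
  then have s2: "(\<lambda>k. \<Sum>\<^sub>\<infinity>l. norm (F k l)) summable_on UNIV"
    unfolding eq using v by (intro sobolev_dual_summable[of _ "s - m"]) auto
  have "pairing (mat_apply K u) v = (\<Sum>\<^sub>\<infinity>k. \<Sum>\<^sub>\<infinity>l. F k l)"
    unfolding pairing_def mat_apply_def F_def
    using abs_summable_summable[OF offdiag_summable[OF K u]] by (simp add: infsum_cmult_left)
  also have "\<dots> = (\<Sum>\<^sub>\<infinity>l. \<Sum>\<^sub>\<infinity>k. F k l)" by (rule double_sum(1)[OF s1 s2])
  also have "\<dots> = pairing u (mat_apply (mat_adj K) v)"
    unfolding pairing_def
  proof (rule infsum_cong)
    fix l
    have "(\<Sum>\<^sub>\<infinity>k. F k l) = (\<Sum>\<^sub>\<infinity>k. u l * cnj (mat_adj K l k * v k))"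
      by (simp add: F_def mat_adj_def ac_simps)
    also have "\<dots> = u l * cnj (mat_apply (mat_adj K) v l)"
      unfolding mat_apply_def infsum_cnj[symmetric]
      using abs_summable_summable[OF offdiag_summable[OF offdiag_adj[OF K] v]]
      by (intro infsum_cmult_right) (simp only: summable_on_cnj_iff)
    finally show "(\<Sum>\<^sub>\<infinity>k. F k l) = u l * cnj (mat_apply (mat_adj K) v l)" .
  qed
  finally show ?thesis .
qed

text \<open>Associativity holds for the same reason as above: the absolute matrix of
  \<open>K\<close> applied to |u| still lies in a Sobolev space, on which the rows of
  \<open>B\<close> are absolutely summable.\<close>

lemma mat_apply_comp:
  assumes B: "offdiag m' B" and K: "offdiag m K" and u: "u \<in> sobolev s"
  shows "mat_apply B (mat_apply K u) = mat_apply (mat_comp B K) u"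
proof
  fix j
  define F where "F p l = B j p * K p l * u l" for p l
  have s1: "(\<lambda>l. norm (F p l)) summable_on UNIV" for p
    unfolding F_def using summable_on_cmult_right[OF offdiag_summable[OF K u], where c = "cmod (B j p)"]
    by (simp add: norm_mult mult.assoc)
  have eq: "(\<Sum>\<^sub>\<infinity>l. norm (F p l)) = cmod (B j p * mat_apply (mat_abs K) (\<lambda>l. of_real (cmod (u l))) p)" for p
    unfolding F_def using infsum_cmult_right[OF offdiag_summable[OF K u, of p], where c = "cmod (B j p)"]
    by (simp add: norm_mult mult.assoc infsum_nonneg flip: infsum_cmod_mat[OF K u])
  have "mat_apply (mat_abs K) (\<lambda>l. of_real (cmod (u l))) \<in> sobolev (s - m)"
    using u by (intro offdiag_sobolev offdiag_abs K) (simp add: sobolev_abs_iff)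
  then have s2: "(\<lambda>p. \<Sum>\<^sub>\<infinity>l. norm (F p l)) summable_on UNIV"
    unfolding eq using offdiag_summable[OF B] by blast
  have "mat_apply B (mat_apply K u) j = (\<Sum>\<^sub>\<infinity>p. \<Sum>\<^sub>\<infinity>l. F p l)"
    unfolding mat_apply_def F_def mult.assoc
    using abs_summable_summable[OF offdiag_summable[OF K u]] by (simp add: infsum_cmult_right)
  also have "\<dots> = (\<Sum>\<^sub>\<infinity>l. \<Sum>\<^sub>\<infinity>p. F p l)" by (rule double_sum(1)[OF s1 s2])
  also have "\<dots> = mat_apply (mat_comp B K) u j"
    unfolding mat_apply_def
  proof (rule infsum_cong)
    fix l
    show "(\<Sum>\<^sub>\<infinity>p. F p l) = mat_comp B K j l * u l"
      unfolding mat_comp_def F_def by (rule infsum_cmult_left')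
  qed
  finally show "mat_apply B (mat_apply K u) j = mat_apply (mat_comp B K) u j" .
qed

section \<open>Schwartz sequences\<close>

lemma coords: "distinct (coords :: 'n::finite list)" "set (coords :: 'n list) = UNIV"
proof -
  have "\<exists>js::'n list. distinct js \<and> set js = UNIV"
    using finite_distinct_list[of "UNIV :: 'n set"] by auto
  from someI_ex[OF this] show "distinct (coords :: 'n list)" "set (coords :: 'n list) = UNIV"
    unfolding coords_def by auto
qed

text \<open>For a multi-index concentrated at one coordinate, the arbitrary enumeration
  \<open>coords\<close> disappears and a pure power of a single operator remains.\<close>

lemma foldr_single:
  assumes "distinct xs" "j \<in> set xs" "\<And>i. i \<noteq> j \<Longrightarrow> F i = id"
  shows "foldr F xs = F j"
  using assms(1,2)
proof (induction xs)
  case (Cons i xs)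
  have id: "foldr F ys = id" if "j \<notin> set ys" for ys
    using that by (induction ys) (auto simp: assms(3))
  show ?case using Cons by (cases "i = j") (auto simp: id assms(3))
qed simp

lemma mi_diff_zero: "mi_diff (\<lambda>_. 0) u = u"
proof -
  have "foldr (\<lambda>j. fdiff j ^^ 0) xs u = u" for xs by (induction xs) auto
  then show ?thesis by (simp add: mi_diff_def)
qed

lemma mi_diff_single: "mi_diff (\<lambda>i. if i = j then 1 else 0) u = fdiff j u"
  unfolding mi_diff_def
  by (subst foldr_single[of _ j]) (auto simp: coords id_def)

text \<open>The largest of 1 and the |k_j| is at least 1/(n+1) times the bracket, and its power is
  one of the terms on the right. This reduces decay in the bracket to decay in each coordinate
  separately.\<close>

lemma bracket_power_le:
  "bracket (k :: int ^ 'n::finite) ^ N \<le> real (CARD('n) + 1) ^ N * (1 + (\<Sum>j\<in>UNIV. \<bar>real_of_int (k $ j)\<bar> ^ N))"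
proof -
  let ?A = "insert 1 (range (\<lambda>j. \<bar>real_of_int (k $ j)\<bar>))"
  define M where "M = Max ?A"
  have le: "1 \<le> M" "\<bar>real_of_int (k $ j)\<bar> \<le> M" for j
    unfolding M_def by (intro Max_ge; simp)+
  have "M \<in> ?A" unfolding M_def by (intro Max_in) auto
  then have MN: "M ^ N \<le> 1 + (\<Sum>j\<in>UNIV. \<bar>real_of_int (k $ j)\<bar> ^ N)"
  proof
    assume "M = 1" then show ?thesis by (simp add: sum_nonneg)
  next
    assume "M \<in> range (\<lambda>j. \<bar>real_of_int (k $ j)\<bar>)"
    then obtain j where "M = \<bar>real_of_int (k $ j)\<bar>" by auto
    then have "M ^ N \<le> (\<Sum>j\<in>UNIV. \<bar>real_of_int (k $ j)\<bar> ^ N)"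
      using member_le_sum[of j UNIV "\<lambda>j. \<bar>real_of_int (k $ j)\<bar> ^ N"] by simp
    then show ?thesis by simp
  qed
  have "bracket k \<le> 1 + (\<Sum>j\<in>UNIV. \<bar>real_of_int (k $ j)\<bar>)"
    using norm_le_l1_cart[of "rvec k"] by (simp add: bracket_def znorm_def rvec_simps)
  also have "(\<Sum>j\<in>UNIV. \<bar>real_of_int (k $ j)\<bar>) \<le> (\<Sum>j\<in>(UNIV::'n set). M)"
    using le by (intro sum_mono) auto
  finally have "bracket k \<le> 1 + real CARD('n) * M" by simp
  also have "\<dots> \<le> real (CARD('n) + 1) * M" using le(1) by (simp add: algebra_simps)
  finally have "bracket k ^ N \<le> (real (CARD('n) + 1) * M) ^ N"
    using bracket_pos[of k] by (intro power_mono) auto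
  also have "\<dots> = real (CARD('n) + 1) ^ N * M ^ N" by (simp add: power_mult_distrib)
  also have "\<dots> \<le> real (CARD('n) + 1) ^ N * (1 + (\<Sum>j\<in>UNIV. \<bar>real_of_int (k $ j)\<bar> ^ N))"
    using MN by (intro mult_left_mono) auto
  finally show ?thesis .
qed

lemma le_powr_neg_iff: "x \<le> C * bracket k powr (- s) \<longleftrightarrow> bracket k powr s * x \<le> C"
  using bracket_powr_pos[of k s] by (simp add: powr_minus_divide field_simps)

text \<open>Differences are absent: on the lattice they are combinations of shifted values, so decay
  of the values alone already describes the Schwartz space.\<close>

definition rapid :: "'n::finite lattice_fun \<Rightarrow> bool" where
  "rapid u \<longleftrightarrow> (\<forall>N::nat. \<exists>C\<ge>0. \<forall>k. bracket k ^ N * cmod (u k) \<le> C)"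

text \<open>A unit shift changes the bracket by at most the factor 2, hence its N-th power by at
  most 2^N.\<close>

lemma rapid_fdiff:
  assumes "rapid u" shows "rapid (fdiff j u)"
  unfolding rapid_def
proof
  fix N
  obtain C where C: "C \<ge> 0" "\<And>k. bracket k ^ N * cmod (u k) \<le> C" using assms unfolding rapid_def by blast
  have "bracket k ^ N * cmod (fdiff j u k) \<le> 2 ^ N * C + C" for k
  proof -
    have "bracket k \<le> 2 * bracket (k + axis j 1)"
      using bracket_add[of "k + axis j 1" "- axis j 1"] by (simp add: bracket_minus bracket_axis mult.commute)
    then have "bracket k ^ N \<le> (2 * bracket (k + axis j 1)) ^ N" using bracket_pos[of k] by (intro power_mono) auto
    then have "bracket k ^ N * cmod (u (k + axis j 1)) \<le> (2 * bracket (k + axis j 1)) ^ N * cmod (u (k + axis j 1))"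
      by (intro mult_right_mono) auto
    also have "\<dots> = 2 ^ N * (bracket (k + axis j 1) ^ N * cmod (u (k + axis j 1)))" 
      by (simp add: power_mult_distrib)
    also have "\<dots> \<le> 2 ^ N * C" using C by (intro mult_left_mono) auto
    finally have 1: "bracket k ^ N * cmod (u (k + axis j 1)) \<le> 2 ^ N * C" .
    have "bracket k ^ N * cmod (fdiff j u k) \<le> bracket k ^ N * (cmod (u (k + axis j 1)) + cmod (u k))"
      unfolding fdiff_def using bracket_pos[of k] by (intro mult_left_mono norm_triangle_ineq4) auto
    then show ?thesis using 1 C(2)[of k] by (simp add: algebra_simps)
  qed
  moreover have "2 ^ N * C + C \<ge> 0" using C(1) by simp
  ultimately show "\<exists>C\<ge>0. \<forall>k. bracket k ^ N * cmod (fdiff j u k) \<le> C" by blast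
qed

lemma rapid_mi_diff:
  assumes "rapid u" shows "rapid (mi_diff \<beta> u)"
proof -
  have f: "rapid ((fdiff j ^^ r) u)" if "rapid u" for j r and u :: "'a lattice_fun"
    using that by (induction r) (auto intro: rapid_fdiff)
  have "rapid (foldr (\<lambda>j. fdiff j ^^ \<beta> j) xs u)" for xs
    using assms by (induction xs) (auto intro: f)
  then show ?thesis by (simp add: mi_diff_def)
qed

lemma schwartz_iff_rapid:
  fixes u :: "'n::finite lattice_fun"
  shows "u \<in> schwartz \<longleftrightarrow> rapid u"
proof
  assume u: "(u :: 'n lattice_fun) \<in> schwartz"
  show "rapid u"
    unfolding rapid_def
  proof
    fix N :: nat
    have bd: "bdd_above (range (\<lambda>k. cmod ((\<Prod>j\<in>UNIV. of_int (k $ j) ^ \<alpha> j) * u k)))" for \<alpha>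
    proof -
      have "bdd_above (range (\<lambda>k. cmod ((\<Prod>j\<in>UNIV. of_int (k $ j) ^ \<alpha> j) * mi_diff (\<lambda>_. 0) u k)))"
        by (rule u[unfolded schwartz_def mem_Collect_eq, THEN spec, THEN spec])
      then show ?thesis by (simp only: mi_diff_zero)
    qed
    \<comment> \<open>The multi-index with \<open>N\<close> at \<open>j\<close> and 0 elsewhere
      isolates a power of a single coordinate.\<close>
    have "\<exists>B. \<forall>k. \<bar>real_of_int (k $ j)\<bar> ^ N * cmod (u k) \<le> B" for j
    proof -
      have "(\<Prod>i\<in>UNIV. (of_int (k $ i) :: complex) ^ (if i = j then N else 0)) = of_int (k $ j) ^ N" for k :: "int ^ 'n"
        by (subst prod.remove[of _ j]) auto
      then show ?thesis
        using bd[of "\<lambda>i. if i = j then N else 0"] by (auto simp: bdd_above_def norm_mult norm_power)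
    qed
    then obtain B where B: "\<And>j k. \<bar>real_of_int (k $ j)\<bar> ^ N * cmod (u k) \<le> B j" by metis
    obtain B0 where B0: "\<And>k. cmod (u k) \<le> B0"
      using bd[of "\<lambda>_. 0"] by (auto simp: bdd_above_def)
    have le: "bracket k ^ N * cmod (u k) \<le> real (CARD('n) + 1) ^ N * (B0 + (\<Sum>j\<in>UNIV. B j))" for k
    proof -
      have "bracket k ^ N * cmod (u k) \<le> (real (CARD('n) + 1) ^ N * (1 + (\<Sum>j\<in>UNIV. \<bar>real_of_int (k $ j)\<bar> ^ N))) * cmod (u k)"
        by (intro mult_right_mono bracket_power_le) auto
      also have "\<dots> = real (CARD('n) + 1) ^ N * (cmod (u k) + (\<Sum>j\<in>UNIV. \<bar>real_of_int (k $ j)\<bar> ^ N * cmod (u k)))"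
        by (simp add: algebra_simps sum_distrib_left sum_distrib_right)
      also have "\<dots> \<le> real (CARD('n) + 1) ^ N * (B0 + (\<Sum>j\<in>UNIV. B j))"
        by (intro mult_left_mono add_mono B0 sum_mono B) auto
      finally show ?thesis .
    qed
    \<comment> \<open>Nonnegativity of the constant is read off at \<open>k = 0\<close>, where the
      left side is nonnegative.\<close>
    have "0 \<le> real (CARD('n) + 1) ^ N * (B0 + (\<Sum>j\<in>UNIV. B j))"
      by (rule order_trans[OF _ le[of 0]]) (simp add: bracket_zero)
    then show "\<exists>C\<ge>0. \<forall>k. bracket k ^ N * cmod (u k) \<le> C" using le by blast
  qed
next
  assume u: "rapid u"
  show "u \<in> schwartz"
    unfolding schwartz_def
  proof (intro CollectI allI)
    fix \<alpha> \<beta> :: "'n \<Rightarrow> nat"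
    obtain C where C: "\<And>k. bracket k ^ sum \<alpha> UNIV * cmod (mi_diff \<beta> u k) \<le> C"
      using rapid_mi_diff[OF u, of \<beta>] unfolding rapid_def by blast
    have "cmod ((\<Prod>j\<in>UNIV. of_int (k $ j) ^ \<alpha> j) * mi_diff \<beta> u k) \<le> C" for k
    proof -
      have "\<bar>real_of_int (k $ j)\<bar> \<le> bracket k" for j using component_le_jb[of k j] by linarith
      then have "cmod (\<Prod>j\<in>UNIV. of_int (k $ j) ^ \<alpha> j) \<le> (\<Prod>j\<in>UNIV. bracket k ^ \<alpha> j)"
        unfolding prod_norm[symmetric] by (intro prod_mono) (auto simp: norm_power intro!: power_mono)
      also have "\<dots> = bracket k ^ sum \<alpha> UNIV" by (simp add: power_sum)
      finally have "cmod (\<Prod>j\<in>UNIV. of_int (k $ j) ^ \<alpha> j) * cmod (mi_diff \<beta> u k) \<le> bracket k ^ sum \<alpha> UNIV * cmod (mi_diff \<beta> u k)"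
        by (intro mult_right_mono) auto
      then show ?thesis using C[of k] by (simp add: norm_mult)
    qed
    then show "bdd_above (range (\<lambda>k. cmod ((\<Prod>j\<in>UNIV. of_int (k $ j) ^ \<alpha> j) * mi_diff \<beta> u k)))"
      by (auto simp: bdd_above_def)
  qed
qed

text \<open>With this, mapping properties on Schwartz sequences are inherited from the Sobolev
  bounds, and linear combinations need no separate treatment.\<close>

lemma schwartz_iff_sobolev:
  fixes u :: "'n::finite lattice_fun"
  shows "u \<in> schwartz \<longleftrightarrow> (\<forall>s. u \<in> sobolev s)"
proof
  assume "(u :: 'n lattice_fun) \<in> schwartz"
  then have u: "rapid u" by (simp add: schwartz_iff_rapid)
  show "\<forall>s. u \<in> sobolev s"
  proof
    fix s :: real
    \<comment> \<open>The surplus of n powers becomes the summable exponent 2n after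
      squaring.\<close>
    define N where "N = nat \<lceil>\<bar>s\<bar>\<rceil> + CARD('n)"
    have N: "real N \<ge> s + real CARD('n)" unfolding N_def by linarith
    obtain C where C: "C \<ge> 0" "\<And>k. bracket k ^ N * cmod (u k) \<le> C" using u unfolding rapid_def by blast
    show "u \<in> sobolev s"
      unfolding sobolev_iff
    proof (rule summable_on_comparison_test)
      show "(\<lambda>k::int^'n. (2 powr \<bar>s\<bar> * C)\<^sup>2 * bracket k powr (- (2 * real CARD('n)))) summable_on UNIV"
        by (intro summable_on_cmult_right bracket_summable_nat)
      fix k :: "int ^ 'n"
      have "bracket k powr s * cmod (u k) \<le> C * bracket k powr (- real CARD('n))"
      proof -
        have "bracket k powr real CARD('n) * (bracket k powr s * cmod (u k)) = bracket k powr (s + real CARD('n)) * cmod (u k)"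
          by (simp add: powr_add)
        also have "\<dots> \<le> bracket k powr (real N) * cmod (u k)"
          using N by (intro mult_right_mono bracket_powr_mono) auto
        also have "\<dots> \<le> C" using C(2)[of k] bracket_pos[of k] by (simp add: powr_realpow)
        finally show ?thesis by (simp add: le_powr_neg_iff)
      qed
      then have "2 powr \<bar>s\<bar> * (bracket k powr s * cmod (u k)) \<le> 2 powr \<bar>s\<bar> * (C * bracket k powr (- real CARD('n)))"
        by (intro mult_left_mono) auto
      moreover have "sobolev_weight s k * cmod (u k) \<le> 2 powr \<bar>s\<bar> * bracket k powr s * cmod (u k)"
        by (intro mult_right_mono sobolev_weight_le_jb) auto
      ultimately have "sobolev_weight s k * cmod (u k) \<le> 2 powr \<bar>s\<bar> * C * bracket k powr (- real CARD('n))"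
        by (simp only: mult.assoc)
      then have "(sobolev_weight s k * cmod (u k))\<^sup>2 \<le> (2 powr \<bar>s\<bar> * C * bracket k powr (- real CARD('n)))\<^sup>2"
        using sobolev_weight_pos[of s k] by (intro power_mono) auto
      also have "\<dots> = (2 powr \<bar>s\<bar> * C)\<^sup>2 * (bracket k powr (- real CARD('n)))\<^sup>2" by (simp add: power_mult_distrib)
      also have "(bracket k powr (- real CARD('n)))\<^sup>2 = bracket k powr (- (2 * real CARD('n)))"
        by (simp add: power2_eq_square flip: powr_add)
      finally show "(sobolev_weight s k * cmod (u k))\<^sup>2 \<le> (2 powr \<bar>s\<bar> * C)\<^sup>2 * bracket k powr (- (2 * real CARD('n)))" .
    qed auto
  qed
next
  assume u: "\<forall>s. (u :: 'n lattice_fun) \<in> sobolev s"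
  have "rapid u"
    unfolding rapid_def
  proof
    fix N :: nat
    have "bracket k ^ N * cmod (u k) \<le> 2 powr (real N) * sobolev_norm N u" for k
    proof -
      have "bracket k ^ N * cmod (u k) \<le> (2 powr \<bar>real N\<bar> * sobolev_weight N k) * cmod (u k)"
        using bracket_le_wt[of k "real N"] bracket_pos[of k] by (intro mult_right_mono) (auto simp: powr_realpow)
      also have "\<dots> \<le> 2 powr (real N) * sobolev_norm N u"
        using sobolev_weight_times_cmod_le[of u "real N" k] u by (simp add: mult.assoc)
      finally show ?thesis .
    qed
    then show "\<exists>C\<ge>0. \<forall>k. bracket k ^ N * cmod (u k) \<le> C"
      by (intro exI[of _ "2 powr (real N) * sobolev_norm N u"]) (auto simp: sobolev_norm_nonneg)
  qed
  then show "u \<in> schwartz" by (simp add: schwartz_iff_rapid)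
qed

lemma schwartz_sobolev: "u \<in> schwartz \<Longrightarrow> u \<in> sobolev s"
  by (simp add: schwartz_iff_sobolev)

lemma finite_support_schwartz:
  assumes "finite F" "\<And>k. k \<notin> F \<Longrightarrow> u k = 0"
  shows "u \<in> schwartz"
proof -
  have "finite {k. (sobolev_weight s k * cmod (u k))\<^sup>2 \<noteq> 0}" for s
    by (rule finite_subset[OF _ assms(1)]) (use assms(2) in force)
  then show ?thesis
    unfolding schwartz_iff_sobolev sobolev_iff by (auto intro: finite_nonzero_values_imp_summable_on)
qed

lemma infsum_only:
  assumes "\<And>k. k \<noteq> l \<Longrightarrow> f k = 0"
  shows "infsum f UNIV = f l"
proof -
  have "infsum f UNIV = infsum f {l}" by (rule infsum_cong_neutral) (use assms in auto)
  then show ?thesis by simp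
qed

text \<open>Test vectors: pairing with them reads off single entries, so an identity tested on all
  Schwartz sequences becomes an equality of sequences.\<close>

definition unit_fun :: "int ^ 'n::finite \<Rightarrow> 'n lattice_fun" where
  "unit_fun l = (\<lambda>k. if k = l then 1 else 0)"

lemma unit_fun_schwartz: "unit_fun l \<in> schwartz"
  by (rule finite_support_schwartz[of "{l}"]) (auto simp: unit_fun_def)

lemma pairing_unit_fun_right: "pairing u (unit_fun l) = u l"
  unfolding pairing_def
  by (subst infsum_only[of l]) (auto simp: unit_fun_def)

lemma pairing_unit_fun_left: "pairing (unit_fun l) u = cnj (u l)"
  unfolding pairing_def
  by (subst infsum_only[of l]) (auto simp: unit_fun_def)

lemma mat_apply_schwartz:
  assumes "offdiag m K" "u \<in> schwartz"
  shows "mat_apply K u \<in> schwartz"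
  unfolding schwartz_iff_sobolev
proof
  fix s
  show "mat_apply K u \<in> sobolev s"
    using offdiag_sobolev[OF assms(1) schwartz_sobolev[OF assms(2), of "s + m"]] by simp
qed

text \<open>Truncation to a finite set carrying all but (epsilon/2)^2 of the squared norm; a
  finitely supported sequence is Schwartz.\<close>

lemma schwartz_dense:
  assumes u: "u \<in> sobolev s" and "\<epsilon> > 0"
  obtains w where "w \<in> schwartz" "sobolev_norm s (\<lambda>k. w k - u k) < \<epsilon>"
proof -
  let ?f = "\<lambda>k. (sobolev_weight s k * cmod (u k))\<^sup>2"
  have sm: "?f summable_on UNIV" using u by (simp add: sobolev_iff)
  obtain F where F: "finite F" "dist (sum ?f F) (infsum ?f UNIV) \<le> (\<epsilon> / 2)\<^sup>2"
    using infsum_finite_approximation[OF sm, of "(\<epsilon> / 2)\<^sup>2"] assms(2) by auto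
  define w where "w k = (if k \<in> F then u k else 0)" for k
  have "infsum ?f UNIV = infsum ?f F + infsum ?f (- F)"
    using infsum_Un_disjoint[of ?f F "- F"] sm F(1)
    by (simp add: Compl_partition summable_on_subset_banach[OF sm])
  then have "infsum ?f (- F) \<le> (\<epsilon> / 2)\<^sup>2"
    using F by (simp add: dist_real_def)
  moreover have "(\<Sum>\<^sub>\<infinity>k. (sobolev_weight s k * cmod (w k - u k))\<^sup>2) = infsum ?f (- F)"
    by (rule infsum_cong_neutral) (auto simp: w_def)
  ultimately have "sobolev_norm s (\<lambda>k. w k - u k) \<le> \<epsilon> / 2"
    unfolding sobolev_norm_eq using assms(2) by (intro real_le_lsqrt) (auto intro: infsum_nonneg)
  moreover have "w \<in> schwartz" using F(1) by (rule finite_support_schwartz) (simp add: w_def)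
  ultimately show ?thesis using that assms(2) by force
qed

lemma schwartz_dense_sequence:
  assumes u: "u \<in> sobolev s"
  obtains w where "\<And>i::nat. w i \<in> schwartz" "(\<lambda>i. sobolev_norm s (\<lambda>k. w i k - u k)) \<longlonglongrightarrow> 0"
proof -
  have "\<exists>w. w \<in> schwartz \<and> sobolev_norm s (\<lambda>k. w k - u k) < inverse (real (Suc i))" for i
    by (rule schwartz_dense[OF u, of "inverse (real (Suc i))"]) auto
  then obtain w where w: "\<And>i. w i \<in> schwartz" "\<And>i. sobolev_norm s (\<lambda>k. w i k - u k) < inverse (real (Suc i))"
    by metis
  have "(\<lambda>i. sobolev_norm s (\<lambda>k. w i k - u k)) \<longlonglongrightarrow> 0"
    by (rule tendsto_sandwich[OF _ _ tendsto_const LIMSEQ_inverse_real_of_nat])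
      (use w(2) in \<open>auto simp: sobolev_norm_nonneg less_imp_le\<close>)
  with w(1) show ?thesis using that by blast
qed

section \<open>Closures and adjoints\<close>

lemma offdiag_norm_bound:
  assumes "offdiag m K" "s - m = t"
  obtains C where "C \<ge> 0"
    "\<And>u. u \<in> sobolev s \<Longrightarrow> sobolev_norm t (mat_apply K u) \<le> C * sobolev_norm s u"
proof -
  show thesis
    by (rule offdiag_bounded[OF assms(1), of s]) (use that assms(2) in blast)
qed

text \<open>The left parametrix gives u = B (K u) - E u. The first term has order t + m, the second
  is one order better than what is known of \<open>u\<close>; feeding the gain back improves
  \<open>u\<close> one order at a time.\<close>

lemma elliptic_regularity:
  assumes K: "offdiag m K" and B: "offdiag (- m) B" and E: "offdiag (- 1) E"
    and BK: "\<And>k l. mat_comp B K k l = mat_id k l + E k l"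
    and u: "u \<in> sobolev s" and Ku: "mat_apply K u \<in> sobolev t"
  shows "u \<in> sobolev (t + m)"
proof -
  have eq: "u = (\<lambda>k. mat_apply B (mat_apply K u) k - mat_apply E u k)"
  proof
    fix k
    have s1: "(\<lambda>l. mat_id k l * u l) summable_on UNIV"
      by (rule finite_nonzero_values_imp_summable_on) (auto simp: mat_id_def)
    have s2: "(\<lambda>l. E k l * u l) summable_on UNIV"
      by (rule abs_summable_summable[OF offdiag_summable[OF E u]])
    have "(\<Sum>\<^sub>\<infinity>l. mat_id k l * u l) = u k"
      by (subst infsum_only[of k]) (auto simp: mat_id_def)
    then have "mat_apply (mat_comp B K) u k = u k + mat_apply E u k"
      using infsum_add[OF s1 s2] by (simp add: mat_apply_def BK distrib_right)
    then show "u k = mat_apply B (mat_apply K u) k - mat_apply E u k"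
      by (simp add: mat_apply_comp[OF B K u])
  qed
  \<comment> \<open>The minimum caps the gain at t + m, the order of the term with
    \<open>B\<close>.\<close>
  have "u \<in> sobolev (min (t + m) (s + real i))" for i
  proof (induction i)
    case 0
    show ?case by (rule sobolev_mono(1)[OF _ u]) simp
  next
    case (Suc i)
    have "mat_apply B (mat_apply K u) \<in> sobolev (t + m)"
      using offdiag_sobolev[OF B Ku] by simp
    then have 1: "mat_apply B (mat_apply K u) \<in> sobolev (min (t + m) (s + real (Suc i)))"
      by (rule sobolev_mono(1)[rotated]) simp
    have 2: "mat_apply E u \<in> sobolev (min (t + m) (s + real (Suc i)))"
      by (rule sobolev_mono(1)[OF _ offdiag_sobolev[OF E Suc]]) auto
    show ?case by (subst eq) (rule sobolev_diff[OF 1 2])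
  qed
  \<comment> \<open>After this many rounds s + i has passed t + m, so the minimum equals t +
    m.\<close>
  from this[of "nat \<lceil>t + m - s\<rceil>"] show ?thesis
    using real_nat_ceiling_ge[of "t + m - s"] by (simp add: min_def split: if_splits)
qed

lemma dom_restricted_op: "dom (restricted_op T D) = D"
  by (auto simp: restricted_op_def split: if_splits)

text \<open>A closure point satisfies v = K u because both limits are taken entry by entry.
  Conversely, regularity places \<open>u\<close> in order t + m, where one approximating sequence
  serves for \<open>u\<close> and for \<open>K u\<close>. The result does not mention sequences,
  which makes it comparable with an adjoint.\<close>

lemma graph_closure_elliptic:
  assumes K: "offdiag m K" and B: "offdiag (- m) B" and E: "offdiag (- 1) E"
    and BK: "\<And>k l. mat_comp B K k l = mat_id k l + E k l"
    and T: "\<And>u. u \<in> schwartz \<Longrightarrow> T u = mat_apply K u"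
    and order: "m > s - t"
  shows "graph_closure s t (restricted_op T schwartz) =
    {(u, v). u \<in> sobolev s \<and> v \<in> sobolev t \<and> v = mat_apply K u}" (is "?G = ?H")
proof (intro set_eqI iffI)
  have Tw: "the (restricted_op T schwartz w) = mat_apply K w" if "w \<in> schwartz" for w
    using that T by (simp add: restricted_op_def)
  fix x
  {
    assume "x \<in> ?G"
    moreover obtain u v where x: "x = (u, v)" by (cases x)
    ultimately obtain w where u: "u \<in> sobolev s" and v: "v \<in> sobolev t"
      and w': "\<forall>i::nat. w i \<in> schwartz" 
      and wu: "(\<lambda>i. sobolev_norm s (\<lambda>k. w i k - u k)) \<longlonglongrightarrow> 0"
      and wv': "(\<lambda>i. sobolev_norm t (\<lambda>k. the (restricted_op T schwartz (w i)) k - v k)) \<longlonglongrightarrow> 0"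
      unfolding graph_closure_def dom_restricted_op by blast
    have w: "w i \<in> schwartz" for i using w' by blast
    have wv: "(\<lambda>i. sobolev_norm t (\<lambda>k. mat_apply K (w i) k - v k)) \<longlonglongrightarrow> 0"
      using wv' by (simp only: Tw[OF w])
    obtain C where C: "C \<ge> 0" 
      "\<And>u. u \<in> sobolev s \<Longrightarrow> sobolev_norm (s - m) (mat_apply K u) \<le> C * sobolev_norm s u"
      by (rule offdiag_norm_bound[OF K refl, of s]) (rule that)
    \<comment> \<open>A priori K u lies only in the larger space of order s - m, while v has order
      t. Convergence in either norm implies convergence of each entry, where the two limits can be
      compared.\<close>
    have "v k = mat_apply K u k" for k
    proof (rule LIMSEQ_unique)
      have "(\<lambda>i. mat_apply K (w i) k - v k) \<longlonglongrightarrow> 0"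
      proof (rule Lim_null_comparison)
        have "sobolev_weight t k * cmod (mat_apply K (w i) k - v k) \<le> sobolev_norm t (\<lambda>k. mat_apply K (w i) k - v k)" for i
          using sobolev_weight_times_cmod_le[OF sobolev_diff[OF schwartz_sobolev[OF mat_apply_schwartz[OF K w]] v]] .
        then show "\<forall>\<^sub>F i in sequentially. cmod (mat_apply K (w i) k - v k) 
            \<le> 1 / sobolev_weight t k * sobolev_norm t (\<lambda>k. mat_apply K (w i) k - v k)"
          using sobolev_weight_pos[of t k] by (intro always_eventually) (simp add: field_simps)
        show "(\<lambda>i. 1 / sobolev_weight t k * sobolev_norm t (\<lambda>k. mat_apply K (w i) k - v k)) \<longlonglongrightarrow> 0"
          using tendsto_mult_left[OF wv, of "1 / sobolev_weight t k"] by simp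
      qed
      then show "(\<lambda>i. mat_apply K (w i) k) \<longlonglongrightarrow> v k" by (simp add: LIM_zero_iff)
      have "(\<lambda>i. mat_apply K (w i) k - mat_apply K u k) \<longlonglongrightarrow> 0"
      proof (rule Lim_null_comparison)
        have "sobolev_weight (s - m) k * cmod (mat_apply K (w i) k - mat_apply K u k) \<le> C * sobolev_norm s (\<lambda>k. w i k - u k)" for i
        proof -
          have d: "(\<lambda>k. w i k - u k) \<in> sobolev s" using sobolev_diff[OF schwartz_sobolev[OF w] u] .
          have "sobolev_weight (s - m) k * cmod (mat_apply K (w i) k - mat_apply K u k)
              = sobolev_weight (s - m) k * cmod (mat_apply K (\<lambda>k. w i k - u k) k)"
            using mat_apply_diff[OF K schwartz_sobolev[OF w] u] by simp
          also have "\<dots> \<le> sobolev_norm (s - m) (mat_apply K (\<lambda>k. w i k - u k))"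
            by (rule sobolev_weight_times_cmod_le[OF offdiag_sobolev[OF K d]])
          also have "\<dots> \<le> C * sobolev_norm s (\<lambda>k. w i k - u k)" by (rule C(2)[OF d])
          finally show ?thesis .
        qed
        then show "\<forall>\<^sub>F i in sequentially. cmod (mat_apply K (w i) k - mat_apply K u k) 
            \<le> C / sobolev_weight (s - m) k * sobolev_norm s (\<lambda>k. w i k - u k)"
          using sobolev_weight_pos[of "s - m" k] by (intro always_eventually) (simp add: field_simps)
        show "(\<lambda>i. C / sobolev_weight (s - m) k * sobolev_norm s (\<lambda>k. w i k - u k)) \<longlonglongrightarrow> 0"
          using tendsto_mult_left[OF wu, of "C / sobolev_weight (s - m) k"] by simp
      qed
      then show "(\<lambda>i. mat_apply K (w i) k) \<longlonglongrightarrow> mat_apply K u k" by (simp add: LIM_zero_iff)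
    qed
    then show "x \<in> ?H" using x u v by auto
  next
    assume "x \<in> ?H"
    then obtain u where x: "x = (u, mat_apply K u)" and u: "u \<in> sobolev s" and Ku: "mat_apply K u \<in> sobolev t"
      by auto
    have u': "u \<in> sobolev (t + m)" by (rule elliptic_regularity[OF K B E BK u Ku])
    obtain w where w: "\<And>i::nat. w i \<in> schwartz" 
      and wu: "(\<lambda>i. sobolev_norm (t + m) (\<lambda>k. w i k - u k)) \<longlonglongrightarrow> 0"
      using schwartz_dense_sequence[OF u'] by blast
    have d: "(\<lambda>k. w i k - u k) \<in> sobolev (t + m)" for i using sobolev_diff[OF schwartz_sobolev[OF w] u'] .
    obtain C where C: "C \<ge> 0" 
      "\<And>u. u \<in> sobolev (t + m) \<Longrightarrow> sobolev_norm t (mat_apply K u) \<le> C * sobolev_norm (t + m) u"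
      by (rule offdiag_norm_bound[OF K, of "t + m" t]) (simp, rule that)
    \<comment> \<open>Here the condition on the order enters: s < t + m, so convergence in order t +
      m implies convergence in order s.\<close>
    have 1: "(\<lambda>i. sobolev_norm s (\<lambda>k. w i k - u k)) \<longlonglongrightarrow> 0"
      by (rule tendsto_sandwich[OF _ _ tendsto_const wu])
        (use sobolev_mono(2)[OF _ d, of s] order in \<open>auto simp: sobolev_norm_nonneg\<close>)
    have le: "sobolev_norm t (\<lambda>k. mat_apply K (w i) k - mat_apply K u k) \<le> C * sobolev_norm (t + m) (\<lambda>k. w i k - u k)" for i
      using C(2)[OF d, of i] mat_apply_diff[OF K schwartz_sobolev[OF w] u'] by simp
    have lim: "(\<lambda>i. C * sobolev_norm (t + m) (\<lambda>k. w i k - u k)) \<longlonglongrightarrow> 0"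
      using tendsto_mult_left[OF wu, of C] by simp
    have 2: "(\<lambda>i. sobolev_norm t (\<lambda>k. mat_apply K (w i) k - mat_apply K u k)) \<longlonglongrightarrow> 0"
      by (rule tendsto_sandwich[OF _ _ tendsto_const lim]) (simp_all only: sobolev_norm_nonneg le eventually_True)
    show "x \<in> ?G"
      unfolding x graph_closure_def mem_Collect_eq case_prod_conv dom_restricted_op
      by (intro conjI exI[of _ w] allI u Ku w) (simp_all only: Tw[OF w] 1 2)
  }
qed

lemma densely_defined_restricted:
  assumes K: "offdiag m K" and T: "\<And>u. u \<in> schwartz \<Longrightarrow> T u = mat_apply K u"
  shows "densely_defined_op s t (restricted_op T schwartz)"
  unfolding densely_defined_op_def dom_restricted_op
proof (intro conjI ballI allI impI)
  show "schwartz \<subseteq> sobolev s" by (auto intro: schwartz_sobolev)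
  show "ran (restricted_op T schwartz) \<subseteq> sobolev t"
    by (auto simp: ran_def restricted_op_def T split: if_splits intro: schwartz_sobolev mat_apply_schwartz[OF K])
next
  fix u v :: "'a lattice_fun" and c assume uv: "u \<in> schwartz" "v \<in> schwartz"
  have "(\<lambda>k. c * u k + v k) \<in> schwartz"
    using sobolev_lincomb[of u _ v c 1] uv by (simp add: schwartz_iff_sobolev)
  then show "restricted_op T schwartz (\<lambda>k. c * u k + v k) =
    Some (\<lambda>k. c * the (restricted_op T schwartz u) k + the (restricted_op T schwartz v) k)"
    using uv mat_apply_lincomb[OF K schwartz_sobolev schwartz_sobolev, of u v c 1]
    by (simp add: restricted_op_def T)
next
  fix u :: "'a lattice_fun" and \<epsilon> :: real assume "u \<in> sobolev s" "\<epsilon> > 0"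
  then show "\<exists>w\<in>schwartz. sobolev_norm s (\<lambda>k. w k - u k) < \<epsilon>"
    using schwartz_dense by metis
qed

lemma mat_adj_adj: "mat_adj (mat_adj K) = K"
  by (simp add: mat_adj_def)

text \<open>The formal adjoint is a definite description: the conjugate transpose provides
  existence, pairing with unit functions uniqueness.\<close>

lemma formal_adjoint_mat:
  assumes K: "offdiag m K" and T: "\<And>u. u \<in> schwartz \<Longrightarrow> T u = mat_apply K u" and v: "v \<in> schwartz"
  shows "formal_adjoint T v = mat_apply (mat_adj K) v"
  unfolding formal_adjoint_def
proof (rule the_equality)
  have eq: "pairing (T u) v = pairing u (mat_apply (mat_adj K) v)" if "u \<in> schwartz" for u
    using pairing_adjoint[OF K schwartz_sobolev[OF that, of 0] schwartz_sobolev[OF v]] T[OF that] by simp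
  then show "mat_apply (mat_adj K) v \<in> schwartz \<and> (\<forall>u\<in>schwartz. pairing (T u) v = pairing u (mat_apply (mat_adj K) v))"
    using mat_apply_schwartz[OF offdiag_adj[OF K] v] by blast
  fix w assume "w \<in> schwartz \<and> (\<forall>u\<in>schwartz. pairing (T u) v = pairing u w)"
  then have "pairing (unit_fun l) w = pairing (unit_fun l) (mat_apply (mat_adj K) v)" for l
    using eq unit_fun_schwartz[of l] by metis
  then show "w = mat_apply (mat_adj K) v" by (simp add: pairing_unit_fun_left fun_eq_iff)
qed

text \<open>The hypotheses are symmetric under K -> K adjoint: a left and a right parametrix
  exchange roles, and m > s - t is also m > (-t) - (-s). One closure lemma thus covers both
  operators, and it remains to see that the adjoints have the same graphs.\<close>

theorem essentially_adjoint_offdiag: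
  assumes K: "offdiag m K" and B: "offdiag (- m) B" and E: "offdiag (- 1) E" and E': "offdiag (- 1) E'"
    and BK: "\<And>k l. mat_comp B K k l = mat_id k l + E k l"
    and KB: "\<And>k l. mat_comp K B k l = mat_id k l + E' k l"
    and T: "\<And>u. u \<in> schwartz \<Longrightarrow> T u = mat_apply K u"
    and order: "m > s - t"
  shows "essentially_adjoint_pair s t (restricted_op T schwartz) (restricted_op (formal_adjoint T) schwartz)"
proof -
  let ?Y = "restricted_op T schwartz" and ?Z = "restricted_op (formal_adjoint T) schwartz"
  note K' = offdiag_adj[OF K]
  have T': "formal_adjoint T v = mat_apply (mat_adj K) v" if "v \<in> schwartz" for v
    by (rule formal_adjoint_mat[OF K T that])
  \<comment> \<open>Conjugate transposition reverses the order of a product, so the right parametrix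
    of \<open>K\<close> becomes a left parametrix of its adjoint.\<close>
  have BK': "mat_comp (mat_adj B) (mat_adj K) k l = mat_id k l + mat_adj E' k l" for k l
  proof -
    have "mat_comp (mat_adj B) (mat_adj K) k l = cnj (mat_comp K B l k)"
      by (simp add: mat_comp_def mat_adj_def mult.commute flip: infsum_cnj)
    then show ?thesis by (simp add: KB mat_adj_def mat_id_def)
  qed
  have GY: "graph_closure s t ?Y = {(u, v). u \<in> sobolev s \<and> v \<in> sobolev t \<and> v = mat_apply K u}"
    by (rule graph_closure_elliptic[OF K B E BK T order])
  have GZ: "graph_closure (- t) (- s) ?Z =
      {(u, v). u \<in> sobolev (- t) \<and> v \<in> sobolev (- s) \<and> v = mat_apply (mat_adj K) u}"
    by (rule graph_closure_elliptic[OF K' offdiag_adj[OF B] offdiag_adj[OF E'] BK' T']) (use order in auto)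
  \<comment> \<open>For \<open>w\<close> in the source space, testing against all Schwartz sequences
    is the same as the equation v = K w. The adjoint relation is therefore exactly the maximal graph
    found for the closure.\<close>
  have AZ: "(\<forall>f\<in>schwartz. pairing (the (?Z f)) w = pairing f v) \<longleftrightarrow> v = mat_apply K w" if "w \<in> sobolev s" for w v
  proof -
    have "pairing (the (?Z f)) w = pairing f (mat_apply K w)" if "f \<in> schwartz" for f
      using pairing_adjoint[OF K' schwartz_sobolev[OF that, of "m - s"], of w] \<open>w \<in> sobolev s\<close> T'[OF that] that
      by (simp add: restricted_op_def mat_adj_adj)
    moreover have "v = mat_apply K w" if *: "\<forall>f\<in>schwartz. pairing f (mat_apply K w) = pairing f v"
      using bspec[OF * unit_fun_schwartz] by (simp add: fun_eq_iff pairing_unit_fun_left)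
    ultimately show ?thesis by auto
  qed
  have AY: "(\<forall>u\<in>schwartz. pairing f (the (?Y u)) = pairing g u) \<longleftrightarrow> g = mat_apply (mat_adj K) f" if "f \<in> sobolev (- t)" for f g
  proof -
    have "pairing f (the (?Y u)) = pairing (mat_apply (mat_adj K) f) u" if "u \<in> schwartz" for u
      using pairing_adjoint[OF K' \<open>f \<in> sobolev (- t)\<close> schwartz_sobolev[OF that]] T[OF that] that
      by (simp add: restricted_op_def mat_adj_adj)
    moreover have "g = mat_apply (mat_adj K) f"
      if *: "\<forall>u\<in>schwartz. pairing (mat_apply (mat_adj K) f) u = pairing g u"
      using bspec[OF * unit_fun_schwartz] by (simp add: fun_eq_iff pairing_unit_fun_right)
    ultimately show ?thesis by auto
  qed
  show ?thesis
    unfolding essentially_adjoint_pair_def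
  proof (intro conjI)
    show "densely_defined_op s t ?Y" by (rule densely_defined_restricted[OF K T])
    show "densely_defined_op (- t) (- s) ?Z" by (rule densely_defined_restricted[OF K' T'])
    show "closable_op s t ?Y" by (auto simp: closable_op_def GY single_valued_def)
    show "closable_op (- t) (- s) ?Z" by (auto simp: closable_op_def GZ single_valued_def)
    show "op_closure s t ?Y = true_adjoint_of_dual s t ?Z"
      unfolding op_closure_def true_adjoint_of_dual_def GY dom_restricted_op
      by (intro arg_cong[of _ _ op_of_graph]) (use AZ in auto)
    show "op_closure (- t) (- s) ?Z = true_adjoint s t ?Y"
      unfolding op_closure_def true_adjoint_def GZ dom_restricted_op
      by (intro arg_cong[of _ _ op_of_graph]) (use AY in auto)
  qed
qed

section \<open>Fourier series on the torus\<close>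

definition torus_char :: "int ^ 'n::finite \<Rightarrow> real ^ 'n \<Rightarrow> complex" where
  "torus_char q x = exp (2 * of_real pi * \<i> * of_real (rvec q \<bullet> x))"

definition fourier_coeff :: "(real ^ 'n::finite \<Rightarrow> complex) \<Rightarrow> int ^ 'n \<Rightarrow> complex" where
  "fourier_coeff f q = integral (cbox 0 1) (\<lambda>x. f x * torus_char (- q) x)"

definition torus_cont :: "(real ^ 'n::finite \<Rightarrow> complex) set" where
  "torus_cont = {f. continuous_on UNIV f \<and> (\<forall>j x. f (x + axis j 1) = f x)}"

lemma torus_char_add: "torus_char (p + q) x = torus_char p x * torus_char q x"
  by (simp add: torus_char_def rvec_simps inner_add_left distrib_left flip: exp_add)

lemma torus_char_zero [simp]: "torus_char 0 x = 1"
  by (simp add: torus_char_def rvec_simps)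

lemma cmod_ef [simp]: "cmod (torus_char q x) = 1"
proof -
  have "torus_char q x = exp (\<i> * of_real (2 * pi * (rvec q \<bullet> x)))"
    unfolding torus_char_def by (simp add: ac_simps)
  then show ?thesis by (simp only: norm_exp_i_times)
qed

lemma torus_char_cnj: "cnj (torus_char q x) = torus_char (- q) x"
  by (simp add: torus_char_def rvec_simps exp_cnj)

lemma torus_char_continuous [continuous_intros]: "continuous_on S (torus_char q)"
  unfolding torus_char_def[abs_def] by (intro continuous_intros)

lemma torus_char_shift: "torus_char q (x + t *\<^sub>R axis j 1) = torus_char q x * exp (2 * of_real pi * \<i> * of_int (q $ j) * of_real t)"
proof -
  have "rvec q \<bullet> (x + t *\<^sub>R axis j 1) = rvec q \<bullet> x + t * real_of_int (q $ j)"
    by (simp add: inner_add_right inner_axis rvec_simps)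
  then show ?thesis
    by (simp add: torus_char_def distrib_left ac_simps flip: exp_add)
qed

lemma torus_char_torus_cont: "torus_char q \<in> torus_cont"
proof -
  have "exp (2 * of_real pi * \<i> * of_int n) = 1" for n :: int
    using exp_integer_2pi[of "of_int n"] by (simp add: ac_simps)
  then show ?thesis
    using torus_char_shift[of q _ 1] by (auto simp: torus_cont_def intro: torus_char_continuous)
qed

lemma torus_cont_continuous: "f \<in> torus_cont \<Longrightarrow> continuous_on S f"
  by (auto simp: torus_cont_def intro: continuous_on_subset)

lemma torus_cont_add: "f \<in> torus_cont \<Longrightarrow> g \<in> torus_cont \<Longrightarrow> (\<lambda>x. f x + g x) \<in> torus_cont"
  by (auto simp: torus_cont_def intro: continuous_intros)

lemma torus_cont_mult: "f \<in> torus_cont \<Longrightarrow> g \<in> torus_cont \<Longrightarrow> (\<lambda>x. f x * g x) \<in> torus_cont"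
  by (auto simp: torus_cont_def intro: continuous_intros)

lemma torus_cont_const: "(\<lambda>_. c) \<in> torus_cont"
  by (auto simp: torus_cont_def intro: continuous_intros)

lemma content_cube: "measure lborel (cbox 0 (1 :: real ^ 'n::finite)) = 1"
proof -
  have "(0 :: real ^ 'n) \<in> cbox 0 1" by (simp add: mem_box_cart)
  then have "cbox 0 (1 :: real ^ 'n) \<noteq> {}" by blast
  then show ?thesis by (simp add: content_cbox_cart)
qed

lemma cube_integrable: "continuous_on UNIV f \<Longrightarrow> f integrable_on cbox a b"
  for f :: "real ^ 'n::finite \<Rightarrow> complex"
  by (rule integrable_continuous) (rule continuous_on_subset, auto)

text \<open>Shifting the unit cube by \<open>t\<close> in direction \<open>j\<close> removes a slab at one end and adds its
  translate by a period at the other end.\<close>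

lemma torus_integral_shift:
  assumes f: "f \<in> torus_cont" and t: "0 \<le> t" "t \<le> 1"
  shows "integral (cbox 0 1) (\<lambda>x. f (x + t *\<^sub>R axis j 1)) = integral (cbox 0 1) f"
proof -
  let ?e = "axis j 1 :: real ^ 'a"
  have cf: "continuous_on UNIV f" and per: "\<And>x. f (x + ?e) = f x" using f by (auto simp: torus_cont_def)
  define Q where "Q = cbox 0 (1 + t *\<^sub>R ?e)"
  have hi: "(f has_integral integral (cbox a b) f) (cbox a b)" for a b
    using cube_integrable[OF cf] by (rule integrable_integral)
  have b: "?e \<in> Basis" by (auto simp: Basis_vec_def)
  have box: "x \<in> cbox (\<alpha> *\<^sub>R ?e) (1 + \<gamma> *\<^sub>R ?e) \<longleftrightarrow>
      \<alpha> \<le> x $ j \<and> x $ j \<le> 1 + \<gamma> \<and> (\<forall>i. i \<noteq> j \<longrightarrow> 0 \<le> x $ i \<and> x $ i \<le> 1)" for \<alpha> \<gamma> and x :: "real ^ 'a"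
  proof -
    have split: "(\<forall>i. P i) \<longleftrightarrow> P j \<and> (\<forall>i. i \<noteq> j \<longrightarrow> P i)" for P by (rule iffI; fast)
    show ?thesis unfolding mem_box_cart by (subst split) (simp add: axis_def)
  qed
  have box0: "x \<in> cbox 0 (1 + \<gamma> *\<^sub>R ?e) \<longleftrightarrow>
      0 \<le> x $ j \<and> x $ j \<le> 1 + \<gamma> \<and> (\<forall>i. i \<noteq> j \<longrightarrow> 0 \<le> x $ i \<and> x $ i \<le> 1)" for \<gamma> and x :: "real ^ 'a"
    using box[of x 0 \<gamma>] by simp
  have ej: "x \<bullet> ?e = x $ j" for x by (simp add: inner_axis)
  \<comment> \<open>\<open>Q\<close> is the cube lengthened by \<open>t\<close> in direction
    \<open>j\<close>, cut once at height \<open>t\<close> and once at height 1. The cuts leave the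
    shifted cube and the cube itself; the other two pieces are slabs a period apart.\<close>
  have e1: "Q \<inter> {x. x \<bullet> ?e \<le> t} = cbox 0 (1 + (t - 1) *\<^sub>R ?e)"
    unfolding Q_def set_eq_iff Int_iff box0 mem_Collect_eq ej using t by auto
  have e2: "Q \<inter> {x. x \<bullet> ?e \<ge> t} = cbox (t *\<^sub>R ?e) (1 + t *\<^sub>R ?e)"
    unfolding Q_def set_eq_iff Int_iff box0 box mem_Collect_eq ej using t by auto
  have e3: "Q \<inter> {x. x \<bullet> ?e \<le> 1} = cbox 0 1"
  proof -
    have "x \<in> cbox 0 1 \<longleftrightarrow> 0 \<le> x $ j \<and> x $ j \<le> 1 \<and> (\<forall>i. i \<noteq> j \<longrightarrow> 0 \<le> x $ i \<and> x $ i \<le> 1)" for x :: "real ^ 'a"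
      using box0[of x 0] by (simp only: scaleR_zero_left add_0_right)
    then show ?thesis unfolding Q_def set_eq_iff Int_iff box0 mem_Collect_eq ej using t by auto
  qed
  have e4: "Q \<inter> {x. x \<bullet> ?e \<ge> 1} = cbox ?e (1 + t *\<^sub>R ?e)"
    using t box[of _ 1 t] unfolding Q_def set_eq_iff Int_iff box0 mem_Collect_eq ej by auto
  have "(f has_integral integral (cbox 0 (1 + (t - 1) *\<^sub>R ?e)) f + integral (cbox (t *\<^sub>R ?e) (1 + t *\<^sub>R ?e)) f) Q"
    using has_integral_split[OF _ _ b, of f _ 0 "1 + t *\<^sub>R ?e" t] hi e1 e2 unfolding Q_def by metis
  moreover have "(f has_integral integral (cbox 0 1) f + integral (cbox ?e (1 + t *\<^sub>R ?e)) f) Q"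
    using has_integral_split[OF _ _ b, of f _ 0 "1 + t *\<^sub>R ?e" 1] hi e3 e4 unfolding Q_def by metis
  ultimately have "integral (cbox 0 (1 + (t - 1) *\<^sub>R ?e)) f + integral (cbox (t *\<^sub>R ?e) (1 + t *\<^sub>R ?e)) f
     = integral (cbox 0 1) f + integral (cbox ?e (1 + t *\<^sub>R ?e)) f"
    by (rule has_integral_unique)
  moreover have "integral (cbox ?e (1 + t *\<^sub>R ?e)) f = integral (cbox 0 (1 + (t - 1) *\<^sub>R ?e)) f"
    using integral_shift_cbox[of ?e ?e "1 + t *\<^sub>R ?e" f] by (simp add: per algebra_simps)
  moreover have "integral (cbox (t *\<^sub>R ?e) (1 + t *\<^sub>R ?e)) f = integral (cbox 0 1) (\<lambda>x. f (x + t *\<^sub>R ?e))"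
    using integral_shift_cbox[of "t *\<^sub>R ?e" "t *\<^sub>R ?e" "1 + t *\<^sub>R ?e" f] by simp
  ultimately show ?thesis by simp
qed

text \<open>A relation between functions rather than an operator, so that derivatives of products
  and reciprocals can be assembled from given ones; the derivative at 0 for every base point covers
  the whole line in direction \<open>j\<close>.\<close>

definition has_partial :: "'n::finite \<Rightarrow> (real ^ 'n \<Rightarrow> complex) \<Rightarrow> (real ^ 'n \<Rightarrow> complex) \<Rightarrow> bool" where
  "has_partial j f f' \<longleftrightarrow> (\<forall>x. ((\<lambda>t. f (x + t *\<^sub>R axis j 1)) has_vector_derivative f' x) (at 0))"

lemma has_partial_mult:
  assumes "has_partial j f f'" "has_partial j g g'"
  shows "has_partial j (\<lambda>x. f x * g x) (\<lambda>x. f x * g' x + f' x * g x)"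
  unfolding has_partial_def
proof
  fix x
  show "((\<lambda>t. f (x + t *\<^sub>R axis j 1) * g (x + t *\<^sub>R axis j 1)) has_vector_derivative f x * g' x + f' x * g x) (at 0)"
    using has_vector_derivative_mult[of _ "f' x" 0 UNIV _ "g' x"] assms unfolding has_partial_def by fastforce
qed

lemma has_partial_ef: "has_partial j (torus_char q) (\<lambda>x. 2 * of_real pi * \<i> * of_int (q $ j) * torus_char q x)"
  unfolding has_partial_def
proof
  fix x
  have "((\<lambda>t. torus_char q x * exp (2 * of_real pi * \<i> * of_int (q $ j) * t)) has_field_derivative
     2 * of_real pi * \<i> * of_int (q $ j) * torus_char q x) (at (of_real 0))"
    by (auto intro!: derivative_eq_intros)
  from has_vector_derivative_real_field[OF this]
  show "((\<lambda>t. torus_char q (x + t *\<^sub>R axis j 1)) has_vector_derivative 2 * of_real pi * \<i> * of_int (q $ j) * torus_char q x) (at 0)"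
    by (simp add: torus_char_shift)
qed

text \<open>The integral of the translates of \<open>f\<close> is constant in the translation by
  periodicity; differentiating it under the integral sign gives the integral of the
  derivative.\<close>

lemma torus_integral_partial:
  assumes f: "f \<in> torus_cont" and f': "continuous_on UNIV f'" and d: "has_partial j f f'"
  shows "integral (cbox 0 1) f' = 0"
proof -
  let ?e = "axis j 1 :: real ^ 'a"
  have cf: "continuous_on UNIV f" using f by (auto simp: torus_cont_def)
  have dt: "((\<lambda>t. f (x + t *\<^sub>R ?e)) has_vector_derivative f' (x + t *\<^sub>R ?e)) (at t within U)" for x t U
  proof -
    have "((\<lambda>s. f ((x + t *\<^sub>R ?e) + s *\<^sub>R ?e)) has_vector_derivative f' (x + t *\<^sub>R ?e)) (at 0)"
      using d unfolding has_partial_def by blast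
    moreover have "((\<lambda>s. s - t) has_vector_derivative 1) (at t)"
      by (auto intro!: derivative_eq_intros)
    ultimately
    have "((\<lambda>s. f (x + s *\<^sub>R ?e)) has_vector_derivative f' (x + t *\<^sub>R ?e)) (at t)"
      using vector_diff_chain_at[of "\<lambda>s. s - t" 1 t "\<lambda>s. f ((x + t *\<^sub>R ?e) + s *\<^sub>R ?e)" "f' (x + t *\<^sub>R ?e)"]
      by (simp add: o_def algebra_simps)
    then show ?thesis by (rule has_vector_derivative_at_within)
  qed
  \<comment> \<open>The derivative is one-sided, within [0,1], because shift invariance is
    established for 0 <= t <= 1; such a derivative is still unique at 0.\<close>
  have "((\<lambda>t. integral (cbox 0 1) (\<lambda>x. f (x + t *\<^sub>R ?e))) has_vector_derivative
      integral (cbox 0 1) (\<lambda>x. f' (x + 0 *\<^sub>R ?e))) (at 0 within {0..1})"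
  proof (rule leibniz_rule_vector_derivative[where U = "{0..1}"])
    show "((\<lambda>t. f (x + t *\<^sub>R ?e)) has_vector_derivative f' (x + t *\<^sub>R ?e)) (at t within {0..1})" for t x
      by (rule dt)
    show "(\<lambda>x. f (x + t *\<^sub>R ?e)) integrable_on cbox 0 1" for t
      by (intro cube_integrable continuous_on_compose2[OF cf] continuous_intros) auto
    show "continuous_on ({0..1} \<times> cbox 0 1) (\<lambda>(t, x). f' (x + t *\<^sub>R ?e))"
      unfolding case_prod_beta' by (intro continuous_on_compose2[OF f'] continuous_intros) auto
  qed auto
  moreover have "((\<lambda>t. integral (cbox 0 1) (\<lambda>x. f (x + t *\<^sub>R ?e))) has_vector_derivative 0) (at 0 within {0..1})"
  proof (rule has_vector_derivative_transform[of 0 "{0..1}" _ "\<lambda>_. integral (cbox 0 1) f"])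
    show "integral (cbox 0 1) (\<lambda>x. f (x + t *\<^sub>R ?e)) = integral (cbox 0 1) f" if "t \<in> {0..1}" for t
      using torus_integral_shift[OF f] that by auto
  qed auto
  ultimately have "integral (cbox 0 1) (\<lambda>x. f' (x + 0 *\<^sub>R ?e)) = 0"
    by (intro vector_derivative_unique_within[of 0 "{0..1::real}"]) (auto simp: trivial_limit_within islimpt_Icc)
  then show ?thesis by simp
qed

text \<open>Integration by parts: the derivative of \<open>f\<close> times a character has integral
  zero, and differentiating the character produces the factor.\<close>

lemma fourier_coeff_partial:
  assumes f: "f \<in> torus_cont" and f': "continuous_on UNIV f'" and d: "has_partial j f f'"
  shows "fourier_coeff f' q = 2 * of_real pi * \<i> * of_int (q $ j) * fourier_coeff f q"
proof -
  let ?c = "2 * of_real pi * \<i> * of_int (q $ j) :: complex"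
  have cf: "continuous_on UNIV f" using f by (auto simp: torus_cont_def)
  have "integral (cbox 0 1) (\<lambda>x. f x * (2 * of_real pi * \<i> * of_int ((- q) $ j) * torus_char (- q) x) + f' x * torus_char (- q) x) = 0"
    by (rule torus_integral_partial[OF torus_cont_mult[OF f torus_char_torus_cont] _ has_partial_mult[OF d has_partial_ef]])
      (intro continuous_intros cf f')
  then have "integral (cbox 0 1) (\<lambda>x. f' x * torus_char (- q) x - ?c * (f x * torus_char (- q) x)) = 0"
    by (simp add: algebra_simps)
  then have "integral (cbox 0 1) (\<lambda>x. f' x * torus_char (- q) x) - integral (cbox 0 1) (\<lambda>x. ?c * (f x * torus_char (- q) x)) = 0"
    by (subst (asm) integral_diff) (intro cube_integrable continuous_intros cf f')+
  then show ?thesis unfolding fourier_coeff_def by simp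
qed

lemma fourier_coeff_bound:
  assumes "continuous_on UNIV f" "\<And>x. cmod (f x) \<le> B"
  shows "cmod (fourier_coeff f q) \<le> B"
proof -
  have "((\<lambda>x. f x * torus_char (- q) x) has_integral fourier_coeff f q) (cbox 0 1)"
    unfolding fourier_coeff_def by (intro integrable_integral cube_integrable continuous_intros assms)
  then have "cmod (fourier_coeff f q) \<le> B * measure lborel (cbox 0 (1 :: real ^ 'a))"
    by (intro has_integral_bound[of B "\<lambda>x. f x * torus_char (- q) x"] order_trans[OF norm_ge_zero assms(2)])
      (auto simp: norm_mult assms(2))
  then show ?thesis by (simp add: content_cube)
qed

text \<open>For different frequencies, choose a direction \<open>j\<close> in which they differ. The
  coefficient of the derivative is both p_j and q_j times the same multiple of the coefficient,
  which must vanish.\<close>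

lemma fourier_coeff_ef: "fourier_coeff (torus_char p) q = (if p = q then 1 else 0)"
proof (cases "p = q")
  case True
  then show ?thesis by (simp add: fourier_coeff_def content_cube flip: torus_char_add)
next
  case False
  then obtain j where j: "p $ j \<noteq> q $ j" by (auto simp: vec_eq_iff)
  have "fourier_coeff (\<lambda>x. 2 * of_real pi * \<i> * of_int (p $ j) * torus_char p x) q = 2 * of_real pi * \<i> * of_int (q $ j) * fourier_coeff (torus_char p) q"
    by (rule fourier_coeff_partial[OF torus_char_torus_cont _ has_partial_ef]) (intro continuous_intros)
  moreover have "fourier_coeff (\<lambda>x. 2 * of_real pi * \<i> * of_int (p $ j) * torus_char p x) q = 2 * of_real pi * \<i> * of_int (p $ j) * fourier_coeff (torus_char p) q"
    unfolding fourier_coeff_def by (simp add: mult.assoc)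
  ultimately show ?thesis using j False by simp
qed

text \<open>The Weierstrass test gives uniform convergence along finite subsets, under which
  continuity and the integral over the cube pass to the limit.\<close>

lemma integral_infsum_cube:
  fixes \<phi> :: "'i \<Rightarrow> real ^ 'n::finite \<Rightarrow> complex"
  assumes c: "\<And>i. continuous_on UNIV (\<phi> i)" and le: "\<And>i x. cmod (\<phi> i x) \<le> M i" and M: "M summable_on UNIV"
  shows "continuous_on UNIV (\<lambda>x. \<Sum>\<^sub>\<infinity>i. \<phi> i x)"
    and "integral (cbox 0 1) (\<lambda>x. \<Sum>\<^sub>\<infinity>i. \<phi> i x) = (\<Sum>\<^sub>\<infinity>i. integral (cbox 0 1) (\<phi> i))"
proof -
  have ul: "uniform_limit UNIV (\<lambda>A x. \<Sum>i\<in>A. \<phi> i x) (\<lambda>x. \<Sum>\<^sub>\<infinity>i. \<phi> i x) (finite_subsets_at_top UNIV)"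
    by (rule Weierstrass_m_test_general[OF le M])
  show "continuous_on UNIV (\<lambda>x. \<Sum>\<^sub>\<infinity>i. \<phi> i x)"
    by (rule uniform_limit_theorem[OF _ ul]) (auto intro!: always_eventually continuous_on_sum c)
  have ulc: "uniform_limit (cbox 0 1) (\<lambda>A x. \<Sum>i\<in>A. \<phi> i x) (\<lambda>x. \<Sum>\<^sub>\<infinity>i. \<phi> i x) (finite_subsets_at_top UNIV)"
    by (rule uniform_limit_on_subset[OF ul]) simp
  obtain I J where I: "\<And>A. ((\<lambda>x. \<Sum>i\<in>A. \<phi> i x) has_integral I A) (cbox 0 1)"
    and J: "((\<lambda>x. \<Sum>\<^sub>\<infinity>i. \<phi> i x) has_integral J) (cbox 0 1)"
    and lim: "(I \<longlongrightarrow> J) (finite_subsets_at_top UNIV)"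
    by (rule uniform_limit_integral_cbox[OF ulc])
      (auto intro!: continuous_on_sum continuous_on_subset[OF c])
  have "I A = (\<Sum>i\<in>A. integral (cbox 0 1) (\<phi> i))" if "finite A" for A
  proof -
    have "I A = integral (cbox 0 1) (\<lambda>x. \<Sum>i\<in>A. \<phi> i x)" by (rule integral_unique[OF I, symmetric])
    also have "\<dots> = (\<Sum>i\<in>A. integral (cbox 0 1) (\<phi> i))"
      using that cube_integrable[OF c] by (intro integral_sum) auto
    finally show ?thesis .
  qed
  then have "((\<lambda>A. \<Sum>i\<in>A. integral (cbox 0 1) (\<phi> i)) \<longlongrightarrow> J) (finite_subsets_at_top UNIV)"
    by (intro Lim_transform_eventually[OF lim] eventually_finite_subsets_at_top_weakI) auto
  then have "((\<lambda>i. integral (cbox 0 1) (\<phi> i)) has_sum J) UNIV" by (simp add: has_sum_def)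
  then show "integral (cbox 0 1) (\<lambda>x. \<Sum>\<^sub>\<infinity>i. \<phi> i x) = (\<Sum>\<^sub>\<infinity>i. integral (cbox 0 1) (\<phi> i))"
    using J by (simp add: infsumI integral_unique)
qed


lemma torus_cont_periodic:
  assumes f: "f \<in> torus_cont"
  shows "f (x + rvec k) = f x"
proof -
  have per: "f (x + axis j 1) = f x" for x j using f by (auto simp: torus_cont_def)
  have nat: "f (x + real r *\<^sub>R axis j 1) = f x" for x j r
  proof (induction r)
    case (Suc r)
    then show ?case using per[of "x + real r *\<^sub>R axis j 1" j] by (simp add: algebra_simps)
  qed simp
  have int: "f (x + real_of_int c *\<^sub>R axis j 1) = f x" for x j c
  proof (cases "c \<ge> 0")
    case True
    then show ?thesis using nat[of x "nat c" j] by simp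
  next
    case False
    then show ?thesis using nat[of "x + real_of_int c *\<^sub>R axis j 1" "nat (- c)" j] by simp
  qed
  have sum: "f (x + (\<Sum>j\<in>A. real_of_int (k $ j) *\<^sub>R axis j 1)) = f x" if "finite A" for A
    using that
  proof (induction A)
    case (insert j A)
    then show ?case
      using int[of "x + (\<Sum>j\<in>A. real_of_int (k $ j) *\<^sub>R axis j 1)" "k $ j" j] by (simp add: algebra_simps)
  qed simp
  have "rvec k = (\<Sum>j\<in>UNIV. real_of_int (k $ j) *\<^sub>R axis j 1)"
    by (simp add: vec_eq_iff rvec_simps sum_component axis_def if_distrib cong: if_cong)
  then show ?thesis using sum[of UNIV] by simp
qed

section \<open>Uniqueness of Fourier coefficients of continuous functions\<close>

definition fourier_coeff_null :: "(real ^ 'n::finite \<Rightarrow> complex) set" where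
  "fourier_coeff_null = {h \<in> torus_cont. \<forall>q. fourier_coeff h q = 0}"

lemma fourier_coeff_add:
  assumes "continuous_on UNIV f" "continuous_on UNIV g"
  shows "fourier_coeff (\<lambda>x. f x + g x) q = fourier_coeff f q + fourier_coeff g q"
  unfolding fourier_coeff_def distrib_right
  by (intro integral_add cube_integrable continuous_intros assms)

lemma fourier_coeff_diff:
  assumes "continuous_on UNIV f" "continuous_on UNIV g"
  shows "fourier_coeff (\<lambda>x. f x - g x) q = fourier_coeff f q - fourier_coeff g q"
  unfolding fourier_coeff_def left_diff_distrib
  by (intro integral_diff cube_integrable continuous_intros assms)

lemma fourier_coeff_cmult: "fourier_coeff (\<lambda>x. c * f x) q = c * fourier_coeff f q"
  by (simp add: fourier_coeff_def mult.assoc)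

lemma fourier_coeff_ef_mult: "fourier_coeff (\<lambda>x. torus_char p x * f x) q = fourier_coeff f (q - p)"
proof -
  have "torus_char p x * f x * torus_char (- q) x = f x * torus_char (p - q) x" for x
    using torus_char_add[of p "- q" x] by (simp add: ac_simps)
  then show ?thesis by (simp only: fourier_coeff_def minus_diff_eq)
qed

lemma fourier_coeff_cnj: "fourier_coeff (\<lambda>x. cnj (f x)) q = cnj (fourier_coeff f (- q))"
  by (simp add: fourier_coeff_def integral_cnj torus_char_cnj)

lemma fourier_coeff_null_add: "f \<in> fourier_coeff_null \<Longrightarrow> g \<in> fourier_coeff_null \<Longrightarrow> (\<lambda>x. f x + g x) \<in> fourier_coeff_null"
  by (simp add: fourier_coeff_null_def torus_cont_add fourier_coeff_add torus_cont_continuous)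

lemma fourier_coeff_null_cmult: "f \<in> fourier_coeff_null \<Longrightarrow> (\<lambda>x. c * f x) \<in> fourier_coeff_null"
  by (auto simp: fourier_coeff_null_def fourier_coeff_cmult intro: torus_cont_mult[OF torus_cont_const])

lemma fourier_coeff_null_ef: "f \<in> fourier_coeff_null \<Longrightarrow> (\<lambda>x. torus_char p x * f x) \<in> fourier_coeff_null"
  by (auto simp: fourier_coeff_null_def fourier_coeff_ef_mult intro: torus_cont_mult[OF torus_char_torus_cont])

lemma fourier_coeff_null_cnj: "f \<in> fourier_coeff_null \<Longrightarrow> (\<lambda>x. cnj (f x)) \<in> fourier_coeff_null"
  by (auto simp: fourier_coeff_null_def fourier_coeff_cnj torus_cont_def intro: continuous_intros)

lemma fourier_coeff_null_sum:
  assumes "finite A" "\<And>i. i \<in> A \<Longrightarrow> f i \<in> fourier_coeff_null"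
  shows "(\<lambda>x. \<Sum>i\<in>A. f i x) \<in> fourier_coeff_null"
  using assms
proof (induction A)
  case empty
  then show ?case using torus_cont_const[of 0] by (simp add: fourier_coeff_null_def fourier_coeff_def)
next
  case (insert i A)
  then show ?case using fourier_coeff_null_add[of "f i" "\<lambda>x. \<Sum>i\<in>A. f i x"] by simp
qed

text \<open>Embeds the torus in a Euclidean space, so that periodic functions live on a compact set
  where polynomial approximation is available.\<close>

definition torus_map :: "real ^ 'n::finite \<Rightarrow> complex ^ 'n" where
  "torus_map x = (\<chi> j. cis (2 * pi * x $ j))"

lemma torus_map_continuous: "continuous_on S torus_map"
  unfolding torus_map_def[abs_def] by (intro continuous_intros)

lemma torus_map_eq:
  assumes "torus_map x = torus_map y"
  obtains k where "x = y + rvec k"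
proof -
  have "\<exists>n::int. x $ j = y $ j + real_of_int n" for j
  proof -
    have "cis (2 * pi * x $ j) = cis (2 * pi * y $ j)" using assms by (simp add: torus_map_def vec_eq_iff)
    then have "sin (2 * pi * x $ j) = sin (2 * pi * y $ j) \<and> cos (2 * pi * x $ j) = cos (2 * pi * y $ j)"
      by (simp add: complex_eq_iff)
    then obtain n :: int where "2 * pi * x $ j = 2 * pi * y $ j + 2 * pi * n"
      unfolding sin_cos_eq_iff by blast
    then have "2 * pi * (x $ j) = 2 * pi * (y $ j + n)" by (simp add: algebra_simps)
    then show ?thesis by auto
  qed
  then obtain n where n: "\<And>j. x $ j = y $ j + real_of_int (n j)" by metis
  have "x = y + rvec (\<chi> j. n j)" using n by (simp add: vec_eq_iff rvec_simps)
  then show ?thesis by (rule that)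
qed

text \<open>A real-linear functional of \<open>torus_map\<close> is a combination of cosines and
  sines of single coordinates, hence of the characters of plus or minus a unit vector, and
  multiplication by a character only shifts the coefficients.\<close>

lemma linear_torus_map:
  assumes L: "bounded_linear (L :: complex ^ 'n::finite \<Rightarrow> real)" and h: "h \<in> fourier_coeff_null"
  shows "(\<lambda>x. of_real (L (torus_map x)) * h x) \<in> fourier_coeff_null"
proof -
  interpret bounded_linear L by fact
  let ?e = "\<lambda>j. axis j 1 :: int ^ 'n"
  have cis: "cis (2 * pi * x $ j) = torus_char (?e j) x" for x j
  proof -
    have "rvec (?e j) \<bullet> x = x $ j" by (simp add: rvec_axis inner_axis')
    then show ?thesis by (simp add: torus_char_def cis_conv_exp ac_simps)
  qed
  have "(of_real (L (torus_map x)) :: complex) =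
     (\<Sum>j\<in>UNIV. of_real (L (axis j 1)) * ((torus_char (?e j) x + torus_char (- ?e j) x) / 2)
            + of_real (L (axis j \<i>)) * ((torus_char (?e j) x - torus_char (- ?e j) x) / (2 * \<i>)))" for x
  proof -
    have "torus_map x = (\<Sum>j\<in>UNIV. cos (2 * pi * x $ j) *\<^sub>R axis j 1 + sin (2 * pi * x $ j) *\<^sub>R axis j \<i>)"
      by (simp add: vec_eq_iff torus_map_def sum_component axis_def if_distrib complex_eq_iff cong: if_cong)
    then have "L (torus_map x) = (\<Sum>j\<in>UNIV. cos (2 * pi * x $ j) * L (axis j 1) + sin (2 * pi * x $ j) * L (axis j \<i>))"
      by (simp add: sum add scaleR)
    moreover have "(of_real (cos (2 * pi * x $ j)) :: complex) = (torus_char (?e j) x + torus_char (- ?e j) x) / 2"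
      and "(of_real (sin (2 * pi * x $ j)) :: complex) = (torus_char (?e j) x - torus_char (- ?e j) x) / (2 * \<i>)" for j
      by (simp_all add: complex_eq_iff flip: torus_char_cnj cis)
    ultimately show ?thesis by (simp only: of_real_sum of_real_add of_real_mult mult.commute)
  qed
  then have eq: "of_real (L (torus_map x)) * h x = (\<Sum>j\<in>UNIV. 
     (of_real (L (axis j 1)) / 2 + of_real (L (axis j \<i>)) / (2 * \<i>)) * (torus_char (?e j) x * h x)
   + (of_real (L (axis j 1)) / 2 - of_real (L (axis j \<i>)) / (2 * \<i>)) * (torus_char (- ?e j) x * h x))" for x
    by (simp add: sum_distrib_right) (intro sum.cong refl, simp add: field_simps)
  show ?thesis unfolding eq
    by (intro fourier_coeff_null_sum fourier_coeff_null_add fourier_coeff_null_cmult fourier_coeff_null_ef h) auto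
qed

text \<open>Multiplication by any polynomial in the coordinates of \<open>torus_map\<close> preserves the vanishing of all
  Fourier coefficients, so by Stone--Weierstrass such a function is orthogonal to itself.\<close>

lemma polynomial_torus_map:
  assumes "real_polynomial_function P" "h \<in> fourier_coeff_null"
  shows "(\<lambda>x. of_real (P (torus_map x)) * h x) \<in> fourier_coeff_null"
  using assms
proof (induction arbitrary: h)
  case (linear f)
  then show ?case by (rule linear_torus_map)
next
  case (const c)
  then show ?case by (rule fourier_coeff_null_cmult)
next
  case (add f g)
  then show ?case using fourier_coeff_null_add[of "\<lambda>x. of_real (f (torus_map x)) * h x" "\<lambda>x. of_real (g (torus_map x)) * h x"]
    by (simp add: distrib_right)
next
  case (mult f g)
  then show ?case by (simp add: mult.assoc)
qed

text \<open>With a polynomial P close to \<open>r\<close> and the integral of P r equal to zero, the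
  integral of r^2 equals that of (r - P) r and is arbitrarily small. Continuity then forces
  \<open>r\<close> to vanish on the cube.\<close>

lemma fourier_coeff_null_real_zero:
  assumes r: "(\<lambda>x. complex_of_real (r x)) \<in> fourier_coeff_null" and x: "x \<in> cbox 0 1"
  shows "r x = (0::real)"
proof -
  have tc: "(\<lambda>x. complex_of_real (r x)) \<in> torus_cont" using r by (simp add: fourier_coeff_null_def)
  have cr: "continuous_on S r" for S
    using continuous_on_Re[OF torus_cont_continuous[OF tc, of S]] by simp
  have eq: "r x = r y" if e: "torus_map x = torus_map y" for x y
  proof -
    obtain k where "x = y + rvec k" by (rule torus_map_eq[OF e])
    then show ?thesis using torus_cont_periodic[OF tc, of y k] by simp
  qed
  let ?Q = "cbox 0 (1 :: real ^ 'a)"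
  define S where "S = torus_map ` ?Q"
  have cS: "compact S" unfolding S_def by (intro compact_continuous_image torus_map_continuous compact_cbox)
  \<comment> \<open>\<open>F\<close> is \<open>r\<close> read on the embedded torus; the choice of
    preimage is harmless, as two preimages differ by a lattice vector.\<close>
  define F where "F z = r (SOME y. torus_map y = z)" for z
  have F: "F (torus_map y) = r y" for y
    unfolding F_def by (rule eq) (rule someI_ex, blast)
  \<comment> \<open>Compactness of the cube makes its image carry the quotient topology: the
    preimage of a closed set under \<open>F\<close> is the image of a compact set.\<close>
  have cF: "continuous_on S F"
    unfolding continuous_on_closed_vimage[OF compact_imp_closed[OF cS]]
  proof (intro allI impI)
    fix B :: "real set" assume "closed B"
    have "F -` B \<inter> S = torus_map ` (r -` B \<inter> ?Q)" unfolding S_def by (auto simp: F)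
    moreover have "compact (r -` B \<inter> ?Q)"
      using closed_vimage_Int[OF \<open>closed B\<close> cr[of ?Q] closed_cbox]
      by (simp add: compact_eq_bounded_closed bounded_Int bounded_cbox)
    ultimately show "closed (F -` B \<inter> S)"
      by (simp add: compact_imp_closed compact_continuous_image torus_map_continuous)
  qed
  obtain M where M: "\<And>y. y \<in> ?Q \<Longrightarrow> \<bar>r y\<bar> \<le> M" "M > 0"
  proof -
    have "bounded (r ` ?Q)" by (intro compact_imp_bounded compact_continuous_image cr compact_cbox)
    then show ?thesis using that unfolding bounded_pos by auto
  qed
  have int2: "(\<lambda>y. (r y)\<^sup>2) integrable_on ?Q"
    by (intro integrable_continuous continuous_intros cr)
  have "integral ?Q (\<lambda>y. (r y)\<^sup>2) \<le> \<epsilon>" if eps: "\<epsilon> > 0" for \<epsilon>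
  proof -
    obtain P where P: "real_polynomial_function P" "\<And>z. z \<in> S \<Longrightarrow> \<bar>F z - P z\<bar> < \<epsilon> / M"
      by (rule Stone_Weierstrass_real_polynomial_function[OF cS cF, of "\<epsilon> / M"])
        (use M(2) eps in simp, rule that)
    have cP: "continuous_on UNIV (\<lambda>y. P (torus_map y))"
      using P(1) by (intro continuous_on_compose2[OF _ torus_map_continuous, of UNIV])
        (auto simp: real_polynomial_function_eq intro: continuous_on_polymonial_function)
    \<comment> \<open>The coefficient at 0 is the plain integral, so its vanishing says that the
      polynomial is orthogonal to \<open>r\<close>.\<close>
    have "fourier_coeff (\<lambda>y. of_real (P (torus_map y)) * of_real (r y)) 0 = 0"
      using polynomial_torus_map[OF P(1) r] by (simp add: fourier_coeff_null_def)
    then have 0: "integral ?Q (\<lambda>y. complex_of_real (P (torus_map y) * r y)) = 0" by (simp add: fourier_coeff_def)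
    have intP: "(\<lambda>y. P (torus_map y) * r y) integrable_on ?Q"
      by (auto intro!: integrable_continuous continuous_intros cr continuous_on_subset[OF cP])
    have "integral ?Q (complex_of_real \<circ> (\<lambda>y. P (torus_map y) * r y)) = of_real (integral ?Q (\<lambda>y. P (torus_map y) * r y))"
      by (rule integral_linear[OF intP bounded_linear_of_real])
    with 0 have 0: "integral ?Q (\<lambda>y. P (torus_map y) * r y) = 0" by (simp add: o_def)
    have "integral ?Q (\<lambda>y. (r y)\<^sup>2) = integral ?Q (\<lambda>y. (r y)\<^sup>2 - P (torus_map y) * r y)"
      using 0 by (subst integral_diff[OF int2 intP]) simp
    also have "\<dots> \<le> integral ?Q (\<lambda>_. \<epsilon>)"
    proof (rule integral_le)
      show "(\<lambda>y. (r y)\<^sup>2 - P (torus_map y) * r y) integrable_on ?Q" by (intro integrable_diff int2 intP)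
      fix y assume y: "y \<in> ?Q"
      have "(r y)\<^sup>2 - P (torus_map y) * r y = (F (torus_map y) - P (torus_map y)) * r y"
        by (simp add: F power2_eq_square algebra_simps)
      also have "\<dots> \<le> \<bar>F (torus_map y) - P (torus_map y)\<bar> * \<bar>r y\<bar>" by (simp flip: abs_mult)
      also have "\<dots> \<le> \<epsilon> / M * M"
        using P(2)[of "torus_map y"] y M eps by (intro mult_mono) (auto simp: S_def less_imp_le)
      finally show "(r y)\<^sup>2 - P (torus_map y) * r y \<le> \<epsilon>" using M(2) by simp
    qed auto
    also have "\<dots> = \<epsilon>" by (simp add: content_cube)
    finally show ?thesis .
  qed
  then have "integral ?Q (\<lambda>y. (r y)\<^sup>2) \<le> 0" by (rule field_le_epsilon) simp
  moreover have "integral ?Q (\<lambda>y. (r y)\<^sup>2) \<ge> 0" by (intro integral_nonneg int2) auto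
  ultimately have "integral ?Q (\<lambda>y. (r y)\<^sup>2) = 0" by simp
  moreover have "box 0 (1 :: real ^ 'a) \<noteq> {}"
  proof -
    have "(\<chi> j. (1 / 2 :: real)) \<in> box 0 (1 :: real ^ 'a)" by (simp add: mem_box_cart)
    then show ?thesis by blast
  qed
  moreover have "continuous_on ?Q (\<lambda>y. (r y)\<^sup>2)" by (intro continuous_intros cr)
  ultimately have "\<forall>y\<in>?Q. (r y)\<^sup>2 = 0" using integral_cbox_eq_0_iff[of 0 1 "\<lambda>y. (r y)\<^sup>2"] by simp
  then show ?thesis using x by simp
qed

text \<open>Stability under conjugation lets the real and imaginary parts be treated separately by
  the real case.\<close>

lemma fourier_coeff_null_zero:
  assumes h: "h \<in> fourier_coeff_null" and x: "x \<in> cbox 0 1"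
  shows "h x = 0"
proof -
  have "(\<lambda>x. 1 / 2 * h x + 1 / 2 * cnj (h x)) \<in> fourier_coeff_null"
    by (intro fourier_coeff_null_add fourier_coeff_null_cmult fourier_coeff_null_cnj h)
  also have "(\<lambda>x. 1 / 2 * h x + 1 / 2 * cnj (h x)) = (\<lambda>x. of_real (Re (h x)))"
    by (auto simp: complex_eq_iff)
  finally have "Re (h x) = 0" by (rule fourier_coeff_null_real_zero[OF _ x])
  moreover have "(\<lambda>x. 1 / (2 * \<i>) * h x + (- 1 / (2 * \<i>)) * cnj (h x)) \<in> fourier_coeff_null"
    by (intro fourier_coeff_null_add fourier_coeff_null_cmult fourier_coeff_null_cnj h)
  moreover have "(\<lambda>x. 1 / (2 * \<i>) * h x + (- 1 / (2 * \<i>)) * cnj (h x)) = (\<lambda>x. of_real (Im (h x)))"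
    by (auto simp: complex_eq_iff)
  ultimately show ?thesis using fourier_coeff_null_real_zero[OF _ x, of "\<lambda>x. Im (h x)"] by (simp add: complex_eq_iff)
qed

text \<open>The sum of the series is continuous, and termwise integration with orthogonality gives
  it the coefficients of \<open>f\<close>; uniqueness does the rest.\<close>

lemma fourier_inversion:
  assumes f: "f \<in> torus_cont" and s: "(\<lambda>q. cmod (fourier_coeff f q)) summable_on UNIV" and x: "x \<in> cbox 0 1"
  shows "f x = (\<Sum>\<^sub>\<infinity>q. fourier_coeff f q * torus_char q x)"
proof -
  define g where "g x = (\<Sum>\<^sub>\<infinity>q. fourier_coeff f q * torus_char q x)" for x
  have cg: "continuous_on UNIV g"
    unfolding g_def[abs_def]
    by (rule integral_infsum_cube(1)[where M = "\<lambda>q. cmod (fourier_coeff f q)"]) (auto simp: norm_mult s intro!: continuous_intros)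
  have g: "g \<in> torus_cont"
  proof -
    have "torus_char q (x + axis j 1) = torus_char q x" for q :: "int ^ 'a" and x j
      using torus_char_torus_cont by (auto simp: torus_cont_def)
    then show ?thesis using cg by (simp add: torus_cont_def g_def)
  qed
  have "fourier_coeff g p = fourier_coeff f p" for p
  proof -
    have "fourier_coeff g p = integral (cbox 0 1) (\<lambda>x. \<Sum>\<^sub>\<infinity>q. fourier_coeff f q * torus_char q x * torus_char (- p) x)"
      unfolding fourier_coeff_def[of g] g_def by (simp add: infsum_cmult_left')
    also have "\<dots> = (\<Sum>\<^sub>\<infinity>q. integral (cbox 0 1) (\<lambda>x. fourier_coeff f q * torus_char q x * torus_char (- p) x))"
      by (rule integral_infsum_cube(2)[where M = "\<lambda>q. cmod (fourier_coeff f q)"]) (auto simp: norm_mult s intro!: continuous_intros)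
    also have "\<dots> = (\<Sum>\<^sub>\<infinity>q. fourier_coeff f q * fourier_coeff (torus_char q) p)"
      by (simp add: fourier_coeff_def[of "torus_char _"] mult.assoc)
    also have "\<dots> = fourier_coeff f p"
      by (subst infsum_only[of p]) (auto simp: fourier_coeff_ef)
    finally show ?thesis .
  qed
  moreover have "(\<lambda>x. f x - g x) \<in> torus_cont"
    using torus_cont_add[OF f torus_cont_mult[OF torus_cont_const[of "- 1"] g]] by simp
  moreover have "fourier_coeff (\<lambda>x. f x - g x) q = fourier_coeff f q - fourier_coeff g q" for q
    by (intro fourier_coeff_diff torus_cont_continuous f g)
  ultimately have "(\<lambda>x. f x - g x) \<in> fourier_coeff_null" by (simp add: fourier_coeff_null_def)
  from fourier_coeff_null_zero[OF this x] show ?thesis by (simp add: g_def)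
qed

lemma torus_cont_bounded:
  assumes g: "g \<in> torus_cont"
  obtains B where "\<And>x. cmod (g x) \<le> B"
proof -
  have "bounded (g ` cbox 0 1)"
    by (intro compact_imp_bounded compact_continuous_image torus_cont_continuous g compact_cbox)
  then obtain B where B: "\<And>x. x \<in> cbox 0 1 \<Longrightarrow> cmod (g x) \<le> B" unfolding bounded_iff by auto
  have "cmod (g x) \<le> B" for x
  proof -
    let ?y = "x - rvec (\<chi> j. \<lfloor>x $ j\<rfloor>)"
    have "g x = g ?y"
      using torus_cont_periodic[OF g, of ?y "\<chi> j. \<lfloor>x $ j\<rfloor>"] by simp
    moreover have "?y \<in> cbox 0 1"
      unfolding mem_box_cart
    proof
      fix i
      show "(0 :: real ^ 'a) $ i \<le> ?y $ i \<and> ?y $ i \<le> (1 :: real ^ 'a) $ i"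
        by (simp add: rvec_simps) linarith
    qed
    ultimately show ?thesis using B by metis
  qed
  then show ?thesis by (rule that)
qed

text \<open>Only \<open>f\<close> is expanded into its series, with \<open>g\<close> a bounded
  factor under the integral; hence summability is asked of the coefficients of \<open>f\<close>
  alone.\<close>

lemma fourier_coeff_mult:
  assumes f: "f \<in> torus_cont" and s: "(\<lambda>q. cmod (fourier_coeff f q)) summable_on UNIV" and g: "g \<in> torus_cont"
  shows "fourier_coeff (\<lambda>x. f x * g x) q = (\<Sum>\<^sub>\<infinity>p. fourier_coeff f p * fourier_coeff g (q - p))"
proof -
  obtain B where gB: "\<And>x. cmod (g x) \<le> B" by (rule torus_cont_bounded[OF g]) (rule that)
  have "fourier_coeff (\<lambda>x. f x * g x) q = integral (cbox 0 1) (\<lambda>x. \<Sum>\<^sub>\<infinity>p. fourier_coeff f p * (torus_char p x * g x * torus_char (- q) x))"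
    unfolding fourier_coeff_def[of "\<lambda>x. f x * g x"]
  proof (rule integral_cong)
    fix x :: "real ^ 'a" assume "x \<in> cbox 0 1"
    from fourier_inversion[OF f s this]
    have "f x * g x * torus_char (- q) x = (\<Sum>\<^sub>\<infinity>p. fourier_coeff f p * torus_char p x) * (g x * torus_char (- q) x)" by (simp add: mult.assoc)
    also have "\<dots> = (\<Sum>\<^sub>\<infinity>p. fourier_coeff f p * torus_char p x * (g x * torus_char (- q) x))" by (rule infsum_cmult_left'[symmetric])
    finally show "f x * g x * torus_char (- q) x = (\<Sum>\<^sub>\<infinity>p. fourier_coeff f p * (torus_char p x * g x * torus_char (- q) x))" by (simp add: mult.assoc)
  qed
  also have "\<dots> = (\<Sum>\<^sub>\<infinity>p. integral (cbox 0 1) (\<lambda>x. fourier_coeff f p * (torus_char p x * g x * torus_char (- q) x)))"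
  proof (rule integral_infsum_cube(2))
    show "continuous_on UNIV (\<lambda>x. fourier_coeff f p * (torus_char p x * g x * torus_char (- q) x))" for p
      by (intro continuous_intros torus_cont_continuous g)
    show "(\<lambda>p. cmod (fourier_coeff f p) * B) summable_on UNIV" by (intro summable_on_cmult_left s)
    show "cmod (fourier_coeff f p * (torus_char p x * g x * torus_char (- q) x)) \<le> cmod (fourier_coeff f p) * B" for p x
      using gB[of x] by (auto simp: norm_mult intro!: mult_left_mono)
  qed
  also have "\<dots> = (\<Sum>\<^sub>\<infinity>p. fourier_coeff f p * fourier_coeff g (q - p))"
    by (simp add: fourier_coeff_def[of "\<lambda>x. torus_char _ x * g x", symmetric] fourier_coeff_ef_mult)
  finally show ?thesis .
qed

section \<open>Matrices of pseudo-differential operators\<close>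

definition symbol_matrix :: "'n::finite lattice_symbol \<Rightarrow> 'n lattice_matrix" where
  "symbol_matrix a k l = fourier_coeff (a k) (l - k)"

lemma pdo_eq_mat_apply:
  assumes a: "\<And>k. a k \<in> torus_cont" and u: "u \<in> schwartz"
  shows "pdo a u = mat_apply (symbol_matrix a) u"
proof
  fix k
  have us: "(\<lambda>l. cmod (u l)) summable_on UNIV"
  proof -
    obtain C where C: "C \<ge> 0" "\<And>k. bracket k ^ (2 * CARD('a)) * cmod (u k) \<le> C"
      using u unfolding schwartz_iff_rapid rapid_def by blast
    show ?thesis
    proof (rule summable_on_comparison_test)
      show "(\<lambda>k::int^'a. C * bracket k powr (- (2 * real CARD('a)))) summable_on UNIV"
        by (intro summable_on_cmult_right bracket_summable_nat)
      fix k :: "int ^ 'a"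
      have "bracket k powr (2 * real CARD('a)) = bracket k ^ (2 * CARD('a))"
        using bracket_pos[of k] by (simp flip: powr_realpow)
      then show "cmod (u k) \<le> C * bracket k powr (- (2 * real CARD('a)))"
        using C(2)[of k] by (simp only: le_powr_neg_iff)
    qed auto
  qed
  obtain B where B: "\<And>x. cmod (a k x) \<le> B" by (rule torus_cont_bounded[OF a[of k]]) (rule that)
  have "pdo a u k = integral (cbox 0 1) (\<lambda>x. \<Sum>\<^sub>\<infinity>l. a k x * torus_char (- (l - k)) x * u l)"
    unfolding pdo_def
  proof (rule integral_cong)
    fix x :: "real ^ 'a"
    \<comment> \<open>The factor of frequency \<open>k\<close> and the term of frequency
      \<open>-l\<close> from the Fourier transform of \<open>u\<close> combine to the character of
      \<open>-(l - k)\<close>, which explains the index in \<open>symbol_matrix\<close>.\<close>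
    have "exp (2 * of_real pi * \<i> * of_real (rvec k \<bullet> x)) * a k x * fourier u x
        = torus_char k x * a k x * (\<Sum>\<^sub>\<infinity>l. torus_char (- l) x * u l)"
      by (simp add: fourier_def torus_char_def rvec_simps)
    also have "\<dots> = (\<Sum>\<^sub>\<infinity>l. torus_char k x * a k x * (torus_char (- l) x * u l))" by (rule infsum_cmult_right'[symmetric])
    also have "\<dots> = (\<Sum>\<^sub>\<infinity>l. a k x * torus_char (- (l - k)) x * u l)"
      using torus_char_add[of k "- l" x for l] by (simp add: ac_simps)
    finally show "exp (2 * of_real pi * \<i> * of_real (rvec k \<bullet> x)) * a k x * fourier u x
        = (\<Sum>\<^sub>\<infinity>l. a k x * torus_char (- (l - k)) x * u l)" .
  qed
  also have "\<dots> = (\<Sum>\<^sub>\<infinity>l. integral (cbox 0 1) (\<lambda>x. a k x * torus_char (- (l - k)) x * u l))"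
  proof (rule integral_infsum_cube(2))
    show "continuous_on UNIV (\<lambda>x. a k x * torus_char (- (l - k)) x * u l)" for l
      by (intro continuous_intros torus_cont_continuous a)
    show "(\<lambda>l. B * cmod (u l)) summable_on UNIV" by (intro summable_on_cmult_right us)
    show "cmod (a k x * torus_char (- (l - k)) x * u l) \<le> B * cmod (u l)" for l x
      using B[of x] by (auto simp: norm_mult intro!: mult_right_mono)
  qed
  also have "\<dots> = mat_apply (symbol_matrix a) u k"
    by (simp add: mat_apply_def symbol_matrix_def fourier_coeff_def)
  finally show "pdo a u k = mat_apply (symbol_matrix a) u k" .
qed

section \<open>Families of functions with weighted derivative bounds\<close>

text \<open>One constant serves the whole family, and all dependence on the index goes into
  \<open>W\<close>. The index set is kept variable because reciprocals exist only away from small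
  \<open>k\<close>.\<close>

definition bcont :: "'i set \<Rightarrow> ('i \<Rightarrow> real) \<Rightarrow> ('i \<Rightarrow> real ^ 'n::finite \<Rightarrow> complex) \<Rightarrow> bool" where
  "bcont I W f \<longleftrightarrow> (\<forall>i\<in>I. f i \<in> torus_cont) \<and> (\<exists>C\<ge>0. \<forall>i\<in>I. \<forall>x. cmod (f i x) \<le> C * W i)"

text \<open>Only the pure derivatives in direction \<open>j\<close> up to order \<open>r\<close> are controlled: they suffice for the
  decay of Fourier coefficients. The recursive form makes closure under products and
  reciprocals a plain induction on \<open>r\<close>, without Leibniz formulas.\<close>

primrec bdiff :: "'n \<Rightarrow> nat \<Rightarrow> 'i set \<Rightarrow> ('i \<Rightarrow> real) \<Rightarrow> ('i \<Rightarrow> real ^ 'n::finite \<Rightarrow> complex) \<Rightarrow> bool" where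
  "bdiff j 0 I W f \<longleftrightarrow> bcont I W f"
| "bdiff j (Suc r) I W f \<longleftrightarrow> bcont I W f \<and> (\<exists>f'. (\<forall>i\<in>I. has_partial j (f i) (f' i)) \<and> bdiff j r I W f')"

lemma bdiff_SucI:
  assumes "bcont I W f" "\<And>i. i \<in> I \<Longrightarrow> has_partial j (f i) (f' i)" "bdiff j r I W f'"
  shows "bdiff j (Suc r) I W f"
  using assms by auto

lemma bdiff_bcont: "bdiff j r I W f \<Longrightarrow> bcont I W f"
  by (cases r) auto

lemma bdiff_Suc_D: "bdiff j (Suc r) I W f \<Longrightarrow> bdiff j r I W f"
proof (induction r arbitrary: f)
  case (Suc r)
  then show ?case by (auto simp del: bdiff.simps(2) simp: bdiff.simps(2)[of _ r] bdiff.simps(2)[of _ "Suc r"])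
qed auto

lemma bcont_weight:
  assumes "bcont I W f" "D \<ge> 0" "\<And>i. i \<in> J \<Longrightarrow> i \<in> I" "\<And>i. i \<in> J \<Longrightarrow> W i \<le> D * V i"
  shows "bcont J V f"
proof -
  obtain C where C: "C \<ge> 0" "\<And>i x. i \<in> I \<Longrightarrow> cmod (f i x) \<le> C * W i" using assms(1) by (auto simp: bcont_def)
  have "cmod (f i x) \<le> (C * D) * V i" if "i \<in> J" for i x
    using order_trans[OF C(2)[OF assms(3)[OF that]] mult_left_mono[OF assms(4)[OF that] C(1)]]
    by (simp add: mult.assoc)
  moreover have "C * D \<ge> 0" using C(1) assms(2) by simp
  ultimately show ?thesis using assms(1,3) unfolding bcont_def by blast
qed

lemma bdiff_weight:
  assumes "bdiff j r I W f" "D \<ge> 0" "\<And>i. i \<in> J \<Longrightarrow> i \<in> I" "\<And>i. i \<in> J \<Longrightarrow> W i \<le> D * V i"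
  shows "bdiff j r J V f"
  using assms(1)
proof (induction r arbitrary: f)
  case 0
  then show ?case using bcont_weight[OF _ assms(2-4)] by simp
next
  case (Suc r)
  then obtain f' where "bcont I W f" "\<forall>i\<in>I. has_partial j (f i) (f' i)" "bdiff j r I W f'" by auto
  show ?case
    by (rule bdiff_SucI[OF bcont_weight[OF \<open>bcont I W f\<close> assms(2-4)] _ Suc.IH])
      (use \<open>\<forall>i\<in>I. has_partial j (f i) (f' i)\<close> \<open>bdiff j r I W f'\<close> assms(3) in \<open>auto\<close>)
qed

lemma bdiff_reindex:
  assumes "bdiff j r I W f" "\<And>i. i \<in> J \<Longrightarrow> h i \<in> I"
  shows "bdiff j r J (\<lambda>i. W (h i)) (\<lambda>i. f (h i))"
  using assms(1)
proof (induction r arbitrary: f)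
  case 0
  then show ?case using assms(2) by (auto simp: bcont_def)
next
  case (Suc r)
  then obtain f' where f': "bcont I W f" "\<forall>i\<in>I. has_partial j (f i) (f' i)" "bdiff j r I W f'" by auto
  have "bcont J (\<lambda>i. W (h i)) (\<lambda>i. f (h i))" using f'(1) assms(2) by (auto simp: bcont_def)
  moreover have "\<forall>i\<in>J. has_partial j (f (h i)) (f' (h i))" using f'(2) assms(2) by blast
  ultimately show ?case using Suc.IH[OF f'(3)] by auto
qed

lemma bcont_cmult: "bcont I W f \<Longrightarrow> bcont I W (\<lambda>i x. c * f i x)"
proof -
  assume f: "bcont I W f"
  then obtain C where C: "C \<ge> 0" "\<And>i x. i \<in> I \<Longrightarrow> cmod (f i x) \<le> C * W i" by (auto simp: bcont_def)
  have "cmod (c * f i x) \<le> (cmod c * C) * W i" if "i \<in> I" for i x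
    using mult_left_mono[OF C(2)[OF that], of "cmod c"] by (simp add: norm_mult mult.assoc)
  moreover have "cmod c * C \<ge> 0" using C(1) by simp
  ultimately show ?thesis using f torus_cont_mult[OF torus_cont_const] unfolding bcont_def by blast
qed

lemma bcont_add:
  assumes "bcont I W f" "bcont I W g"
  shows "bcont I W (\<lambda>i x. f i x + g i x)"
proof -
  obtain C where C: "C \<ge> 0" "\<And>i x. i \<in> I \<Longrightarrow> cmod (f i x) \<le> C * W i" using assms(1) by (auto simp: bcont_def)
  obtain D where D: "D \<ge> 0" "\<And>i x. i \<in> I \<Longrightarrow> cmod (g i x) \<le> D * W i" using assms(2) by (auto simp: bcont_def)
  have "cmod (f i x + g i x) \<le> (C + D) * W i" if "i \<in> I" for i x
    using norm_triangle_ineq[of "f i x" "g i x"] C(2)[OF that, of x] D(2)[OF that, of x] by (simp add: distrib_right)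
  moreover have "C + D \<ge> 0" using C(1) D(1) by simp
  ultimately show ?thesis using assms torus_cont_add unfolding bcont_def by blast
qed

lemma bcont_mult:
  assumes "bcont I W f" "bcont I V g"
  shows "bcont I (\<lambda>i. W i * V i) (\<lambda>i x. f i x * g i x)"
proof -
  obtain C where C: "C \<ge> 0" "\<And>i x. i \<in> I \<Longrightarrow> cmod (f i x) \<le> C * W i" using assms(1) by (auto simp: bcont_def)
  obtain D where D: "D \<ge> 0" "\<And>i x. i \<in> I \<Longrightarrow> cmod (g i x) \<le> D * V i" using assms(2) by (auto simp: bcont_def)
  have "cmod (f i x * g i x) \<le> (C * D) * (W i * V i)" if "i \<in> I" for i x
    using mult_mono[OF C(2)[OF that, of x] D(2)[OF that, of x]] order_trans[OF norm_ge_zero C(2)[OF that, of x]]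
    by (simp add: norm_mult ac_simps)
  moreover have "C * D \<ge> 0" using C(1) D(1) by simp
  ultimately show ?thesis using assms torus_cont_mult unfolding bcont_def by blast
qed

lemma has_partial_lincomb:
  assumes "has_partial j f f'" "has_partial j g g'"
  shows "has_partial j (\<lambda>x. c * f x + d * g x) (\<lambda>x. c * f' x + d * g' x)"
  using assms unfolding has_partial_def
  by (auto intro!: has_vector_derivative_add bounded_linear.has_vector_derivative[OF bounded_linear_mult_right])

lemma bdiff_lincomb:
  assumes "bdiff j r I W f" "bdiff j r I W g"
  shows "bdiff j r I W (\<lambda>i x. c * f i x + d * g i x)"
  using assms
proof (induction r arbitrary: f g)
  case 0
  then show ?case by (simp add: bcont_add bcont_cmult)
next
  case (Suc r)
  from Suc.prems obtain f' where f: "bcont I W f" "\<forall>i\<in>I. has_partial j (f i) (f' i)" "bdiff j r I W f'" by auto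
  from Suc.prems obtain g' where g: "bcont I W g" "\<forall>i\<in>I. has_partial j (g i) (g' i)" "bdiff j r I W g'" by auto
  have "bcont I W (\<lambda>i x. c * f i x + d * g i x)" by (intro bcont_add bcont_cmult f g)
  moreover have "\<forall>i\<in>I. has_partial j (\<lambda>x. c * f i x + d * g i x) (\<lambda>x. c * f' i x + d * g' i x)"
    using f(2) g(2) has_partial_lincomb by blast
  ultimately show ?case using Suc.IH[OF f(3) g(3)] by (intro bdiff_SucI) blast+
qed

text \<open>The product rule leaves two products of lower order, each combining one function with a
  derivative of the other; the induction is therefore over all pairs and weights.\<close>

lemma bdiff_mult:
  assumes "bdiff j r I W f" "bdiff j r I V g"
  shows "bdiff j r I (\<lambda>i. W i * V i) (\<lambda>i x. f i x * g i x)"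
  using assms
proof (induction r arbitrary: f g W V)
  case 0
  then show ?case by (simp add: bcont_mult)
next
  case (Suc r)
  from Suc.prems obtain f' where f: "bcont I W f" "\<forall>i\<in>I. has_partial j (f i) (f' i)" "bdiff j r I W f'" by auto
  from Suc.prems obtain g' where g: "bcont I V g" "\<forall>i\<in>I. has_partial j (g i) (g' i)" "bdiff j r I V g'" by auto
  have "bcont I (\<lambda>i. W i * V i) (\<lambda>i x. f i x * g i x)" by (intro bcont_mult f g)
  moreover have "\<forall>i\<in>I. has_partial j (\<lambda>x. f i x * g i x) (\<lambda>x. f i x * g' i x + f' i x * g i x)"
    using f(2) g(2) has_partial_mult by blast
  moreover have "bdiff j r I (\<lambda>i. W i * V i) (\<lambda>i x. f i x * g' i x + f' i x * g i x)"
    using bdiff_lincomb[OF Suc.IH[OF bdiff_Suc_D[OF Suc.prems(1)] g(3)] Suc.IH[OF f(3) bdiff_Suc_D[OF Suc.prems(2)]], of 1 1]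
    by simp
  ultimately show ?case by (intro bdiff_SucI) blast+
qed

lemma has_partial_inverse:
  assumes "has_partial j f f'" "\<And>x. f x \<noteq> 0"
  shows "has_partial j (\<lambda>x. inverse (f x)) (\<lambda>x. - (f' x * (inverse (f x) * inverse (f x))))"
  unfolding has_partial_def
proof
  fix x
  have 1: "((\<lambda>t. f (x + t *\<^sub>R axis j 1)) has_vector_derivative f' x) (at 0)"
    using assms(1) unfolding has_partial_def by blast
  have 2: "(inverse has_field_derivative - (inverse (f x) * inverse (f x))) (at (f (x + 0 *\<^sub>R axis j 1)))"
    using DERIV_inverse[OF assms(2)[of x]] by (simp add: power2_eq_square)
  show "((\<lambda>t. inverse (f (x + t *\<^sub>R axis j 1))) has_vector_derivative - (f' x * (inverse (f x) * inverse (f x)))) (at 0)"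
    using field_vector_diff_chain_at[OF 1 2] by (simp add: o_def)
qed

text \<open>The derivative is -f' (1/f)^2. The induction hypothesis controls 1/f to order r, and the
  weights multiply to W W^-1 W^-1 = W^-1, so the form of the bound is reproduced.\<close>

lemma bdiff_inverse:
  assumes W: "\<And>i. i \<in> I \<Longrightarrow> W i > 0" and c: "c > 0" "\<And>i x. i \<in> I \<Longrightarrow> cmod (f i x) \<ge> c * W i"
    and f: "bdiff j r I W f"
  shows "bdiff j r I (\<lambda>i. inverse (W i)) (\<lambda>i x. inverse (f i x))"
  using f
proof (induction r)
  case 0
  show ?case
    unfolding bdiff.simps bcont_def
  proof (intro conjI exI[of _ "inverse c"] ballI allI)
    have nz: "f i x \<noteq> 0" if "i \<in> I" for i x using c(2)[OF that, of x] mult_pos_pos[OF c(1) W[OF that]] by auto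
    fix i assume i: "i \<in> I"
    show "(\<lambda>x. inverse (f i x)) \<in> torus_cont"
      using 0 i nz by (auto simp: bcont_def torus_cont_def intro!: continuous_intros)
    fix x
    show "cmod (inverse (f i x)) \<le> inverse c * inverse (W i)"
      using le_imp_inverse_le[OF c(2)[OF i, of x]] c(1) W[OF i] by (simp add: norm_inverse)
  qed (use c in \<open>auto\<close>)
next
  case (Suc r)
  from Suc.prems obtain f' where f: "bcont I W f" "\<forall>i\<in>I. has_partial j (f i) (f' i)" "bdiff j r I W f'" by auto
  have IH: "bdiff j r I (\<lambda>i. inverse (W i)) (\<lambda>i x. inverse (f i x))"
    by (rule Suc.IH[OF bdiff_Suc_D[OF Suc.prems]])
  have nz: "f i x \<noteq> 0" if "i \<in> I" for i x using c(2)[OF that, of x] mult_pos_pos[OF c(1) W[OF that]] by auto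
  have "bdiff j r I (\<lambda>i. W i * (inverse (W i) * inverse (W i))) (\<lambda>i x. f' i x * (inverse (f i x) * inverse (f i x)))"
    by (intro bdiff_mult f IH)
  then have "bdiff j r I (\<lambda>i. inverse (W i)) (\<lambda>i x. f' i x * (inverse (f i x) * inverse (f i x)))"
    by (rule bdiff_weight[where D = 1]) (use W in \<open>auto simp: less_imp_neq[symmetric] dest!: W\<close>)
  from bdiff_lincomb[OF this this, of "- 1" 0]
  have 1: "bdiff j r I (\<lambda>i. inverse (W i)) (\<lambda>i x. - (f' i x * (inverse (f i x) * inverse (f i x))))" by simp
  have 2: "\<forall>i\<in>I. has_partial j (\<lambda>x. inverse (f i x)) (\<lambda>x. - (f' i x * (inverse (f i x) * inverse (f i x))))"
    using f(2) nz has_partial_inverse by blast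
  show ?case by (rule bdiff_SucI[OF bdiff_bcont[OF IH] bspec[OF 2] 1])
qed

text \<open>Each derivative in direction \<open>j\<close> multiplies the coefficient by 2 pi i q_j;
  the factor 2 pi, being at least 1, is discarded.\<close>

lemma fourier_coeff_decay_direction:
  assumes "bdiff j r I W f"
  shows "\<exists>C\<ge>0. \<forall>i\<in>I. \<forall>q. \<bar>real_of_int (q $ j)\<bar> ^ r * cmod (fourier_coeff (f i) q) \<le> C * W i"
  using assms
proof (induction r arbitrary: f)
  case 0
  then obtain C where C: "C \<ge> 0" "\<And>i x. i \<in> I \<Longrightarrow> cmod (f i x) \<le> C * W i" and f: "\<And>i. i \<in> I \<Longrightarrow> f i \<in> torus_cont"
    by (auto simp: bcont_def)
  have "cmod (fourier_coeff (f i) q) \<le> C * W i" if "i \<in> I" for i q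
    by (rule fourier_coeff_bound[OF torus_cont_continuous[OF f[OF that]] C(2)[OF that]])
  then show ?case using C(1) by auto
next
  case (Suc r)
  from Suc.prems obtain f' where f: "bcont I W f" "\<forall>i\<in>I. has_partial j (f i) (f' i)" "bdiff j r I W f'" by auto
  obtain C where C: "C \<ge> 0" "\<And>i q. i \<in> I \<Longrightarrow> \<bar>real_of_int (q $ j)\<bar> ^ r * cmod (fourier_coeff (f' i) q) \<le> C * W i"
    using Suc.IH[OF f(3)] by blast
  have "\<bar>real_of_int (q $ j)\<bar> ^ Suc r * cmod (fourier_coeff (f i) q) \<le> C * W i" if i: "i \<in> I" for i q
  proof -
    have fi: "f i \<in> torus_cont" using f(1) i by (auto simp: bcont_def)
    have f'i: "continuous_on UNIV (f' i)" 
      using bdiff_bcont[OF f(3)] i by (auto simp: bcont_def intro: torus_cont_continuous)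
    have "cmod (fourier_coeff (f' i) q) = 2 * pi * \<bar>real_of_int (q $ j)\<bar> * cmod (fourier_coeff (f i) q)"
      using fourier_coeff_partial[OF fi f'i, of j q] f(2) i by (simp add: norm_mult)
    moreover have "1 * (\<bar>real_of_int (q $ j)\<bar> * cmod (fourier_coeff (f i) q)) \<le> 2 * pi * (\<bar>real_of_int (q $ j)\<bar> * cmod (fourier_coeff (f i) q))"
      using pi_ge_two by (intro mult_right_mono) auto
    ultimately have "\<bar>real_of_int (q $ j)\<bar> * cmod (fourier_coeff (f i) q) \<le> cmod (fourier_coeff (f' i) q)" by simp
    then have "\<bar>real_of_int (q $ j)\<bar> ^ r * (\<bar>real_of_int (q $ j)\<bar> * cmod (fourier_coeff (f i) q)) \<le> \<bar>real_of_int (q $ j)\<bar> ^ r * cmod (fourier_coeff (f' i) q)"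
      by (intro mult_left_mono) auto
    then show ?thesis using C(2)[OF i, of q] by (simp add: ac_simps)
  qed
  then show ?case using C(1) by blast
qed

section \<open>Tame families and rapid decay of their Fourier coefficients\<close>

definition tame :: "'i set \<Rightarrow> ('i \<Rightarrow> real) \<Rightarrow> ('i \<Rightarrow> real ^ 'n::finite \<Rightarrow> complex) \<Rightarrow> bool" where
  "tame I W f \<longleftrightarrow> (\<forall>j r. bdiff j r I W f)"

text \<open>The directional bounds are summed by means of \<open>bracket_power_le\<close>; the
  summand 1 there is covered by the bound without derivatives.\<close>

lemma fourier_coeff_decay:
  fixes f :: "'i \<Rightarrow> real ^ 'n::finite \<Rightarrow> complex"
  assumes f: "tame I W f" and W: "\<And>i. i \<in> I \<Longrightarrow> W i \<ge> 0"
  shows "\<exists>C\<ge>0. \<forall>i\<in>I. \<forall>q. cmod (fourier_coeff (f i) q) \<le> C * W i * bracket q powr (- N)"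
proof -
  define M where "M = nat \<lceil>\<bar>N\<bar>\<rceil>"
  have M: "real M \<ge> N" unfolding M_def by linarith
  have "\<forall>j. \<exists>C\<ge>0. \<forall>i\<in>I. \<forall>q. \<bar>real_of_int (q $ j)\<bar> ^ M * cmod (fourier_coeff (f i) q) \<le> C * W i"
    using f unfolding tame_def by (intro allI fourier_coeff_decay_direction) blast
  then obtain C where C: "\<And>j. C j \<ge> 0" 
    "\<And>j i q. i \<in> I \<Longrightarrow> \<bar>real_of_int (q $ j)\<bar> ^ M * cmod (fourier_coeff (f i) q) \<le> C j * W i"
    by metis
  \<comment> \<open>With exponent 0 any direction yields the plain bound on the coefficients, hence
    \<open>undefined\<close>.\<close>
  have "\<exists>C\<ge>0. \<forall>i\<in>I. \<forall>q. \<bar>real_of_int (q $ undefined)\<bar> ^ 0 * cmod (fourier_coeff (f i) q) \<le> C * W i"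
    using f unfolding tame_def by (intro fourier_coeff_decay_direction) blast
  then obtain C0 where C0: "C0 \<ge> 0" "\<And>i q. i \<in> I \<Longrightarrow> cmod (fourier_coeff (f i) q) \<le> C0 * W i" by auto
  let ?D = "real (CARD('n) + 1) ^ M * (C0 + (\<Sum>j\<in>UNIV. C j))"
  have "cmod (fourier_coeff (f i) q) \<le> ?D * W i * bracket q powr (- N)" if i: "i \<in> I" for i q
    unfolding le_powr_neg_iff
  proof -
    have "bracket q powr N * cmod (fourier_coeff (f i) q) \<le> bracket q ^ M * cmod (fourier_coeff (f i) q)"
      using bracket_powr_mono[OF M, of q] bracket_pos[of q] by (intro mult_right_mono) (simp_all add: powr_realpow)
    also have "\<dots> \<le> (real (CARD('n) + 1) ^ M * (1 + (\<Sum>j\<in>UNIV. \<bar>real_of_int (q $ j)\<bar> ^ M))) * cmod (fourier_coeff (f i) q)"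
      by (intro mult_right_mono bracket_power_le) auto
    also have "\<dots> = real (CARD('n) + 1) ^ M * (cmod (fourier_coeff (f i) q) + (\<Sum>j\<in>UNIV. \<bar>real_of_int (q $ j)\<bar> ^ M * cmod (fourier_coeff (f i) q)))"
      by (simp add: algebra_simps sum_distrib_left sum_distrib_right)
    also have "\<dots> \<le> real (CARD('n) + 1) ^ M * (C0 * W i + (\<Sum>j\<in>UNIV. C j * W i))"
      by (intro mult_left_mono add_mono sum_mono C C0 i) auto
    also have "\<dots> = ?D * W i" by (simp add: algebra_simps sum_distrib_left sum_distrib_right)
    finally show "bracket q powr N * cmod (fourier_coeff (f i) q) \<le> ?D * W i" .
  qed
  moreover have "?D \<ge> 0" using C(1) C0(1) by (intro mult_nonneg_nonneg add_nonneg_nonneg sum_nonneg) auto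
  ultimately show ?thesis by blast
qed

lemma tame_bcont: "tame I W f \<Longrightarrow> bcont I W f"
  unfolding tame_def by (rule bdiff_bcont[of undefined 0]) blast

lemma tame_cont: "tame I W f \<Longrightarrow> i \<in> I \<Longrightarrow> f i \<in> torus_cont"
  using tame_bcont unfolding bcont_def by blast

lemma tame_mult: "tame I W f \<Longrightarrow> tame I V g \<Longrightarrow> tame I (\<lambda>i. W i * V i) (\<lambda>i x. f i x * g i x)"
  by (simp add: tame_def bdiff_mult)

lemma tame_cmult: "tame I W f \<Longrightarrow> tame I W (\<lambda>i x. c * f i x)"
  unfolding tame_def using bdiff_lincomb[of _ _ I W f f c 0] by simp

lemma tame_inverse:
  assumes "tame I W f" "\<And>i. i \<in> I \<Longrightarrow> W i > 0" "c > 0" "\<And>i x. i \<in> I \<Longrightarrow> cmod (f i x) \<ge> c * W i"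
  shows "tame I (\<lambda>i. inverse (W i)) (\<lambda>i x. inverse (f i x))"
  unfolding tame_def
proof (intro allI)
  fix j r
  show "bdiff j r I (\<lambda>i. inverse (W i)) (\<lambda>i x. inverse (f i x))"
    using assms(1) unfolding tame_def by (intro bdiff_inverse[OF assms(2-4)]) auto
qed

lemma tame_weight:
  assumes "tame I W f" "D \<ge> 0" "\<And>i. i \<in> J \<Longrightarrow> i \<in> I" "\<And>i. i \<in> J \<Longrightarrow> W i \<le> D * V i"
  shows "tame J V f"
  unfolding tame_def
proof (intro allI)
  fix j r
  show "bdiff j r J V f"
    by (rule bdiff_weight[OF _ assms(2-4)]) (use assms(1) in \<open>auto simp: tame_def\<close>)
qed

lemma tame_reindex:
  assumes "tame I W f" "\<And>i. i \<in> J \<Longrightarrow> h i \<in> I"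
  shows "tame J (\<lambda>i. W (h i)) (\<lambda>i. f (h i))"
  unfolding tame_def
proof (intro allI)
  fix j r
  show "bdiff j r J (\<lambda>i. W (h i)) (\<lambda>i. f (h i))"
    using assms(1) unfolding tame_def by (intro bdiff_reindex[OF _ assms(2)]) auto
qed

section \<open>Symbols\<close>

lemma has_partial_partial_deriv:
  assumes "\<And>x. f differentiable (at x)"
  shows "has_partial j f (partial_deriv j f)"
  unfolding has_partial_def partial_deriv_def
proof
  fix x
  have "(\<lambda>t. f (x + t *\<^sub>R axis j 1)) differentiable (at 0)"
    by (rule differentiable_compose[of f]) (auto intro!: assms derivative_intros)
  then show "((\<lambda>t. f (x + t *\<^sub>R axis j 1)) has_vector_derivative vector_derivative (\<lambda>t. f (x + t *\<^sub>R axis j 1)) (at 0)) (at 0)"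
    by (simp add: vector_derivative_works)
qed

lemma has_partial_unique: "has_partial j f f' \<Longrightarrow> partial_deriv j f = f'"
  by (auto simp: has_partial_def partial_deriv_def fun_eq_iff intro: vector_derivative_at)

lemma C_diff_lincomb:
  assumes "C_diff r f" "C_diff r g"
  shows "C_diff r (\<lambda>x. c * f x + d * g x)"
  using assms
proof (induction r arbitrary: f g)
  case 0
  then show ?case by (auto intro!: continuous_intros)
next
  case (Suc r)
  have "partial_deriv j (\<lambda>x. c * f x + d * g x) = (\<lambda>x. c * partial_deriv j f x + d * partial_deriv j g x)" for j
    using Suc.prems by (intro has_partial_unique has_partial_lincomb has_partial_partial_deriv) auto
  then show ?case using Suc by (auto intro!: derivative_intros)
qed

lemma torus_smooth_lincomb:
  "f \<in> torus_smooth \<Longrightarrow> g \<in> torus_smooth \<Longrightarrow> (\<lambda>x. c * f x + d * g x) \<in> torus_smooth"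
  by (simp add: torus_smooth_def C_diff_lincomb)

lemma torus_smooth_C_diff: "f \<in> torus_smooth \<Longrightarrow> C_diff r f"
  by (simp add: torus_smooth_def)

lemma torus_smooth_differentiable: "f \<in> torus_smooth \<Longrightarrow> f differentiable (at x)"
  using torus_smooth_C_diff[of f 1] by simp

lemma torus_smooth_partial_deriv:
  assumes f: "f \<in> torus_smooth"
  shows "partial_deriv j f \<in> torus_smooth"
  unfolding torus_smooth_def mem_Collect_eq
proof (intro conjI allI)
  fix r
  show "C_diff r (partial_deriv j f)" using torus_smooth_C_diff[OF f, of "Suc r"] by simp
next
  fix i x
  have "f (x + axis i 1 + t *\<^sub>R axis j 1) = f (x + t *\<^sub>R axis j 1)" for t
  proof -
    have "f (x + t *\<^sub>R axis j 1 + axis i 1) = f (x + t *\<^sub>R axis j 1)" using f by (simp add: torus_smooth_def)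
    then show ?thesis by (simp only: ac_simps)
  qed
  then show "partial_deriv j f (x + axis i 1) = partial_deriv j f x" by (simp add: partial_deriv_def)
qed

lemma torus_smooth_cont:
  assumes f: "f \<in> torus_smooth"
  shows "f \<in> torus_cont"
proof -
  have "continuous_on UNIV f" using torus_smooth_C_diff[OF f, of 0] by simp
  then show ?thesis using f by (simp add: torus_smooth_def torus_cont_def)
qed

lemma torus_smooth_Dfall: "f \<in> torus_smooth \<Longrightarrow> Dfall j l f \<in> torus_smooth"
proof (induction l)
  case (Suc l)
  then show ?case
    using torus_smooth_lincomb[OF torus_smooth_partial_deriv[of "Dfall j l f" j], of "Dfall j l f" "1 / (2 * of_real pi * \<i>)" "- of_nat l"]
    by simp
qed simp

text \<open>Symbol estimates are stated for falling-factorial derivatives. Solving their recursion,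
  the ordinary derivative of the l-th one is a combination of those of orders l + 1 and l, so the
  bounds propagate with l left arbitrary in the induction.\<close>

lemma tame_smooth:
  assumes f: "\<And>k. f k \<in> torus_smooth"
    and bound: "\<And>j l. \<exists>C>0. \<forall>k x. cmod (Dfall j l (f k) x) \<le> C * W k"
  shows "tame UNIV W f"
proof -
  have "bdiff j r UNIV W (\<lambda>k. Dfall j l (f k))" for j r l
  proof (induction r arbitrary: l)
    case 0
    obtain C where "C > 0" "\<And>k x. cmod (Dfall j l (f k) x) \<le> C * W k" using bound by blast
    then show ?case
      using torus_smooth_cont[OF torus_smooth_Dfall[OF f]] by (auto simp: bcont_def intro!: exI[of _ C])
  next
    case (Suc r)
    let ?c = "2 * of_real pi * \<i> :: complex"
    have "partial_deriv j (Dfall j l (f k)) = (\<lambda>x. ?c * Dfall j (Suc l) (f k) x + (?c * of_nat l) * Dfall j l (f k) x)" for k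
      by (auto simp: fun_eq_iff field_simps)
    then have "has_partial j (Dfall j l (f k)) (\<lambda>x. ?c * Dfall j (Suc l) (f k) x + (?c * of_nat l) * Dfall j l (f k) x)" for k
      using has_partial_partial_deriv[OF torus_smooth_differentiable[OF torus_smooth_Dfall[OF f]]] by metis
    moreover have "bdiff j r UNIV W (\<lambda>k x. ?c * Dfall j (Suc l) (f k) x + (?c * of_nat l) * Dfall j l (f k) x)"
      by (intro bdiff_lincomb Suc)
    ultimately show ?case
      using bdiff_bcont[OF Suc[of l]] unfolding bdiff.simps
      by (intro conjI exI[of _ "\<lambda>k x. ?c * Dfall j (Suc l) (f k) x + (?c * of_nat l) * Dfall j l (f k) x"] ballI)
  qed
  from this[of _ _ 0] show ?thesis by (simp add: tame_def)
qed

lemma mi_Dfall_single: "mi_Dfall (\<lambda>i. if i = j then l else 0) f = Dfall j l f"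
  unfolding mi_Dfall_def
  by (subst foldr_single[of _ j]) (auto simp: coords fun_eq_iff)

text \<open>Of all the estimates in the definition, those extracted have x-derivatives in a single
  direction and lattice differences of order 0 or 1.\<close>

lemma symbols_tame:
  assumes a: "a \<in> symbols m"
  shows "tame UNIV (\<lambda>k. bracket k powr m) a"
    and "tame UNIV (\<lambda>k. bracket k powr (m - 1)) (\<lambda>k x. a (k + axis i 1) x - a k x)"
proof -
  have sm: "a k \<in> torus_smooth" for k using a by (simp add: symbols_def)
  have bd: "\<exists>C>0. \<forall>k x. cmod (mi_Dfall \<beta> (\<lambda>y. mi_diff \<alpha> (\<lambda>l. a l y) k) x)
          \<le> C * bracket k powr (m - real (mi_order \<alpha>))" for \<alpha> \<beta>
    using a unfolding symbols_def mem_Collect_eq bracket_def by blast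
  show "tame UNIV (\<lambda>k. bracket k powr m) a"
  proof (rule tame_smooth[OF sm])
    fix j l
    show "\<exists>C>0. \<forall>k x. cmod (Dfall j l (a k) x) \<le> C * bracket k powr m"
      using bd[of "\<lambda>i. if i = j then l else 0" "\<lambda>_. 0"]
      by (simp add: mi_Dfall_single mi_diff_zero mi_order_def)
  qed
  show "tame UNIV (\<lambda>k. bracket k powr (m - 1)) (\<lambda>k x. a (k + axis i 1) x - a k x)"
  proof (rule tame_smooth)
    show "(\<lambda>x. a (k + axis i 1) x - a k x) \<in> torus_smooth" for k
      using torus_smooth_lincomb[OF sm sm, of 1 "k + axis i 1" "- 1" k] by simp
    fix j l
    show "\<exists>C>0. \<forall>k x. cmod (Dfall j l (\<lambda>x. a (k + axis i 1) x - a k x) x) \<le> C * bracket k powr (m - 1)"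
      using bd[of "\<lambda>i. if i = j then l else 0" "\<lambda>j. if j = i then 1 else 0"]
      by (simp add: mi_Dfall_single mi_diff_single mi_order_def fdiff_def)
  qed
qed

section \<open>The parametrix\<close>

text \<open>The information about a symbol that composition modulo one order consumes. Being phrased
  in Fourier coefficients, it applies alike to the given symbol and to the cut-off
  reciprocal.\<close>

definition fourier_symbol :: "real \<Rightarrow> 'n::finite lattice_symbol \<Rightarrow> bool" where
  "fourier_symbol m c \<longleftrightarrow> (\<forall>k. c k \<in> torus_cont) \<and>
     (\<forall>N. \<exists>C\<ge>0. \<forall>k q. cmod (fourier_coeff (c k) q) \<le> C * bracket k powr m * bracket q powr (- N)) \<and>
     (\<forall>i N. \<exists>C\<ge>0. \<forall>k q. cmod (fourier_coeff (c (k + axis i 1)) q - fourier_coeff (c k) q)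
        \<le> C * bracket k powr (m - 1) * bracket q powr (- N))"

lemma fourier_symbol_cont: "fourier_symbol m c \<Longrightarrow> c k \<in> torus_cont"
  by (simp add: fourier_symbol_def)

lemma fourier_symbol_decay:
  assumes "fourier_symbol m c"
  obtains C where "C \<ge> 0" "\<And>k q. cmod (fourier_coeff (c k) q) \<le> C * bracket k powr m * bracket q powr (- N)"
  using assms unfolding fourier_symbol_def by blast

lemma fourier_symbol_summable:
  fixes c :: "'n::finite lattice_symbol"
  assumes "fourier_symbol m c"
  shows "(\<lambda>q. cmod (fourier_coeff (c k) q)) summable_on UNIV"
proof -
  obtain C where C: "C \<ge> 0" "\<And>k q. cmod (fourier_coeff (c k) q) \<le> C * bracket k powr m * bracket q powr (- (2 * real CARD('n)))"
    by (rule fourier_symbol_decay[OF assms]) (rule that)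
  have "(\<lambda>q::int^'n. C * bracket k powr m * bracket q powr (- (2 * real CARD('n)))) summable_on UNIV"
    by (intro summable_on_cmult_right bracket_summable_nat)
  then show ?thesis by (rule summable_on_comparison_test) (use C in auto)
qed

lemma offdiag_symbol_matrix:
  assumes "fourier_symbol m c"
  shows "offdiag m (symbol_matrix c)"
  unfolding offdiag_def symbol_matrix_def
proof (intro allI impI)
  fix N :: real
  obtain C where "C \<ge> 0" "\<And>k q. cmod (fourier_coeff (c k) q) \<le> C * bracket k powr m * bracket q powr (- N)"
    by (rule fourier_symbol_decay[OF assms]) (rule that)
  then show "\<exists>C\<ge>0. \<forall>k l. cmod (fourier_coeff (c k) (l - k)) \<le> C * bracket k powr m * bracket (k - l) powr (- N)"
    using bracket_minus_commute by metis
qed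

lemma tame_fourier_symbol:
  assumes c: "tame UNIV (\<lambda>k. bracket k powr m) c"
    and d: "\<And>i. tame UNIV (\<lambda>k. bracket k powr (m - 1)) (\<lambda>k x. c (k + axis i 1) x - c k x)"
  shows "fourier_symbol m c"
  unfolding fourier_symbol_def
proof (intro conjI allI)
  have ct: "c k \<in> torus_cont" for k using tame_cont[OF c] by simp
  then show "c k \<in> torus_cont" for k .
  show "\<exists>C\<ge>0. \<forall>k q. cmod (fourier_coeff (c k) q) \<le> C * bracket k powr m * bracket q powr (- N)" for N
    using fourier_coeff_decay[OF c, of N] by simp
  have "fourier_coeff (\<lambda>x. c (k + axis i 1) x - c k x) q = fourier_coeff (c (k + axis i 1)) q - fourier_coeff (c k) q" for k i q
    by (intro fourier_coeff_diff torus_cont_continuous ct)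
  then show "\<exists>C\<ge>0. \<forall>k q. cmod (fourier_coeff (c (k + axis i 1)) q - fourier_coeff (c k) q) \<le> C * bracket k powr (m - 1) * bracket q powr (- N)" for i N
    using fourier_coeff_decay[OF d, of i N] by simp
qed

lemma symbols_fourier: "a \<in> symbols m \<Longrightarrow> fourier_symbol m a"
  by (intro tame_fourier_symbol symbols_tame)

text \<open>A lattice path from \<open>k\<close> to \<open>k + d\<close> that is monotone in each coordinate keeps the bracket of the
  displacement below \<open>bracket d\<close>.\<close>

lemma telescoping_bound:
  fixes h :: "int ^ 'n::finite \<Rightarrow> complex"
  assumes step: "\<And>k i. cmod (h (k + axis i 1) - h k) \<le> C * bracket k powr s" and C: "C \<ge> 0"
  shows "cmod (h (k + d) - h k) \<le> C * real CARD('n) * bracket k powr s * bracket d powr (\<bar>s\<bar> + 1)"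
proof -
  have step': "cmod (h (k + d + axis i 1) - h (k + d)) \<le> C * (bracket k powr s * bracket D powr \<bar>s\<bar>)"
    if "bracket d \<le> bracket D" for d D i
  proof -
    have "cmod (h (k + d + axis i 1) - h (k + d)) \<le> C * bracket (k + d) powr s" by (rule step)
    also have "bracket (k + d) powr s \<le> bracket k powr s * bracket d powr \<bar>s\<bar>" using peetre[of "k + d" s k] by simp
    also have "\<dots> \<le> bracket k powr s * bracket D powr \<bar>s\<bar>"
      using that bracket_pos[of d] by (intro mult_left_mono powr_mono2) auto
    finally show ?thesis using C by (simp add: mult_left_mono)
  qed
  \<comment> \<open>Induction on the number of unit steps; \<open>D\<close> stays fixed while
    \<open>d\<close> shrinks, so every step has the same bound.\<close>
  have main: "cmod (h (k + d) - h k) \<le> real r * (C * (bracket k powr s * bracket D powr \<bar>s\<bar>))"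
    if "(\<Sum>j\<in>UNIV. nat \<bar>d $ j\<bar>) = r" "bracket d \<le> bracket D" for d D r
    using that
  proof (induction r arbitrary: d)
    case 0
    then have "d = 0" by (simp add: vec_eq_iff)
    then show ?case by simp
  next
    case (Suc r)
    then obtain j where j: "d $ j \<noteq> 0" by (metis abs_zero nat_0 sum.neutral nat.distinct(1))
    define e :: "int ^ 'n" where "e = (if d $ j > 0 then axis j 1 else - axis j 1)"
    define d' where "d' = d - e"
    have d'j: "nat \<bar>d' $ j\<bar> + 1 = nat \<bar>d $ j\<bar>" using j by (auto simp: d'_def e_def axis_def)
    have d'i: "d' $ i = d $ i" if "i \<noteq> j" for i using that by (auto simp: d'_def e_def axis_def)
    have "(\<Sum>i\<in>UNIV. nat \<bar>d $ i\<bar>) = nat \<bar>d $ j\<bar> + (\<Sum>i\<in>UNIV - {j}. nat \<bar>d $ i\<bar>)"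
      by (rule sum.remove) auto
    moreover have "(\<Sum>i\<in>UNIV. nat \<bar>d' $ i\<bar>) = nat \<bar>d' $ j\<bar> + (\<Sum>i\<in>UNIV - {j}. nat \<bar>d' $ i\<bar>)"
      by (rule sum.remove) auto
    moreover have "(\<Sum>i\<in>UNIV - {j}. nat \<bar>d' $ i\<bar>) = (\<Sum>i\<in>UNIV - {j}. nat \<bar>d $ i\<bar>)"
      using d'i by (intro sum.cong) auto
    ultimately have r: "(\<Sum>i\<in>UNIV. nat \<bar>d' $ i\<bar>) = r" using Suc.prems(1) d'j by simp
    have "norm (rvec d') \<le> norm (rvec d)"
    proof (rule norm_le_componentwise_cart)
      fix i show "norm (rvec d' $ i) \<le> norm (rvec d $ i)"
        using d'i[of i] d'j by (cases "i = j") (auto simp: rvec_simps)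
    qed
    then have jd': "bracket d' \<le> bracket D" using Suc.prems(2) by (simp add: bracket_def znorm_def)
    have "cmod (h (k + d) - h (k + d')) \<le> C * (bracket k powr s * bracket D powr \<bar>s\<bar>)"
    proof (cases "d $ j > 0")
      case True
      then have "k + d = k + d' + axis j 1" by (simp add: d'_def e_def)
      then show ?thesis using step'[OF jd', of j] by (simp add: add.assoc)
    next
      \<comment> \<open>For a negative coordinate the path runs backwards: the step bound is applied
        at \<open>k + d\<close> and the difference read in reverse.\<close>
      case False
      then have "k + d' = k + d + axis j 1" by (simp add: d'_def e_def)
      then show ?thesis using step'[OF Suc.prems(2), of j] by (simp add: norm_minus_commute add.assoc)
    qed
    moreover have "cmod (h (k + d') - h k) \<le> real r * (C * (bracket k powr s * bracket D powr \<bar>s\<bar>))"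
      by (rule Suc.IH[OF r jd'])
    moreover have "cmod (h (k + d) - h k) \<le> cmod (h (k + d) - h (k + d')) + cmod (h (k + d') - h k)"
      using norm_triangle_ineq[of "h (k + d) - h (k + d')" "h (k + d') - h k"] by simp
    ultimately show ?case by (simp add: distrib_right)
  qed
  \<comment> \<open>The number of steps is at most n times the bracket of \<open>d\<close>, which is
    the source of the +1 in the exponent.\<close>
  have "real (\<Sum>j\<in>UNIV. nat \<bar>d $ j\<bar>) \<le> (\<Sum>j\<in>(UNIV::'n set). bracket d)"
    unfolding of_nat_sum
  proof (rule sum_mono)
    fix j show "real (nat \<bar>d $ j\<bar>) \<le> bracket d" using component_le_jb[of d j] by simp
  qed
  then have n: "real (\<Sum>j\<in>UNIV. nat \<bar>d $ j\<bar>) \<le> real CARD('n) * bracket d" by simp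
  have "cmod (h (k + d) - h k) \<le> real (\<Sum>j\<in>UNIV. nat \<bar>d $ j\<bar>) * (C * (bracket k powr s * bracket d powr \<bar>s\<bar>))"
    by (rule main) auto
  also have "\<dots> \<le> (real CARD('n) * bracket d) * (C * (bracket k powr s * bracket d powr \<bar>s\<bar>))"
    using C by (intro mult_right_mono n) auto
  also have "\<dots> = C * real CARD('n) * bracket k powr s * bracket d powr (\<bar>s\<bar> + 1)"
    using bracket_pos[of d] by (simp add: powr_add)
  finally show ?thesis .
qed

text \<open>Allows a symbol at \<open>p\<close> to be replaced by the symbol at \<open>k\<close>:
  one order is gained, at the price of polynomial growth in \<open>k - p\<close>.\<close>

lemma fourier_symbol_difference:
  fixes c :: "'n::finite lattice_symbol"
  assumes "fourier_symbol m c"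
  obtains C where "C \<ge> 0"
    "\<And>k p q. cmod (fourier_coeff (c p) q - fourier_coeff (c k) q) \<le> C * bracket k powr (m - 1) * bracket (k - p) powr (\<bar>m - 1\<bar> + 1) * bracket q powr (- N)"
proof -
  have "\<forall>i. \<exists>C\<ge>0. \<forall>k q. cmod (fourier_coeff (c (k + axis i 1)) q - fourier_coeff (c k) q) \<le> C * bracket k powr (m - 1) * bracket q powr (- N)"
    using assms unfolding fourier_symbol_def by blast
  then obtain C where C: "\<And>i. C i \<ge> 0" 
    "\<And>i k q. cmod (fourier_coeff (c (k + axis i 1)) q - fourier_coeff (c k) q) \<le> C i * bracket k powr (m - 1) * bracket q powr (- N)" by metis
  \<comment> \<open>The sum over the directions is a constant valid for all of them, as required
    along a path that changes direction.\<close>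
  define D where "D = (\<Sum>i\<in>UNIV. C i)"
  have CD: "C i \<le> D" for i unfolding D_def using C(1) by (intro member_le_sum) auto
  have D0: "D \<ge> 0" unfolding D_def using C(1) by (intro sum_nonneg) auto
  have "cmod (fourier_coeff (c p) q - fourier_coeff (c k) q) \<le> (D * real CARD('n)) * bracket k powr (m - 1) * bracket (k - p) powr (\<bar>m - 1\<bar> + 1) * bracket q powr (- N)" for k p q
  proof -
    have "cmod (fourier_coeff (c (k + axis i 1)) q - fourier_coeff (c k) q) \<le> (D * bracket q powr (- N)) * bracket k powr (m - 1)" for k i
    proof -
      have "C i * bracket k powr (m - 1) * bracket q powr (- N) \<le> D * bracket k powr (m - 1) * bracket q powr (- N)"
        by (intro mult_right_mono CD) auto
      then show ?thesis using C(2)[where i = i and k = k and q = q] by (simp add: ac_simps)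
    qed
    from telescoping_bound[where h = "\<lambda>k. fourier_coeff (c k) q", OF this, of k "p - k"]
    show ?thesis using D0 by (simp add: bracket_minus_commute ac_simps)
  qed
  then show ?thesis using that[of "D * real CARD('n)"] D0 by simp
qed

text \<open>With the second symbol frozen at the row \<open>k\<close>, the matrix product is a
  convolution and gives the coefficients of the pointwise product. The error contains g p - g k and
  so gains one order; its growth in \<open>k - p\<close> is absorbed by the decay of the
  coefficients of \<open>f\<close>.\<close>

lemma symbol_matrix_comp:
  fixes f g :: "'n::finite lattice_symbol"
  assumes f: "fourier_symbol m f" and g: "fourier_symbol m' g"
  shows "offdiag (m + m' - 1) (\<lambda>k l. mat_comp (symbol_matrix f) (symbol_matrix g) k l - fourier_coeff (\<lambda>x. f k x * g k x) (l - k))"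
proof -
  let ?d = "2 * real CARD('n)"
  define T where "T k l p = fourier_coeff (f k) (p - k) * (fourier_coeff (g p) (l - p) - fourier_coeff (g k) (l - p))" for k l p
  have bound: "\<exists>C\<ge>0. \<forall>k l p. cmod (T k l p) \<le>
      (C * bracket k powr (m + m' - 1)) * bracket (k - p) powr (- (N + ?d)) * bracket (p - l) powr (- N)" for N
  proof -
    \<comment> \<open>The exponent has two parts: N + 2n is what \<open>triple_sum_bound\<close>
      asks for, and |m' - 1| + 1 cancels the growth in the difference of \<open>g\<close>.\<close>
    obtain C where C: "C \<ge> 0" 
      "\<And>k q. cmod (fourier_coeff (f k) q) \<le> C * bracket k powr m * bracket q powr (- (N + ?d + (\<bar>m' - 1\<bar> + 1)))"
      by (rule fourier_symbol_decay[OF f]) (rule that)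
    obtain D where D: "D \<ge> 0"
      "\<And>k p q. cmod (fourier_coeff (g p) q - fourier_coeff (g k) q) \<le> D * bracket k powr (m' - 1) * bracket (k - p) powr (\<bar>m' - 1\<bar> + 1) * bracket q powr (- N)"
      by (rule fourier_symbol_difference[OF g]) (rule that)
    have "cmod (T k l p) \<le> (C * D * bracket k powr (m + m' - 1)) * bracket (k - p) powr (- (N + ?d)) * bracket (p - l) powr (- N)" for k l p
    proof -
      have "cmod (T k l p) \<le> (C * bracket k powr m * bracket (k - p) powr (- (N + ?d + (\<bar>m' - 1\<bar> + 1))))
          * (D * bracket k powr (m' - 1) * bracket (k - p) powr (\<bar>m' - 1\<bar> + 1) * bracket (p - l) powr (- N))"
        unfolding T_def norm_mult
        using C(2)[of k "p - k"] D(2)[of p "l - p" k] C(1) 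
        by (intro mult_mono) (simp_all add: bracket_minus_commute)
      also have "\<dots> = C * D * (bracket k powr m * bracket k powr (m' - 1))
          * (bracket (k - p) powr (- (N + ?d + (\<bar>m' - 1\<bar> + 1))) * bracket (k - p) powr (\<bar>m' - 1\<bar> + 1)) * bracket (p - l) powr (- N)"
        by (simp only: ac_simps)
      also have "bracket k powr m * bracket k powr (m' - 1) = bracket k powr (m + m' - 1)" by (simp add: add_diff_eq flip: powr_add)
      also have "bracket (k - p) powr (- (N + ?d + (\<bar>m' - 1\<bar> + 1))) * bracket (k - p) powr (\<bar>m' - 1\<bar> + 1) = bracket (k - p) powr (- (N + ?d))"
        by (simp flip: powr_add)
      finally show ?thesis by simp
    qed
    then show ?thesis using C(1) D(1) by (intro exI[of _ "C * D"]) auto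
  qed
  have eq: "mat_comp (symbol_matrix f) (symbol_matrix g) k l - fourier_coeff (\<lambda>x. f k x * g k x) (l - k) = (\<Sum>\<^sub>\<infinity>p. T k l p)" for k l
  proof -
    \<comment> \<open>At N = 0 the first factor still keeps the decay 2n, which is enough for
      summability over \<open>p\<close>.\<close>
    obtain C where C: "C \<ge> 0" "\<And>k l p. cmod (T k l p) \<le>
      (C * bracket k powr (m + m' - 1)) * bracket (k - p) powr (- (0 + ?d)) * bracket (p - l) powr (- 0)" using bound[of 0] by blast
    have s1: "T k l summable_on UNIV"
      by (rule abs_summable_summable, rule triple_sum_bound(1)[of "T k l" "C * bracket k powr (m + m' - 1)" k 0 l])
        (use C in auto)
    obtain B where B: "\<And>x. cmod (g k x) \<le> B"
      by (rule torus_cont_bounded[OF fourier_symbol_cont[OF g, of k]]) (rule that)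
    have "(\<lambda>p. cmod (fourier_coeff (f k) (p - k))) summable_on UNIV"
      using fourier_symbol_summable[OF f, of k]
        summable_on_reindex_bij_betw[of "\<lambda>p. p - k" UNIV UNIV "\<lambda>q. cmod (fourier_coeff (f k) q)"]
        bij_betw_byWitness[of UNIV "\<lambda>p. p + k" "\<lambda>p. p - k" UNIV] by simp
    then have s2': "(\<lambda>p. cmod (fourier_coeff (f k) (p - k)) * B) summable_on UNIV" by (rule summable_on_cmult_left)
    have s2: "(\<lambda>p. fourier_coeff (f k) (p - k) * fourier_coeff (g k) (l - p)) summable_on UNIV"
    proof (rule abs_summable_summable, rule summable_on_comparison_test[OF s2'])
      fix p
      have "cmod (fourier_coeff (g k) (l - p)) \<le> B"
        by (rule fourier_coeff_bound[OF torus_cont_continuous[OF fourier_symbol_cont[OF g]] B])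
      then show "norm (fourier_coeff (f k) (p - k) * fourier_coeff (g k) (l - p)) \<le> cmod (fourier_coeff (f k) (p - k)) * B"
        by (simp add: norm_mult mult_left_mono)
    qed auto
    have "fourier_coeff (\<lambda>x. f k x * g k x) (l - k) = (\<Sum>\<^sub>\<infinity>p. fourier_coeff (f k) p * fourier_coeff (g k) (l - k - p))"
      by (rule fourier_coeff_mult[OF fourier_symbol_cont[OF f] fourier_symbol_summable[OF f] fourier_symbol_cont[OF g]])
    also have "\<dots> = (\<Sum>\<^sub>\<infinity>p. fourier_coeff (f k) (p - k) * fourier_coeff (g k) (l - p))"
      using infsum_reindex_bij_betw[of "\<lambda>p. p - k" UNIV UNIV "\<lambda>p. fourier_coeff (f k) p * fourier_coeff (g k) (l - k - p)"]
        bij_betw_byWitness[of UNIV "\<lambda>p. p + k" "\<lambda>p. p - k" UNIV] by simp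
    finally have 1: "fourier_coeff (\<lambda>x. f k x * g k x) (l - k) = (\<Sum>\<^sub>\<infinity>p. fourier_coeff (f k) (p - k) * fourier_coeff (g k) (l - p))" .
    have "mat_comp (symbol_matrix f) (symbol_matrix g) k l
       = (\<Sum>\<^sub>\<infinity>p. T k l p + fourier_coeff (f k) (p - k) * fourier_coeff (g k) (l - p))"
      unfolding mat_comp_def symbol_matrix_def T_def by (simp add: algebra_simps)
    also have "\<dots> = (\<Sum>\<^sub>\<infinity>p. T k l p) + (\<Sum>\<^sub>\<infinity>p. fourier_coeff (f k) (p - k) * fourier_coeff (g k) (l - p))"
      by (rule infsum_add[OF s1 s2])
    finally show ?thesis using 1 by simp
  qed
  show ?thesis
    unfolding offdiag_def eq
  proof (intro allI impI)
    fix N :: real assume N: "N \<ge> 0"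
    obtain C where C: "C \<ge> 0" "\<And>k l p. cmod (T k l p) \<le>
      (C * bracket k powr (m + m' - 1)) * bracket (k - p) powr (- (N + ?d)) * bracket (p - l) powr (- N)" using bound[of N] by blast
    have "cmod (\<Sum>\<^sub>\<infinity>p. T k l p) \<le> (C * bracket k powr (m + m' - 1)) * bracket_sum TYPE('n) * bracket (k - l) powr (- N)" for k l
      by (rule triple_sum_bound(2)) (use C N in auto)
    then show "\<exists>C\<ge>0. \<forall>k l. cmod (\<Sum>\<^sub>\<infinity>p. T k l p) \<le> C * bracket k powr (m + m' - 1) * bracket (k - l) powr (- N)"
      using C(1) bracket_sum_nonneg[where 'n = 'n] by (intro exI[of _ "C * bracket_sum TYPE('n)"]) (auto simp: ac_simps)
  qed
qed

definition parametrix :: "real \<Rightarrow> 'n::finite lattice_symbol \<Rightarrow> 'n lattice_symbol" where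
  "parametrix R a k = (if znorm k > R then (\<lambda>x. inverse (a k x)) else (\<lambda>_. 0))"

lemma bracket_axis_add_le: "bracket (k + axis i 1) \<le> 2 * bracket k" "bracket k \<le> 2 * bracket (k + axis i 1)"
  using bracket_add[of k "axis i 1"] bracket_add[of "k + axis i 1" "- axis i 1"]
  by (simp_all add: bracket_axis bracket_minus mult.commute)

text \<open>Where both reciprocals exist, their difference is -(a(k+e) - a(k)) / (a(k) a(k+e)), of
  order (m - 1) - 2m = -m - 1. Elsewhere \<open>k\<close> is confined to a ball, on which one order
  more or less is only a constant.\<close>

lemma fourier_symbol_parametrix:
  fixes a :: "'n::finite lattice_symbol"
  assumes a: "a \<in> symbols m" and c: "c > 0" and R: "R > 0"
    and ell: "\<And>k x. znorm k > R \<Longrightarrow> cmod (a k x) \<ge> c * bracket k powr m"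
  shows "fourier_symbol (- m) (parametrix R a)"
proof -
  let ?b = "parametrix R a"
  let ?I = "{k :: int ^ 'n. znorm k > R}"
  have tI: "tame ?I (\<lambda>k. bracket k powr m) a"
    by (rule tame_weight[OF symbols_tame(1)[OF a], where D = 1]) auto
  have inv: "tame ?I (\<lambda>k. inverse (bracket k powr m)) (\<lambda>k x. inverse (a k x))"
    by (rule tame_inverse[OF tI _ c]) (use ell bracket_powr_pos in auto)
  have z: "fourier_coeff (\<lambda>_. 0) q = 0" for q :: "int ^ 'n" by (simp add: fourier_coeff_def)
  have bt: "?b k \<in> torus_cont" for k
    using tame_cont[OF inv, of k] torus_cont_const[of 0] by (auto simp: parametrix_def)
  have dec: "\<exists>C\<ge>0. \<forall>k q. cmod (fourier_coeff (?b k) q) \<le> C * bracket k powr (- m) * bracket q powr (- N)" for N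
  proof -
    obtain C where C: "C \<ge> 0" "\<And>k q. k \<in> ?I \<Longrightarrow> cmod (fourier_coeff (\<lambda>x. inverse (a k x)) q) \<le> C * inverse (bracket k powr m) * bracket q powr (- N)"
      using fourier_coeff_decay[OF inv, of N] by auto
    have "cmod (fourier_coeff (?b k) q) \<le> C * bracket k powr (- m) * bracket q powr (- N)" for k q
      using C by (auto simp: parametrix_def z powr_minus)
    then show ?thesis using C(1) by blast
  qed
  have dif: "\<exists>C\<ge>0. \<forall>k q. cmod (fourier_coeff (?b (k + axis i 1)) q - fourier_coeff (?b k) q) \<le> C * bracket k powr (- m - 1) * bracket q powr (- N)" for i N
  proof -
    let ?e = "axis i 1 :: int ^ 'n"
    let ?J = "{k. znorm k > R \<and> znorm (k + ?e) > R}"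
    have t1: "tame ?J (\<lambda>k. bracket k powr (m - 1)) (\<lambda>k x. a (k + ?e) x - a k x)"
      by (rule tame_weight[OF symbols_tame(2)[OF a], where D = 1]) auto
    have t2: "tame ?J (\<lambda>k. inverse (bracket k powr m)) (\<lambda>k x. inverse (a k x))"
      by (rule tame_weight[OF inv, where D = 1]) auto
    have t3: "tame ?J (\<lambda>k. inverse (bracket (k + ?e) powr m)) (\<lambda>k x. inverse (a (k + ?e) x))"
      using tame_reindex[OF inv, of ?J "\<lambda>k. k + ?e"] by simp
    have "tame ?J (\<lambda>k. bracket k powr (m - 1) * (inverse (bracket k powr m) * inverse (bracket (k + ?e) powr m)))
       (\<lambda>k x. - 1 * ((a (k + ?e) x - a k x) * (inverse (a k x) * inverse (a (k + ?e) x))))"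
      by (intro tame_cmult tame_mult t1 t2 t3)
    \<comment> \<open>The factor \<open>2 powr \<bar>m\<bar>\<close> compares the weights at
      \<open>k\<close> and at its neighbour, by Peetre's inequality with a unit vector of bracket
      2.\<close>
    then have t: "tame ?J (\<lambda>k. bracket k powr (- m - 1))
       (\<lambda>k x. - 1 * ((a (k + ?e) x - a k x) * (inverse (a k x) * inverse (a (k + ?e) x))))"
    proof (rule tame_weight[where D = "2 powr \<bar>m\<bar>"])
      fix k
      have "bracket (k + ?e) powr (- m) \<le> bracket k powr (- m) * 2 powr \<bar>m\<bar>"
        using peetre[of "k + ?e" "- m" k] by (simp add: bracket_axis)
      then have "bracket k powr (m - 1) * bracket k powr (- m) * bracket (k + ?e) powr (- m)
        \<le> bracket k powr (m - 1) * bracket k powr (- m) * (bracket k powr (- m) * 2 powr \<bar>m\<bar>)"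
        by (intro mult_left_mono) auto
      also have "\<dots> = 2 powr \<bar>m\<bar> * (bracket k powr (m - 1) * bracket k powr (- m) * bracket k powr (- m))"
        by (simp only: ac_simps)
      also have "bracket k powr (m - 1) * bracket k powr (- m) * bracket k powr (- m) = bracket k powr (- m - 1)"
        unfolding powr_add[symmetric] by (rule arg_cong[of _ _ "(powr) (bracket k)"]) linarith
      finally show "bracket k powr (m - 1) * (inverse (bracket k powr m) * inverse (bracket (k + ?e) powr m)) \<le> 2 powr \<bar>m\<bar> * bracket k powr (- m - 1)"
        by (simp only: powr_minus[of "bracket _" m] mult.assoc)
    qed auto
    obtain C where C: "C \<ge> 0" "\<And>k q. k \<in> ?J \<Longrightarrow> 
        cmod (fourier_coeff (\<lambda>x. - 1 * ((a (k + ?e) x - a k x) * (inverse (a k x) * inverse (a (k + ?e) x)))) q)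
        \<le> C * bracket k powr (- m - 1) * bracket q powr (- N)"
      using fourier_coeff_decay[OF t, of N] by auto
    obtain D where D: "D \<ge> 0" "\<And>k q. cmod (fourier_coeff (?b k) q) \<le> D * bracket k powr (- m) * bracket q powr (- N)"
      using dec[of N] by blast
    \<comment> \<open>D (2^|m| + 1) bounds the two coefficients separately with order -m; the factor
      2 (1 + R) bounds the bracket of \<open>k\<close> and turns -m into -m - 1.\<close>
    define E where "E = D * (2 powr \<bar>m\<bar> + 1) * (2 * (1 + R))"
    have E0: "E \<ge> 0" using D(1) R by (simp add: E_def)
    have le: "cmod (fourier_coeff (?b (k + ?e)) q - fourier_coeff (?b k) q) \<le> (C + E) * bracket k powr (- m - 1) * bracket q powr (- N)" for k q
    proof (cases "k \<in> ?J")
      case True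
      then have nz: "a k x \<noteq> 0" "a (k + ?e) x \<noteq> 0" for x
        using ell[of k x] ell[of "k + ?e" x] c mult_pos_pos[OF c bracket_powr_pos[of k m]] mult_pos_pos[OF c bracket_powr_pos[of "k + ?e" m]]
        by auto
      have "fourier_coeff (?b (k + ?e)) q - fourier_coeff (?b k) q = fourier_coeff (\<lambda>x. ?b (k + ?e) x - ?b k x) q"
        by (intro fourier_coeff_diff[symmetric] torus_cont_continuous bt)
      also have "(\<lambda>x. ?b (k + ?e) x - ?b k x) = (\<lambda>x. - 1 * ((a (k + ?e) x - a k x) * (inverse (a k x) * inverse (a (k + ?e) x))))"
        using True nz by (auto simp: parametrix_def field_simps)
      finally have "cmod (fourier_coeff (?b (k + ?e)) q - fourier_coeff (?b k) q) \<le> C * bracket k powr (- m - 1) * bracket q powr (- N)"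
        using C(2)[OF True, of q] by simp
      moreover have "0 \<le> E * bracket k powr (- m - 1) * bracket q powr (- N)" using E0 by simp
      ultimately show ?thesis by (simp add: distrib_right)
    next
      case False
      \<comment> \<open>At least one of \<open>k\<close> and its neighbour lies in the ball of
        radius R, and their brackets differ by at most the factor 2.\<close>
      then have "bracket k \<le> 2 * (1 + R)"
        using bracket_axis_add_le(2)[of k i] R by (auto simp: bracket_def not_less)
      then have bracket: "bracket k powr (- m) \<le> 2 * (1 + R) * bracket k powr (- m - 1)"
      proof -
        have "bracket k powr (- m) = bracket k * bracket k powr (- m - 1)"
          using powr_add[of "bracket k" 1 "- m - 1"] bracket_pos[of k] by simp
        then show ?thesis using mult_right_mono[OF \<open>bracket k \<le> 2 * (1 + R)\<close> bracket_powr_nonneg[of k "- m - 1"]] by simp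
      qed
      have "cmod (fourier_coeff (?b (k + ?e)) q - fourier_coeff (?b k) q) \<le> cmod (fourier_coeff (?b (k + ?e)) q) + cmod (fourier_coeff (?b k) q)"
        by (rule norm_triangle_ineq4)
      also have "\<dots> \<le> D * bracket (k + ?e) powr (- m) * bracket q powr (- N) + D * bracket k powr (- m) * bracket q powr (- N)"
        by (intro add_mono D)
      also have "\<dots> \<le> D * (bracket k powr (- m) * 2 powr \<bar>m\<bar>) * bracket q powr (- N) + D * bracket k powr (- m) * bracket q powr (- N)"
        using peetre[of "k + ?e" "- m" k] D(1)
        by (intro add_mono mult_right_mono mult_left_mono) (auto simp: bracket_axis)
      also have "\<dots> = D * (2 powr \<bar>m\<bar> + 1) * bracket k powr (- m) * bracket q powr (- N)" by (simp add: algebra_simps)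
      also have "\<dots> \<le> D * (2 powr \<bar>m\<bar> + 1) * (2 * (1 + R) * bracket k powr (- m - 1)) * bracket q powr (- N)"
        using D(1) by (intro mult_right_mono mult_left_mono bracket) auto
      also have "\<dots> = E * bracket k powr (- m - 1) * bracket q powr (- N)" by (simp add: E_def)
      also have "\<dots> \<le> (C + E) * bracket k powr (- m - 1) * bracket q powr (- N)"
        using C(1) by (intro mult_right_mono) auto
      finally show ?thesis .
    qed
    then show ?thesis using C(1) E0 by (intro exI[of _ "C + E"]) auto
  qed
  show ?thesis unfolding fourier_symbol_def using bt dec dif by blast
qed

text \<open>The inverse symbol vanishes for small \<open>k\<close>; the resulting defect is supported on finitely many
  diagonal entries.\<close>

lemma offdiag_cutoff:
  assumes "R > 0"
  shows "offdiag (- 1) (\<lambda>k l :: int ^ 'n::finite. if k = l \<and> \<not> znorm k > R then - 1 else 0)"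
  unfolding offdiag_def
proof (intro allI impI)
  fix N :: real
  have "cmod (if k = l \<and> \<not> znorm k > R then - 1 else 0) \<le> (1 + R) * bracket k powr (- 1) * bracket (k - l) powr (- N)" for k l :: "int ^ 'n"
  proof (cases "k = l \<and> \<not> znorm k > R")
    case True
    then have "k = l" "bracket l \<le> 1 + R" by (auto simp: bracket_def)
    then show ?thesis using True bracket_pos[of l] by (simp add: bracket_zero powr_minus_divide field_simps)
  next
    case False
    then show ?thesis using assms by (simp only: if_False) simp
  qed
  then show "\<exists>C\<ge>0. \<forall>k l :: int ^ 'n. cmod (if k = l \<and> \<not> znorm k > R then - 1 else 0) \<le> C * bracket k powr (- 1) * bracket (k - l) powr (- N)"
    using assms by (intro exI[of _ "1 + R"]) auto
qed

text \<open>The orders m and -m leave an error of order -1. The product of the symbols is 1 outside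
  the ball, and the coefficients of the constant 1 form the identity matrix; the missing diagonal
  entries inside the ball go into the remainder.\<close>

lemma parametrix_remainder:
  fixes f g :: "'n::finite lattice_symbol"
  assumes f: "fourier_symbol m f" and g: "fourier_symbol (- m) g" and R: "R > 0"
    and fg: "\<And>k x. f k x * g k x = (if znorm k > R then 1 else 0)"
  obtains E where "offdiag (- 1) E"
    "\<And>k l. mat_comp (symbol_matrix f) (symbol_matrix g) k l = mat_id k l + E k l"
proof -
  let ?E = "\<lambda>k l. (mat_comp (symbol_matrix f) (symbol_matrix g) k l - fourier_coeff (\<lambda>x. f k x * g k x) (l - k))
     + (if k = l \<and> \<not> znorm k > R then - 1 else 0)"
  have "offdiag (m + - m - 1) (\<lambda>k l. mat_comp (symbol_matrix f) (symbol_matrix g) k l - fourier_coeff (\<lambda>x. f k x * g k x) (l - k))"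
    by (rule symbol_matrix_comp[OF f g])
  then have "offdiag (- 1) ?E" by (intro offdiag_add offdiag_cutoff R) simp
  moreover have "mat_comp (symbol_matrix f) (symbol_matrix g) k l = mat_id k l + ?E k l" for k l
  proof (cases "znorm k > R")
    case True
    have "fourier_coeff (\<lambda>x. f k x * g k x) (l - k) = fourier_coeff (torus_char 0) (l - k)"
      using True by (simp add: fg fourier_coeff_def)
    then show ?thesis using True by (auto simp: fourier_coeff_ef mat_id_def)
  next
    case False
    have "fourier_coeff (\<lambda>x. f k x * g k x) (l - k) = 0" using False by (simp add: fg fourier_coeff_def)
    then show ?thesis using False by (simp add: mat_id_def)
  qed
  ultimately show ?thesis by (rule that)
qed

theorem theorem2p7:
  fixes a :: "int ^ 'n::finite \<Rightarrow> real ^ 'n \<Rightarrow> complex" and m s1 s2 :: real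
  assumes "a \<in> elliptic_symbols m"
    and "m > s1 - s2"
  shows "essentially_adjoint_pair s1 s2
           (restricted_op (pdo a) schwartz)
           (restricted_op (formal_adjoint (pdo a)) schwartz)"
proof -
  obtain c R where a: "a \<in> symbols m" and c: "c > 0" and R: "R > 0"
    and ell: "\<And>k x. znorm k > R \<Longrightarrow> cmod (a k x) \<ge> c * bracket k powr m"
    using assms(1) unfolding elliptic_symbols_def bracket_def by auto
  let ?b = "parametrix R a"
  note fa = symbols_fourier[OF a]
  note fb = fourier_symbol_parametrix[OF a c R ell]
  have nz: "a k x \<noteq> 0" if "znorm k > R" for k x
    using ell[OF that, of x] mult_pos_pos[OF c bracket_powr_pos[of k m]] by auto
  \<comment> \<open>The left parametrix, which governs the closure of \<open>pdo a\<close>.\<close>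
  obtain E where E: "offdiag (- 1) E" "\<And>k l. mat_comp (symbol_matrix ?b) (symbol_matrix a) k l = mat_id k l + E k l"
    by (rule parametrix_remainder[where f = ?b and g = a and m = "- m", OF _ _ R])
      (use fa fb nz in \<open>auto simp: parametrix_def intro: that\<close>)
  \<comment> \<open>The right parametrix, which governs the closure of the formal adjoint.\<close>
  obtain E' where E': "offdiag (- 1) E'" "\<And>k l. mat_comp (symbol_matrix a) (symbol_matrix ?b) k l = mat_id k l + E' k l"
    by (rule parametrix_remainder[where f = a and g = ?b and m = m, OF fa fb R])
      (use nz in \<open>auto simp: parametrix_def intro: that\<close>)
  show ?thesis
    by (rule essentially_adjoint_offdiag[OF offdiag_symbol_matrix[OF fa] offdiag_symbol_matrix[OF fb] E(1) E'(1) E(2) E'(2)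
          pdo_eq_mat_apply[OF fourier_symbol_cont[OF fa]] assms(2)])
qed

end
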